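(* Let $M$ be a regular matroid with ground set $E$, represented by a totally unimodular matrix $A$. Then $\mathcal{G}(M)$ is canonically a torsor for $\mathrm{Jac}(M)\cong \mathbb{Z}^E/(\Lambda_A(M)\oplus\Lambda_A^*(M))$. More precisely, the following rule gives a well-defined action of $\mathrm{Jac}(M)$ on $\mathcal{G}(M)$, and this action is simply transitive: for $e\in E$, $s\in\{1,-1\}$ and a class $c\in\mathcal{G}(M)$, choose an orientation $\mathcal{O}$ in $c$ with $\mathcal{O}(e)=s$, let $\mathcal{O}'$ be the orientation obtained from $\mathcal{O}$ by reversing the sign at $e$ only, and set $[s\,u_e]\cdot c=[\mathcal{O}']$; extend linearly to all of $\mathrm{Jac}(M)$. (Well-defined means that such an $\mathcal{O}$ always exists, that $[\mathcal{O}']$ does not depend on its choice, that the rule extends to an action of $\mathbb{Z}^E$ on $\mathcal{G}(M)$, and that this action descends to the quotient $\mathbb{Z}^E/(\Lambda_A(M)\oplus\Lambda_A^*(M))$.)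
   Context: $A$ is an $r\times m$ integer matrix of rank $r$, totally unimodular (every square submatrix has determinant in $\{0,\pm1\}$), with columns indexed by $E$, and $M$ is the matroid on $E$ of linear independence of the columns of $A$. A matroid is regular if it is represented over $\mathbb{Q}$ by such a matrix. $u_e\in\mathbb{Z}^E$ is the standard basis vector indexed by $e$. $\Lambda_A(M)=\ker(A)\cap\mathbb{Z}^E$ and $\Lambda_A^*(M)$ is the intersection of the row space of $A$ with $\mathbb{Z}^E$. The Jacobian group is $\mathrm{Jac}(M)=\Lambda^\#/\Lambda$, where $\Lambda=\Lambda_A(M)$ and $\Lambda^\#=\{x\in\Lambda\otimes\mathbb{Q}:\langle x,y\rangle\in\mathbb{Z}\ \forall y\in\Lambda\}$; it is canonically isomorphic to $\mathbb{Z}^E/(\Lambda_A(M)\oplus\Lambda_A^*(M))$, and is identified with this quotient. $[\gamma]$ denotes the class of $\gamma\in\mathbb{Z}^E$. A signed circuit of $M$ is a nonzero vector in $\Lambda_A(M)$ with all entries in $\{0,\pm1\}$ whose support is a circuit of $M$; a signed cocircuit is a nonzero vector in $\Lambda_A^*(M)$ with all entries in $\{0,\pm1\}$ whose support is a cocircuit of $M$. An orientation of $M$ is a function $\mathcal{O}:E\to\{-1,1\}$. It is compatible with a signed circuit (or cocircuit) $C$ if $\mathcal{O}(e)=C(e)$ for all $e$ in the support of $C$; in that case the (co)circuit reversal along $C$ replaces $\mathcal{O}$ by the orientation that is $-\mathcal{O}(e)$ on the support of $C$ and $\mathcal{O}(e)$ elsewhere. $\mathcal{G}(M)$ is the set of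 equivalence classes of orientations under the equivalence relation generated by all circuit reversals and all cocircuit reversals; $[\mathcal{O}]$ is the class of $\mathcal{O}$. *)

theory Defs
  imports
    "Jordan_Normal_Form.DL_Rank"
    "Jordan_Normal_Form.DL_Submatrix"
    "Jordan_Normal_Form.Matrix_Kernel"
    "HOL-Algebra.Group_Action"
begin

(* The ground set is E = {0..<m}, the set of column indices of an r x m matrix; Z^E and Q^E are
   carrier_vec m over int and rat. Both r = 0 and m = 0 are allowed. *)

definition totally_unimodular :: "int mat \<Rightarrow> bool" where
  "totally_unimodular A \<longleftrightarrow>
    (\<forall>I J. I \<subseteq> {0..<dim_row A} \<longrightarrow> J \<subseteq> {0..<dim_col A} \<longrightarrow> card I = card J \<longrightarrow>
      det (submatrix A I J) \<in> {-1, 0, 1})"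

abbreviation rat_mat :: "int mat \<Rightarrow> rat mat" where
  "rat_mat A \<equiv> map_mat rat_of_int A"

abbreviation rat_vec :: "int vec \<Rightarrow> rat vec" where
  "rat_vec v \<equiv> map_vec rat_of_int v"


section \<open>The matroid of a matrix\<close>

(* Independence of columns as an indexed family: injectivity makes equal columns with different
   indices dependent. *)
definition matroid_indep :: "int mat \<Rightarrow> nat set set" where
  "matroid_indep A = {S. S \<subseteq> {0..<dim_col A} \<and> inj_on (col (rat_mat A)) S \<and>
     \<not> module.lin_dep class_ring (module_vec TYPE(rat) (dim_row A)) (col (rat_mat A) ` S)}"

definition bases_of :: "nat set set \<Rightarrow> nat set set" where
  "bases_of \<I> = {B \<in> \<I>. \<forall>B'\<in>\<I>. B \<subseteq> B' \<longrightarrow> B' = B}"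

definition dual_indep :: "nat set \<Rightarrow> nat set set \<Rightarrow> nat set set" where
  "dual_indep E \<I> = {S. S \<subseteq> E \<and> (\<exists>B\<in>bases_of \<I>. S \<inter> B = {})}"

definition circuits_of :: "nat set \<Rightarrow> nat set set \<Rightarrow> nat set set" where
  "circuits_of E \<I> = {C. C \<subseteq> E \<and> C \<notin> \<I> \<and> (\<forall>D. D \<subset> C \<longrightarrow> D \<in> \<I>)}"

definition circuits :: "int mat \<Rightarrow> nat set set" where
  "circuits A = circuits_of {0..<dim_col A} (matroid_indep A)"

definition cocircuits :: "int mat \<Rightarrow> nat set set" where
  "cocircuits A = circuits_of {0..<dim_col A} (dual_indep {0..<dim_col A} (matroid_indep A))"


section \<open>Lattices and the Jacobian group\<close>

definition circuit_lattice :: "int mat \<Rightarrow> int vec set" where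
  "circuit_lattice A = mat_kernel A"

definition cocircuit_lattice :: "int mat \<Rightarrow> int vec set" where
  "cocircuit_lattice A =
     {y \<in> carrier_vec (dim_col A). rat_vec y \<in> vec_space.row_space (dim_col A) (rat_mat A)}"

definition lattice_sum :: "int mat \<Rightarrow> int vec set" where
  "lattice_sum A = {x + y | x y. x \<in> circuit_lattice A \<and> y \<in> cocircuit_lattice A}"

(* L \<otimes> Q is realised as the rational span of L in Q^n. *)
definition dual_lattice :: "nat \<Rightarrow> int vec set \<Rightarrow> rat vec set" where
  "dual_lattice n L =
     {x \<in> LinearCombinations.module.span class_ring (module_vec TYPE(rat) n) (rat_vec ` L).
        \<forall>y\<in>L. x \<bullet> rat_vec y \<in> \<int>}"

definition Jac :: "int mat \<Rightarrow> rat vec set monoid" where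
  "Jac A = (monoid_vec TYPE(rat) (dim_col A)
               \<lparr>carrier := dual_lattice (dim_col A) (circuit_lattice A)\<rparr>)
           Mod (rat_vec ` circuit_lattice A)"

definition jac_class :: "int mat \<Rightarrow> rat vec \<Rightarrow> rat vec set" where
  "jac_class A x =
     rat_vec ` circuit_lattice A #>\<^bsub>monoid_vec TYPE(rat) (dim_col A)\<^esub> x"

definition lattice_quotient :: "int mat \<Rightarrow> int vec set monoid" where
  "lattice_quotient A = monoid_vec TYPE(int) (dim_col A) Mod lattice_sum A"

definition quotient_class :: "int mat \<Rightarrow> int vec \<Rightarrow> int vec set" where
  "quotient_class A \<gamma> = lattice_sum A #>\<^bsub>monoid_vec TYPE(int) (dim_col A)\<^esub> \<gamma>"

(* The canonical isomorphism is induced by the orthogonal projection \<gamma> \<mapsto> x of Z^E onto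
   the rational span of the circuit lattice. *)
definition canonical_jac_iso :: "int mat \<Rightarrow> (int vec set \<Rightarrow> rat vec set) \<Rightarrow> bool" where
  "canonical_jac_iso A \<psi> \<longleftrightarrow>
     \<psi> \<in> iso (lattice_quotient A) (Jac A) \<and>
     (\<forall>\<gamma>\<in>carrier_vec (dim_col A).
        \<exists>x\<in>dual_lattice (dim_col A) (circuit_lattice A).
          (\<forall>y\<in>circuit_lattice A. (rat_vec \<gamma> - x) \<bullet> rat_vec y = 0) \<and>
          \<psi> (quotient_class A \<gamma>) = jac_class A x)"


section \<open>Orientations and their reversal classes\<close>

definition supp :: "int vec \<Rightarrow> nat set" where
  "supp v = {i. i < dim_vec v \<and> v $ i \<noteq> 0}"

definition signed_circuit :: "int mat \<Rightarrow> int vec \<Rightarrow> bool" where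
  "signed_circuit A C \<longleftrightarrow> C \<in> circuit_lattice A \<and> C \<noteq> 0\<^sub>v (dim_col A) \<and>
     (\<forall>i<dim_col A. C $ i \<in> {-1, 0, 1}) \<and> supp C \<in> circuits A"

definition signed_cocircuit :: "int mat \<Rightarrow> int vec \<Rightarrow> bool" where
  "signed_cocircuit A C \<longleftrightarrow> C \<in> cocircuit_lattice A \<and> C \<noteq> 0\<^sub>v (dim_col A) \<and>
     (\<forall>i<dim_col A. C $ i \<in> {-1, 0, 1}) \<and> supp C \<in> cocircuits A"

definition orientations :: "int mat \<Rightarrow> int vec set" where
  "orientations A = {X \<in> carrier_vec (dim_col A). \<forall>i<dim_col A. X $ i \<in> {-1, 1}}"

definition compatible :: "int vec \<Rightarrow> int vec \<Rightarrow> bool" where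
  "compatible X C \<longleftrightarrow> (\<forall>i\<in>supp C. X $ i = C $ i)"

definition negate_on :: "nat set \<Rightarrow> int vec \<Rightarrow> int vec" where
  "negate_on S X = vec (dim_vec X) (\<lambda>i. if i \<in> S then - X $ i else X $ i)"

definition reversal :: "int mat \<Rightarrow> int vec \<Rightarrow> int vec \<Rightarrow> bool" where
  "reversal A X Y \<longleftrightarrow> X \<in> orientations A \<and>
     (\<exists>C. (signed_circuit A C \<or> signed_cocircuit A C) \<and> compatible X C \<and> Y = negate_on (supp C) X)"

definition reversal_equiv :: "int mat \<Rightarrow> (int vec \<times> int vec) set" where
  "reversal_equiv A =
     {(X, Y). X \<in> orientations A \<and> Y \<in> orientations A \<and> equivclp (reversal A) X Y}"

definition reversal_classes :: "int mat \<Rightarrow> int vec set set" where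
  "reversal_classes A = orientations A // reversal_equiv A"

definition orient_class :: "int mat \<Rightarrow> int vec \<Rightarrow> int vec set" where
  "orient_class A X = reversal_equiv A `` {X}"


section \<open>Torsors and the sign reversal rule\<close>

definition torsor ::
  "('g, 'b) monoid_scheme \<Rightarrow> 'x set \<Rightarrow> ('g \<Rightarrow> 'x \<Rightarrow> 'x) \<Rightarrow> bool" where
  "torsor G X \<phi> \<longleftrightarrow> group_action G X \<phi> \<and> X \<noteq> {} \<and>
     (\<forall>x\<in>X. \<forall>y\<in>X. \<exists>!g. g \<in> carrier G \<and> \<phi> g x = y)"

(* Actions of Z^E on the reversal classes extending the rule on the elements s u_e.
   extensional only fixes the irrelevant values of \<phi> outside Z^E, so that uniqueness of
   \<phi> can be asserted. *)
definition rule_action :: "int mat \<Rightarrow> (int vec \<Rightarrow> int vec set \<Rightarrow> int vec set) \<Rightarrow> bool" where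
  "rule_action A \<phi> \<longleftrightarrow>
     group_action (monoid_vec TYPE(int) (dim_col A)) (reversal_classes A) \<phi> \<and>
     \<phi> \<in> extensional (carrier_vec (dim_col A)) \<and>
     (\<forall>e<dim_col A. \<forall>s\<in>{1, -1}. \<forall>c\<in>reversal_classes A. \<forall>X\<in>c. X $ e = s \<longrightarrow>
        \<phi> (s \<cdot>\<^sub>v unit_vec (dim_col A) e) c = orient_class A (negate_on {e} X))"

end

theory Submission
  imports Defs
begin

text \<open>
  Identify an orientation with a sign vector \<open>X \<in> {-1, 1}\<^sup>E\<close>. Reversing a compatible signed circuit or
  cocircuit \<open>C\<close> replaces \<open>X\<close> by \<open>X - 2 C\<close>, and reversing the sign \<open>s\<close> at \<open>e\<close> replaces it by
  \<open>X - 2 s u\<^sub>e\<close>. Write \<open>L\<close> for the circuit lattice, \<open>L'\<close> for the cocircuit lattice and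
  \<open>S = L + L'\<close>. The theorem holds because two orientations are equivalent exactly if they are
  congruent modulo \<open>2 S\<close>, and every vector with odd entries is congruent to an orientation modulo
  \<open>2 S\<close>. So the reversal classes are the residue classes modulo \<open>2 S\<close> of odd vectors; on these the
  group \<open>\<int>\<^sup>E\<close> acts by \<open>\<gamma> \<cdot> x = x - 2 \<gamma>\<close>, transitively and with all stabilisers equal to \<open>S\<close>, and
  this action is the one that the sign reversal rule prescribes.

  Congruent orientations are equivalent (\<open>equivclp_reversal_iff\<close>): if \<open>X - Y = 2 (a + b)\<close> with
  \<open>a \<in> L\<close> and \<open>b \<in> L'\<close>, then \<open>z = a + b\<close> has entries in \<open>{-1, 0, 1}\<close>, so every product
  \<open>a\<^sub>i b\<^sub>i = a\<^sub>i (z\<^sub>i - a\<^sub>i)\<close> of integers is at most \<open>0\<close>. Since \<open>a\<close> and \<open>b\<close> are orthogonal, all these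
  products vanish (\<open>sign_difference_split\<close>). Hence \<open>a\<close> and \<open>b\<close> have disjoint supports and agree with
  \<open>X\<close> there; decomposing them conformally into signed circuits and cocircuits (\<open>peel_circuits\<close>)
  gives reversals that lead from \<open>X\<close> to \<open>Y\<close>.

  Every odd vector is congruent to an orientation (\<open>reduce_to_signs\<close>): by a lemma of Minty
  (\<open>compatible_circuit_or_cocircuit\<close>), every element lies in a signed circuit or cocircuit \<open>C\<close> that is
  compatible with the signs of \<open>x\<close>, and if \<open>\<bar>x\<^sub>e\<bar> > 1\<close> for some \<open>e\<close> in its support, then \<open>x - 2 C\<close> is
  smaller than \<open>x\<close>.

  Total unimodularity enters only through \<open>fundamental_row\<close>: by Cramer's rule the fundamental cocircuits
  of a basis have entries in \<open>{-1, 0, 1}\<close>. Orthogonality transfers this to fundamental circuits and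
  then to all vectors of minimal support in \<open>L\<close> and \<open>L'\<close>. What follows from such a pair of lattices is
  derived in the locale \<open>regular_lattice_pair\<close>, without reference to a matrix.

  As there are finitely many orientations, every \<open>\<gamma>\<close> has a positive multiple in \<open>S\<close>. This provides the
  orthogonal projection of \<open>\<int>\<^sup>E\<close> to the rational span of \<open>L\<close>. It maps onto
  the dual lattice of \<open>L\<close>, because the dual basis of the fundamental circuits of a basis consists of
  projections of unit vectors, and \<open>S\<close> is the preimage of \<open>L\<close>; so it induces the canonical isomorphism
  of \<open>\<int>\<^sup>E / S\<close> with the Jacobian group.
\<close>

section \<open>Vectors of minimal support in a lattice\<close>

text \<open>
  Saturation makes the lattice the set of all integral points of a rational subspace. It allows
  vectors of the lattice to be divided by common factors of their entries.
\<close>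
locale saturated_lattice =
  fixes m :: nat and L :: "int vec set"
  assumes carrier: "L \<subseteq> carrier_vec m"
    and zero: "0\<^sub>v m \<in> L"
    and add: "v \<in> L \<Longrightarrow> w \<in> L \<Longrightarrow> v + w \<in> L"
    and smult: "v \<in> L \<Longrightarrow> k \<cdot>\<^sub>v v \<in> L"
    and saturated: "v \<in> carrier_vec m \<Longrightarrow> k \<noteq> 0 \<Longrightarrow> k \<cdot>\<^sub>v v \<in> L \<Longrightarrow> v \<in> L"
begin

lemma dim [simp]: "v \<in> L \<Longrightarrow> dim_vec v = m"
  using carrier by auto

lemma vec_mem [simp]: "v \<in> L \<Longrightarrow> v \<in> carrier_vec m"
  using carrier by auto

lemma int_combination: "v \<in> L \<Longrightarrow> w \<in> L \<Longrightarrow> a \<cdot>\<^sub>v v + b \<cdot>\<^sub>v w \<in> L"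
  by (simp add: add smult)

lemma diff: "v \<in> L \<Longrightarrow> w \<in> L \<Longrightarrow> v - w \<in> L"
proof -
  assume *: "v \<in> L" "w \<in> L"
  have "v - w = 1 \<cdot>\<^sub>v v + (-1) \<cdot>\<^sub>v w" using * by (intro eq_vecI) auto
  with int_combination[OF *] show ?thesis by metis
qed

definition elementary :: "int vec \<Rightarrow> bool" where
  "elementary v \<longleftrightarrow> v \<in> L \<and> v \<noteq> 0\<^sub>v m \<and> (\<forall>w\<in>L. supp w \<subset> supp v \<longrightarrow> w = 0\<^sub>v m)"

definition free :: "nat set \<Rightarrow> bool" where
  "free S \<longleftrightarrow> (\<forall>v\<in>L. supp v \<subseteq> S \<longrightarrow> v = 0\<^sub>v m)"

definition maximal_free :: "nat set \<Rightarrow> nat set \<Rightarrow> bool" where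
  "maximal_free B S \<longleftrightarrow> B \<subseteq> S \<and> free B \<and> (\<forall>i\<in>S - B. \<not> free (insert i B))"

end

definition conformal :: "int vec \<Rightarrow> int vec \<Rightarrow> bool" where
  "conformal w v \<longleftrightarrow> (\<forall>i<dim_vec w. w $ i \<noteq> 0 \<longrightarrow> 0 < w $ i * v $ i)"

lemma conformal_trans:
  assumes "conformal u w" "conformal w v" "dim_vec u = dim_vec w"
  shows "conformal u v"
  unfolding conformal_def
proof (intro allI impI)
  fix i assume i: "i < dim_vec u" "u $ i \<noteq> 0"
  then have uw: "0 < u $ i * w $ i" using assms by (auto simp: conformal_def)
  then have "w $ i \<noteq> 0" by auto
  then have "0 < w $ i * v $ i" using assms i by (auto simp: conformal_def)
  with uw show "0 < u $ i * v $ i"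
    by (auto simp: zero_less_mult_iff)
qed

lemma supp_conformal: "conformal w v \<Longrightarrow> dim_vec w = dim_vec v \<Longrightarrow> supp w \<subseteq> supp v"
  by (force simp: conformal_def supp_def)

lemma finite_supp [simp]: "finite (supp v)"
  by (simp add: supp_def)

lemma mem_supp: "v \<in> carrier_vec m \<Longrightarrow> i \<in> supp v \<longleftrightarrow> i < m \<and> v $ i \<noteq> 0"
  by (auto simp: supp_def)

lemma supp_empty: "v \<in> carrier_vec m \<Longrightarrow> supp v = {} \<longleftrightarrow> v = 0\<^sub>v m"
  by (auto simp: supp_def intro!: eq_vecI)

lemma eq_of_diff_zero:
  fixes v w :: "int vec"
  assumes "v \<in> carrier_vec m" "w \<in> carrier_vec m" "v - w = 0\<^sub>v m"
  shows "v = w"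
proof (intro eq_vecI)
  fix i assume "i < dim_vec w"
  then have i: "i < m" using assms by simp
  have "v $ i - w $ i = (v - w) $ i" using i assms(1,2) by simp
  also have "\<dots> = 0" unfolding assms(3) using i by simp
  finally show "v $ i = w $ i" by simp
qed (use assms in auto)

context saturated_lattice
begin

lemma zeroI: "v \<in> L \<Longrightarrow> (\<And>i. i < m \<Longrightarrow> v $ i = 0) \<Longrightarrow> v = 0\<^sub>v m"
  by (auto intro!: eq_vecI)

lemma nonzero_entry:
  assumes "v \<in> L" "v \<noteq> 0\<^sub>v m" obtains i where "i < m" "v $ i \<noteq> 0"
  using assms zeroI by blast

text \<open>
  Subtracting a multiple of \<open>u\<close> from \<open>w\<close> until the first entry vanishes keeps the signs of \<open>w\<close>. The sign
  of \<open>u\<close> is chosen such that the entry at \<open>e\<close> does not move towards zero and hence survives.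
\<close>
lemma shrink_support:
  assumes w: "w \<in> L" "w $ e \<noteq> 0" and e: "e < m"
    and u: "u \<in> L" "u \<noteq> 0\<^sub>v m" "supp u \<subset> supp w"
  shows "\<exists>w'\<in>L. w' $ e \<noteq> 0 \<and> conformal w' w \<and> supp w' \<subset> supp w"
proof -
  have supD: "w $ i \<noteq> 0" if "u $ i \<noteq> 0" "i < m" for i
    using u(3) that mem_supp[OF vec_mem[OF u(1)]] mem_supp[OF vec_mem[OF w(1)]] by auto
  obtain f0 where f0: "f0 < m" "u $ f0 \<noteq> 0" using nonzero_entry u by blast
  \<comment> \<open>If \<open>u $ e = 0\<close>, then the entry at \<open>e\<close> is safe with either sign, and the sign is chosen such that
    some entry of \<open>w\<close> does move towards zero.\<close>
  define s :: int where "s = (if u $ e \<noteq> 0 then - sgn (u $ e * w $ e) else sgn (u $ f0 * w $ f0))"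
  define t where "t = s \<cdot>\<^sub>v u"
  have s: "s \<noteq> 0" using f0 supD w(2) by (auto simp: s_def sgn_eq_0_iff)
  have tL: "t \<in> L" using u smult t_def by auto
  have ti: "t $ i = s * u $ i" if "i < m" for i using that u(1) by (simp add: t_def)
  have supt: "supp t = supp u" using s u(1) by (auto simp: supp_def t_def)
  have te: "t $ e * w $ e \<le> 0"
    using ti[OF e] by (auto simp: s_def sgn_if mult_le_0_iff zero_le_mult_iff zero_less_mult_iff split: if_splits)
  have t0: "t $ f0 * w $ f0 > 0" if "u $ e = 0"
    using ti[OF f0(1)] that f0 supD[OF f0(2,1)]
    by (auto simp: s_def sgn_if mult_less_0_iff zero_less_mult_iff split: if_splits)
  have suptD: "w $ i \<noteq> 0" if "t $ i \<noteq> 0" "i < m" for i using supD ti that by auto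
  show ?thesis
  proof (cases "\<exists>f<m. t $ f * w $ f > 0")
    case False
    then have ne: "u $ e \<noteq> 0" using t0 f0 by auto
    \<comment> \<open>No entry of \<open>w\<close> moves towards zero, so \<open>-t\<close> itself has the signs of \<open>w\<close>.\<close>
    have "conformal ((-1) \<cdot>\<^sub>v t) w"
      unfolding conformal_def
    proof (intro allI impI)
      fix i assume i: "i < dim_vec ((-1) \<cdot>\<^sub>v t)" "((-1) \<cdot>\<^sub>v t) $ i \<noteq> 0"
      then have "i < m" "t $ i \<noteq> 0" using tL by auto
      moreover then have "w $ i \<noteq> 0" using suptD by auto
      moreover have "t $ i * w $ i \<le> 0" using False \<open>i < m\<close> by auto
      ultimately have "t $ i * w $ i < 0" by (metis antisym_conv2 mult_eq_0_iff)
      then show "0 < ((-1) \<cdot>\<^sub>v t) $ i * w $ i" using \<open>i < m\<close> tL by auto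
    qed
    moreover have "((-1) \<cdot>\<^sub>v t) $ e \<noteq> 0" using ti[OF e] s ne tL e by auto
    moreover have "supp ((-1) \<cdot>\<^sub>v t) = supp t" using tL by (auto simp: supp_def)
    ultimately show ?thesis using smult[OF tL] supt u(3) by metis
  next
    case True
    define P where "P = {f. f < m \<and> t $ f * w $ f > 0}"
    \<comment> \<open>The entry that reaches zero first is one that minimises the ratio \<open>q\<close>.\<close>
    define q where "q f = rat_of_int \<bar>w $ f\<bar> / rat_of_int \<bar>t $ f\<bar>" for f
    have "finite P" "P \<noteq> {}" using True by (auto simp: P_def)
    then obtain f where f: "f \<in> P" "\<And>g. g \<in> P \<Longrightarrow> q f \<le> q g"
      using arg_min_if_finite[of P q] by (metis not_le)
    have fP: "f < m" "t $ f * w $ f > 0" using f by (auto simp: P_def)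
    define x where "x = \<bar>t $ f\<bar> \<cdot>\<^sub>v w + (- \<bar>w $ f\<bar>) \<cdot>\<^sub>v t"
    have xL: "x \<in> L" unfolding x_def using int_combination w tL by blast
    have xi: "x $ i = \<bar>t $ f\<bar> * w $ i - \<bar>w $ f\<bar> * t $ i" if "i < m" for i
      using that w(1) tL by (simp add: x_def)
    have tf: "\<bar>t $ f\<bar> > 0" using fP by auto
    have key: "x $ g * w $ g = \<bar>t $ f\<bar> * (w $ g * w $ g) - \<bar>w $ f\<bar> * (t $ g * w $ g)" if "g < m" for g
      unfolding xi[OF that] by (simp add: algebra_simps)
    have pos: "0 < x $ g * w $ g" if g: "g < m" "w $ g \<noteq> 0" "t $ g * w $ g \<le> 0" for g
    proof -
      have "0 < \<bar>t $ f\<bar> * (w $ g * w $ g)" using g tf by (metis mult_pos_pos not_square_less_zero mult_eq_0_iff linorder_neqE_linordered_idom)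
      moreover have "\<bar>w $ f\<bar> * (t $ g * w $ g) \<le> 0" using g by (simp add: mult_nonneg_nonpos)
      ultimately show ?thesis using key[OF g(1)] by linarith
    qed
    have conf: "conformal x w"
      unfolding conformal_def
    proof (intro allI impI)
      fix g assume g: "g < dim_vec x" "x $ g \<noteq> 0"
      then have gm: "g < m" using xL by auto
      have wg: "w $ g \<noteq> 0" using g xi[OF gm] suptD[OF _ gm] by auto
      show "0 < x $ g * w $ g"
      proof (cases "t $ g * w $ g \<le> 0")
        case True then show ?thesis using pos gm wg by blast
      next
        case False
        then have gP: "g \<in> P" using gm by (auto simp: P_def)
        have tg: "t $ g \<noteq> 0" using False by auto
        have "q f \<le> q g" using f gP by blast
        then have "rat_of_int \<bar>w $ f\<bar> * rat_of_int \<bar>t $ g\<bar> \<le> rat_of_int \<bar>w $ g\<bar> * rat_of_int \<bar>t $ f\<bar>"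
          using tg tf by (simp add: q_def divide_simps mult.commute)
        then have le: "\<bar>w $ f\<bar> * \<bar>t $ g\<bar> \<le> \<bar>w $ g\<bar> * \<bar>t $ f\<bar>"
          by (metis of_int_le_iff of_int_mult)
        have "t $ g * w $ g = \<bar>t $ g\<bar> * \<bar>w $ g\<bar>" using False by (metis abs_mult abs_of_nonneg linear)
        then have "x $ g * w $ g = (\<bar>w $ g\<bar> * \<bar>t $ f\<bar> - \<bar>w $ f\<bar> * \<bar>t $ g\<bar>) * \<bar>w $ g\<bar>"
          using key[OF gm] by (simp add: algebra_simps)
        then have "x $ g * w $ g \<ge> 0" using le by simp
        moreover have "x $ g * w $ g \<noteq> 0" using g wg by simp
        ultimately show ?thesis by linarith
      qed
    qed
    have "x $ f = 0" using xi[OF fP(1)] fP(2) by (auto simp: abs_if zero_less_mult_iff)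
    moreover have "f \<in> supp w" using fP w(1) by (auto simp: supp_def)
    ultimately have "supp x \<subset> supp w" using supp_conformal[OF conf] xL w(1) by (auto simp: supp_def)
    moreover have "x $ e \<noteq> 0" using pos[OF e w(2) te] by auto
    ultimately show ?thesis using conf xL by blast
  qed
qed

text \<open>
  Among the vectors of the lattice that are conformal to \<open>v\<close> and nonzero at \<open>e\<close>, one of minimal support
  has minimal support in the whole lattice, since otherwise its support could be shrunk.
\<close>
lemma conformal_elementary:
  assumes "v \<in> L" "e < m" "v $ e \<noteq> 0"
  shows "\<exists>w. elementary w \<and> w $ e \<noteq> 0 \<and> conformal w v"
  using assms
proof (induction "card (supp v)" arbitrary: v rule: less_induct)
  case less
  show ?case
  proof (cases "elementary v")
    case True
    moreover have "conformal v v"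
      by (simp add: conformal_def) (metis mult_eq_0_iff not_square_less_zero linorder_neqE_linordered_idom)
    ultimately show ?thesis using less.prems by blast
  next
    case False
    moreover have "v \<noteq> 0\<^sub>v m" using less.prems by auto
    ultimately obtain u where "u \<in> L" "u \<noteq> 0\<^sub>v m" "supp u \<subset> supp v"
      using less.prems by (auto simp: elementary_def)
    from shrink_support[OF less.prems(1,3,2) this]
    obtain w where w: "w \<in> L" "w $ e \<noteq> 0" "conformal w v" "supp w \<subset> supp v" by blast
    then have "card (supp w) < card (supp v)" by (simp add: psubset_card_mono)
    from less.hyps[OF this w(1) less.prems(2) w(2)]
    obtain x where "elementary x" "x $ e \<noteq> 0" "conformal x w" by blast
    moreover then have "x \<in> L" by (simp add: elementary_def)
    ultimately show ?thesis using conformal_trans[of x w v] w by auto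
  qed
qed

lemma free_empty: "free {}"
  unfolding free_def
proof (intro ballI impI)
  fix v assume "v \<in> L" "supp v \<subseteq> {}"
  then show "v = 0\<^sub>v m" using supp_empty[OF vec_mem] by simp
qed

lemma free_subset: "free S \<Longrightarrow> T \<subseteq> S \<Longrightarrow> free T"
  by (auto simp: free_def)

lemma extend_free:
  assumes "finite S" "F \<subseteq> S" "free F"
  shows "\<exists>B. F \<subseteq> B \<and> maximal_free B S"
  using assms
proof (induction "card (S - F)" arbitrary: F rule: less_induct)
  case less
  show ?case
  proof (cases "maximal_free F S")
    case False
    then obtain i where i: "i \<in> S - F" "free (insert i F)" using less.prems by (auto simp: maximal_free_def)
    have "card (S - insert i F) < card (S - F)"
      using i less.prems by (intro psubset_card_mono) auto
    from less.hyps[OF this] i less.prems show ?thesis by (metis Diff_iff insert_subset)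
  qed auto
qed

lemma maximal_free_circuit:
  assumes "maximal_free B S" "i \<in> S - B" "S \<subseteq> {0..<m}"
  obtains v where "v \<in> L" "supp v \<subseteq> insert i B" "v $ i \<noteq> 0"
proof -
  have "\<not> free (insert i B)" using assms by (simp add: maximal_free_def)
  then obtain v where v: "v \<in> L" "supp v \<subseteq> insert i B" "v \<noteq> 0\<^sub>v m"
    unfolding free_def by blast
  have "v $ i \<noteq> 0"
  proof
    assume "v $ i = 0"
    then have "i \<notin> supp v" by (simp add: supp_def)
    then have "supp v \<subseteq> B" using v by auto
    then show False using v assms by (auto simp: maximal_free_def free_def)
  qed
  with v that show thesis by blast
qed

end

section \<open>Regular pairs of orthogonal lattices\<close>

text \<open>
  The pair formed by the circuit lattice and the cocircuit lattice of a regular matroid. The sets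
  \<open>B\<close> with \<open>P.maximal_free B {0..<m}\<close> are the bases of the matroid. The second axiom, on fundamental
  cocircuits, implies its counterpart for fundamental circuits as well as regularity of both lattices,
  so the roles of the two lattices are symmetric although the axioms are not.
\<close>
locale regular_lattice_pair = P: saturated_lattice m L + D: saturated_lattice m L' for m L L' +
  assumes orth: "x \<in> L \<Longrightarrow> y \<in> L' \<Longrightarrow> x \<bullet> y = 0"
    and fundamental_cocircuit: "P.maximal_free B {0..<m} \<Longrightarrow> j \<in> B \<Longrightarrow>
          \<exists>y\<in>L'. (\<forall>i<m. y $ i \<in> {-1, 0, 1}) \<and> y $ j = 1 \<and> (\<forall>i\<in>B - {j}. y $ i = 0)"
begin

lemma orth_sum: "x \<in> L \<Longrightarrow> y \<in> L' \<Longrightarrow> (\<Sum>i<m. x $ i * y $ i) = 0"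
  using orth[of x y] by (simp add: scalar_prod_def atLeast0LessThan)

lemma orth_single:
  assumes "x \<in> L" "y \<in> L'" "j < m" "\<And>i. i < m \<Longrightarrow> i \<noteq> j \<Longrightarrow> x $ i = 0 \<or> y $ i = 0"
  shows "x $ j * y $ j = 0"
proof -
  have "x $ i * y $ i = 0" if "i \<in> {..<m} - {j}" for i
    using assms(4)[of i] that by auto
  then have "(\<Sum>i<m. x $ i * y $ i) = x $ j * y $ j"
    using assms(3) by (subst sum.remove[of _ j]) (auto simp: sum.neutral)
  with orth_sum[OF assms(1,2)] show ?thesis by simp
qed

lemma orth_pair:
  assumes "x \<in> L" "y \<in> L'" "j < m" "k < m" "j \<noteq> k"
    and "\<And>i. i < m \<Longrightarrow> i \<noteq> j \<Longrightarrow> i \<noteq> k \<Longrightarrow> x $ i = 0 \<or> y $ i = 0"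
  shows "x $ j * y $ j + x $ k * y $ k = 0"
proof -
  have "(\<Sum>i<m. x $ i * y $ i) = x $ j * y $ j + (\<Sum>i\<in>{..<m}-{j}. x $ i * y $ i)"
    using assms by (subst sum.remove[of _ j]) auto
  also have "\<dots> = x $ j * y $ j + (x $ k * y $ k + (\<Sum>i\<in>{..<m}-{j}-{k}. x $ i * y $ i))"
    using assms by (subst sum.remove[of _ k]) auto
  also have "(\<Sum>i\<in>{..<m}-{j}-{k}. x $ i * y $ i) = 0"
    using assms(6) by (intro sum.neutral) fastforce
  finally show ?thesis using orth_sum[OF assms(1,2)] by simp
qed

text \<open>
  A circuit in \<open>insert i B\<close> through \<open>i\<close> meets the support of \<open>y\<close> at most in \<open>i\<close>, so orthogonality forces
  \<open>y\<close> to vanish there.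
\<close>
lemma dual_vanishes:
  assumes "P.maximal_free B S" "S \<subseteq> {0..<m}" "y \<in> L'" "\<And>i. i \<in> B \<Longrightarrow> y $ i = 0" "i \<in> S"
  shows "y $ i = 0"
proof (cases "i \<in> B")
  case False
  then obtain v where v: "v \<in> L" "supp v \<subseteq> insert i B" "v $ i \<noteq> 0"
    using P.maximal_free_circuit assms by blast
  have "v $ i * y $ i = 0"
    using v assms by (intro orth_single) (auto simp: supp_def)
  with v show ?thesis by simp
qed (use assms in auto)

text \<open>
  A circuit vector \<open>w\<close> in \<open>insert i B\<close> and the fundamental cocircuit of \<open>k \<in> B\<close> have at most the
  elements \<open>i\<close> and \<open>k\<close> in common. Orthogonality then reads off the ratio \<open>w $ k / w $ i\<close> from the cocircuit,
  and it lies in \<open>{-1, 0, 1}\<close>; saturation permits division by \<open>w $ i\<close>.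
\<close>
lemma fundamental_circuit:
  assumes B: "P.maximal_free B {0..<m}" and i: "i < m" "i \<notin> B"
  obtains v where "v \<in> L" "\<forall>k<m. v $ k \<in> {-1, 0, 1}" "v $ i = 1" "supp v \<subseteq> insert i B"
proof -
  obtain w where w: "w \<in> L" "supp w \<subseteq> insert i B" "w $ i \<noteq> 0"
    using P.maximal_free_circuit[OF B, of i] i by auto
  have ex: "\<exists>c\<in>{-1,0,1}. w $ k = w $ i * c" if "k < m" for k
  proof (cases "k \<in> B")
    case True
    from fundamental_cocircuit[OF B True] obtain y where
      y: "y \<in> L'" "\<forall>i<m. y $ i \<in> {-1, 0, 1}" "y $ k = 1" "\<forall>i\<in>B - {k}. y $ i = 0" by blast
    have "w $ i * y $ i + w $ k * y $ k = 0"
      using w y i that True by (intro orth_pair) (auto simp: supp_def)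
    then have "w $ k = w $ i * (- y $ i)" using y by simp
    moreover have "- y $ i \<in> {-1,0,1}" using y(2) i by force
    ultimately show ?thesis by blast
  next
    case False
    show ?thesis
    proof (cases "k = i")
      case True then show ?thesis by auto
    next
      case False
      then have "w $ k = 0" using w \<open>k \<notin> B\<close> that by (auto simp: supp_def)
      then show ?thesis by auto
    qed
  qed
  define v where "v = vec m (\<lambda>k. w $ k div w $ i)"
  have vk: "v $ k \<in> {-1, 0, 1} \<and> w $ k = w $ i * v $ k" if k: "k < m" for k
  proof -
    obtain c where c: "c \<in> {-1,0,1}" "w $ k = w $ i * c" using ex[OF k] by blast
    then have "v $ k = c" using k w(3) by (simp add: v_def)
    with c show ?thesis by simp
  qed
  have wv: "w = w $ i \<cdot>\<^sub>v v"
  proof (intro eq_vecI)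
    fix k assume "k < dim_vec (w $ i \<cdot>\<^sub>v v)"
    then show "w $ k = (w $ i \<cdot>\<^sub>v v) $ k" using vk[of k] by (simp add: v_def)
  qed (use w(1) in \<open>simp add: v_def\<close>)
  have "v \<in> carrier_vec m" by (simp add: v_def)
  moreover have "w $ i \<cdot>\<^sub>v v \<in> L" using w(1) wv by metis
  ultimately have "v \<in> L" using P.saturated w(3) by blast
  moreover have "\<forall>k<m. v $ k \<in> {-1, 0, 1}" using vk by blast
  moreover have "v $ i = 1" using w i by (simp add: v_def)
  moreover have "supp v \<subseteq> insert i B"
  proof
    fix k assume "k \<in> supp v"
    then have k: "k < m" "v $ k \<noteq> 0" by (auto simp: supp_def v_def)
    then have "w $ k \<noteq> 0" using vk[OF k(1)] w(3) by simp
    then show "k \<in> insert i B" using w k by (auto simp: supp_def)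
  qed
  ultimately show thesis using that by blast
qed

definition unital :: "int vec \<Rightarrow> bool" where
  "unital v \<longleftrightarrow> (\<forall>i<m. v $ i \<in> {-1, 0, 1})"

text \<open>
  Removing one element from the support of \<open>w\<close> leaves a free set. The fundamental circuit of this
  element with respect to a basis that contains the set is proportional to \<open>w\<close>.
\<close>
lemma elementary_multiple:
  assumes w: "P.elementary w"
  obtains k v where "w = k \<cdot>\<^sub>v v" "k \<noteq> 0" "v \<in> L" "unital v"
proof -
  have wL: "w \<in> L" using w by (simp add: P.elementary_def)
  obtain e where e: "e < m" "w $ e \<noteq> 0" using w P.nonzero_entry by (auto simp: P.elementary_def)
  have "P.free (supp w - {e})"
    unfolding P.free_def
  proof (intro ballI impI)
    fix v assume "v \<in> L" "supp v \<subseteq> supp w - {e}"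
    moreover have "e \<in> supp w" using e wL by (auto simp: supp_def)
    ultimately have "supp v \<subset> supp w" by auto
    then show "v = 0\<^sub>v m" using w \<open>v \<in> L\<close> by (auto simp: P.elementary_def)
  qed
  moreover have "supp w - {e} \<subseteq> {0..<m}" using wL by (auto simp: supp_def)
  ultimately obtain B where B: "supp w - {e} \<subseteq> B" "P.maximal_free B {0..<m}"
    using P.extend_free[of "{0..<m}" "supp w - {e}"] by auto
  have free: "P.free B" using B by (simp add: P.maximal_free_def)
  have eB: "e \<notin> B"
  proof
    assume "e \<in> B"
    then have "supp w \<subseteq> B" using B by auto
    then show False using free wL w by (auto simp: P.free_def P.elementary_def)
  qed
  obtain v where v: "v \<in> L" "\<forall>k<m. v $ k \<in> {-1, 0, 1}" "v $ e = 1" "supp v \<subseteq> insert e B"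
    using fundamental_circuit[OF B(2) e(1) eB] by blast
  have vL: "v \<in> L" by fact
  have "w - w $ e \<cdot>\<^sub>v v \<in> L" by (intro P.diff P.smult v wL)
  moreover have "supp (w - w $ e \<cdot>\<^sub>v v) \<subseteq> B"
  proof
    fix i assume i: "i \<in> supp (w - w $ e \<cdot>\<^sub>v v)"
    then have im: "i < m" and ne: "w $ i - w $ e * v $ i \<noteq> 0" using wL vL by (auto simp: supp_def)
    show "i \<in> B"
    proof (rule ccontr)
      assume "i \<notin> B"
      then have "i \<noteq> e" using ne v(3) by auto
      then have "i \<notin> supp w" "i \<notin> supp v" using \<open>i \<notin> B\<close> B(1) v(4) by auto
      then show False using ne im wL vL by (auto simp: supp_def)
    qed
  qed
  ultimately have z: "w - w $ e \<cdot>\<^sub>v v = 0\<^sub>v m" using free by (auto simp: P.free_def)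
  have "w = w $ e \<cdot>\<^sub>v v" by (rule eq_of_diff_zero[OF _ _ z]) (use wL vL in simp_all)
  then show thesis using that[of "w $ e" v] e v by (auto simp: unital_def)
qed

text \<open>
  If \<open>S\<close> does not contain a basis, then a maximal free subset of \<open>S\<close> omits some element \<open>j\<close> of a basis \<open>B\<close>
  that extends it. The fundamental cocircuit of \<open>j\<close> vanishes on this subset and therefore on \<open>S\<close>.
\<close>
lemma fundamental_cocircuit_support:
  assumes S: "S \<subseteq> {0..<m}" and nb: "\<And>B. B \<subseteq> S \<Longrightarrow> P.free B \<Longrightarrow> \<not> P.maximal_free B {0..<m}"
  obtains B j where "P.maximal_free B {0..<m}" "j \<in> B - S" "\<And>y. y \<in> L' \<Longrightarrow> (\<forall>i\<in>B - {j}. y $ i = 0) \<Longrightarrow> supp y \<inter> S = {}"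
proof -
  have fin: "finite S" using S by (auto intro: finite_subset)
  obtain B0 where B0: "P.maximal_free B0 S" using P.extend_free[of S "{}"] P.free_empty fin by auto
  have "B0 \<subseteq> S" "P.free B0" using B0 by (auto simp: P.maximal_free_def)
  then obtain B where B: "B0 \<subseteq> B" "P.maximal_free B {0..<m}"
    using P.extend_free[of "{0..<m}" B0] S by auto
  then have "B \<noteq> B0" "P.free B" using nb[OF \<open>B0 \<subseteq> S\<close>] \<open>P.free B0\<close> by (auto simp: P.maximal_free_def)
  then obtain j where j: "j \<in> B" "j \<notin> B0" using B by auto
  have jS: "j \<notin> S"
  proof
    assume "j \<in> S"
    then have "\<not> P.free (insert j B0)" using B0 j by (auto simp: P.maximal_free_def)
    moreover have "insert j B0 \<subseteq> B" using B j by auto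
    ultimately show False using P.free_subset \<open>P.free B\<close> by blast
  qed
  have van: "supp y \<inter> S = {}" if "y \<in> L'" "\<forall>i\<in>B - {j}. y $ i = 0" for y
  proof -
    have "y $ i = 0" if "i \<in> S" for i
      using dual_vanishes[OF B0 S \<open>y \<in> L'\<close> _ that] \<open>\<forall>i\<in>B - {j}. y $ i = 0\<close> j B(1) by blast
    then show ?thesis by (auto simp: supp_def)
  qed
  have "j \<in> B - S" using j(1) jS by simp
  from that[OF B(2) this van] show thesis .
qed

lemma dual_vanishing_zero:
  assumes "P.maximal_free B {0..<m}" "y \<in> L'" "\<And>i. i \<in> B \<Longrightarrow> y $ i = 0"
  shows "y = 0\<^sub>v m"
proof (rule D.zeroI[OF assms(2)])
  fix i assume "i < m"
  then have "i \<in> {0..<m}" by simp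
  from dual_vanishes[OF assms(1) order.refl assms(2,3) this] show "y $ i = 0" .
qed

text \<open>
  The complement of the support of \<open>w\<close> contains no basis, because a vector of \<open>L'\<close> that vanishes on a
  basis is zero. So some fundamental cocircuit is supported in the support of \<open>w\<close>, and it is proportional
  to \<open>w\<close> by minimality.
\<close>
lemma dual_elementary_multiple:
  assumes w: "D.elementary w"
  obtains k v where "w = k \<cdot>\<^sub>v v" "k \<noteq> 0" "v \<in> L'" "unital v"
proof -
  have wL: "w \<in> L'" and w0: "w \<noteq> 0\<^sub>v m" using w by (auto simp: D.elementary_def)
  define S where "S = {0..<m} - supp w"
  have nb: "\<not> P.maximal_free B {0..<m}" if "B \<subseteq> S" for B
  proof
    assume B: "P.maximal_free B {0..<m}"
    have "w $ i = 0" if "i \<in> B" for i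
      using that \<open>B \<subseteq> S\<close> wL by (auto simp: S_def supp_def)
    then show False using dual_vanishing_zero[OF B wL] w0 by blast
  qed
  obtain B j where B: "P.maximal_free B {0..<m}" "j \<in> B - S"
    and van: "\<And>y. y \<in> L' \<Longrightarrow> (\<forall>i\<in>B - {j}. y $ i = 0) \<Longrightarrow> supp y \<inter> S = {}"
    using fundamental_cocircuit_support[of S] nb by (metis Diff_subset S_def)
  obtain v where v: "v \<in> L'" "\<forall>i<m. v $ i \<in> {-1, 0, 1}" "v $ j = 1" "\<forall>i\<in>B - {j}. v $ i = 0"
    using fundamental_cocircuit[OF B(1)] B(2) by blast
  have vL: "v \<in> L'" by fact
  have jm: "j < m" using B by (auto simp: P.maximal_free_def)
  have js: "j \<in> supp w" using B(2) jm by (auto simp: S_def)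
  have sv: "supp v \<subseteq> supp w" using van[OF v(1) v(4)] vL by (auto simp: S_def supp_def)
  have "w - w $ j \<cdot>\<^sub>v v \<in> L'" by (intro D.diff D.smult v wL)
  moreover have "supp (w - w $ j \<cdot>\<^sub>v v) \<subset> supp w"
  proof -
    have "j \<notin> supp (w - w $ j \<cdot>\<^sub>v v)" using v(3) vL wL jm by (auto simp: supp_def)
    moreover have "supp (w - w $ j \<cdot>\<^sub>v v) \<subseteq> supp w \<union> supp v"
      using vL wL by (auto simp: supp_def)
    ultimately show ?thesis using sv js by blast
  qed
  ultimately have z: "w - w $ j \<cdot>\<^sub>v v = 0\<^sub>v m" using w by (auto simp: D.elementary_def)
  have "w = w $ j \<cdot>\<^sub>v v" by (rule eq_of_diff_zero[OF _ _ z]) (use wL vL in simp_all)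
  then show thesis using that[of "w $ j" v] js v by (auto simp: unital_def supp_def)
qed

end

context saturated_lattice
begin

lemma uminus: "v \<in> L \<Longrightarrow> - v \<in> L"
proof -
  assume v: "v \<in> L"
  have "- v = (-1) \<cdot>\<^sub>v v" using v by (intro eq_vecI) auto
  with smult[OF v, of "-1"] show ?thesis by simp
qed

text \<open>
  Multiplying \<open>u\<close> by the sign of \<open>k\<close> instead of \<open>k\<close> turns a vector of minimal support into a signed
  circuit with the same signs.
\<close>
lemma elementary_normalise:
  assumes w: "elementary w" "w = k \<cdot>\<^sub>v u" "k \<noteq> 0" "u \<in> L"
    and u: "\<forall>i<m. u $ i \<in> {-1, 0, 1}"
  shows "\<exists>C. elementary C \<and> (\<forall>i<m. C $ i \<in> {-1, 0, 1}) \<and> supp C = supp w \<and> conformal C w"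
proof -
  define C where "C = sgn k \<cdot>\<^sub>v u"
  have CL: "C \<in> L" using w smult by (simp add: C_def)
  have Ci: "C $ i = sgn k * u $ i" "w $ i = k * u $ i" if "i < m" for i
    using w that by (simp_all add: C_def)
  have dims: "dim_vec C = m" "dim_vec w = m" using CL w by (auto simp: elementary_def)
  have nz: "C $ i \<noteq> 0 \<longleftrightarrow> w $ i \<noteq> 0" if "i < m" for i
    using Ci[OF that] w(3) by (simp add: sgn_eq_0_iff)
  have supp: "supp C = supp w" using nz dims by (auto simp: supp_def)
  have un: "C $ i \<in> {-1, 0, 1}" if "i < m" for i
  proof -
    have "u $ i \<in> {-1, 0, 1}" using u that by blast
    then show ?thesis unfolding Ci(1)[OF that] by (auto simp: sgn_if)
  qed
  have conf: "conformal C w"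
    unfolding conformal_def
  proof (intro allI impI)
    fix i assume i: "i < dim_vec C" "C $ i \<noteq> 0"
    have "C $ i * w $ i = (sgn k * k) * (u $ i * u $ i)"
      using Ci[of i] i dims by simp
    also have "\<dots> > 0"
    proof (rule mult_pos_pos)
      show "0 < sgn k * k" using w(3) by (simp add: sgn_if)
      have "u $ i \<noteq> 0" using i dims Ci(1)[of i] by auto
      then show "0 < u $ i * u $ i" by (auto simp: zero_less_mult_iff)
    qed
    finally show "0 < C $ i * w $ i" .
  qed
  have "C \<noteq> 0\<^sub>v m"
  proof
    assume C0: "C = 0\<^sub>v m"
    have "supp w = {}" unfolding supp[symmetric] C0 by (simp add: supp_def)
    then show False using w(1) supp_empty[of w m] by (auto simp: elementary_def)
  qed
  then have "elementary C" using w(1) CL supp by (auto simp: elementary_def)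
  then show ?thesis using un supp conf by blast
qed

end

definition sign_vectors :: "nat \<Rightarrow> int vec set" where
  "sign_vectors m = {X \<in> carrier_vec m. \<forall>i<m. X $ i \<in> {-1, 1}}"

lemma sign_vectorsD: "X \<in> sign_vectors m \<Longrightarrow> i < m \<Longrightarrow> X $ i = 1 \<or> X $ i = -1"
  by (auto simp: sign_vectors_def)

lemma sign_vectors_dim: "X \<in> sign_vectors m \<Longrightarrow> X \<in> carrier_vec m"
  by (simp add: sign_vectors_def)

text \<open>
  A vector \<open>a\<close> that agrees with \<open>X\<close> on its support is a sum of signed circuits with disjoint supports, all
  compatible with \<open>X\<close>; they are reversed one after the other. A circuit that is not yet reversed remains
  compatible because its support is disjoint from the previous ones. Stated for an arbitrary relation
  \<open>R\<close>, since it is applied to circuits and to cocircuits.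
\<close>
lemma (in saturated_lattice) peel_circuits:
  assumes circuit: "\<And>v e. v \<in> L \<Longrightarrow> e < m \<Longrightarrow> v $ e \<noteq> 0 \<Longrightarrow>
        \<exists>C. elementary C \<and> (\<forall>i<m. C $ i \<in> {-1, 0, 1}) \<and> C $ e \<noteq> 0 \<and> conformal C v"
    and step: "\<And>X C. X \<in> sign_vectors m \<Longrightarrow> elementary C \<Longrightarrow> (\<forall>i<m. C $ i \<in> {-1, 0, 1}) \<Longrightarrow>
        conformal C X \<Longrightarrow> R X (X - 2 \<cdot>\<^sub>v C)"
    and X: "X \<in> sign_vectors m" and a: "a \<in> L" "\<And>i. i < m \<Longrightarrow> a $ i = 0 \<or> a $ i = X $ i"
  shows "R\<^sup>*\<^sup>* X (X - 2 \<cdot>\<^sub>v a)"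
  using X a
proof (induction "card (supp a)" arbitrary: X a rule: less_induct)
  case less
  note Xd = sign_vectors_dim[OF less.prems(1)]
  show ?case
  proof (cases "a = 0\<^sub>v m")
    case True
    then have "X - 2 \<cdot>\<^sub>v a = X" using Xd by (intro eq_vecI) auto
    then show ?thesis by simp
  next
    case False
    then obtain e where e: "e < m" "a $ e \<noteq> 0" using nonzero_entry less.prems by blast
    from circuit[OF less.prems(2) e] obtain C where
      C: "elementary C" "\<forall>i<m. C $ i \<in> {-1, 0, 1}" "C $ e \<noteq> 0" "conformal C a" by blast
    have CL: "C \<in> L" using C by (simp add: elementary_def)
    have Ca: "C $ i = 0 \<or> C $ i = a $ i \<and> a $ i = X $ i" if i: "i < m" for i
    proof (cases "C $ i = 0")
      case False
      then have pos: "0 < C $ i * a $ i" using C(4) CL i by (auto simp: conformal_def)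
      then have "a $ i = X $ i" using less.prems(3)[OF i] by auto
      moreover have "C $ i \<in> {-1, 0, 1}" using C(2) i by blast
      ultimately show ?thesis using pos sign_vectorsD[OF less.prems(1) i] by auto
    qed simp
    have confX: "conformal C X"
      unfolding conformal_def
    proof (intro allI impI)
      fix i assume i: "i < dim_vec C" "C $ i \<noteq> 0"
      then have "i < m" using CL by simp
      from Ca[OF this] sign_vectorsD[OF less.prems(1) this] i show "0 < C $ i * X $ i" by auto
    qed
    define X' where "X' = X - 2 \<cdot>\<^sub>v C"
    define a' where "a' = a - C"
    have X'i: "X' $ i = X $ i - 2 * C $ i" and a'i: "a' $ i = a $ i - C $ i" if "i < m" for i
      using that CL Xd less.prems(2) by (simp_all add: X'_def a'_def)
    have X'd: "X' \<in> carrier_vec m" using CL Xd by (simp add: X'_def)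
    have X's: "X' \<in> sign_vectors m"
      unfolding sign_vectors_def
    proof (intro CollectI conjI allI impI X'd)
      fix i assume i: "i < m"
      show "X' $ i \<in> {-1, 1}"
        using Ca[OF i] sign_vectorsD[OF less.prems(1) i] unfolding X'i[OF i] by auto
    qed
    have a'L: "a' \<in> L" using diff less.prems CL by (simp add: a'_def)
    have a'X: "a' $ i = 0 \<or> a' $ i = X' $ i" if i: "i < m" for i
      using Ca[OF i] less.prems(3)[OF i] unfolding X'i[OF i] a'i[OF i] by auto
    have "supp a' \<subseteq> supp a"
      using Ca a'i CL less.prems(2) a'L by (fastforce simp: supp_def)
    moreover have "e \<in> supp a" "e \<notin> supp a'"
      using Ca[OF e(1)] C(3) e a'i[OF e(1)] less.prems(2) by (auto simp: supp_def)
    ultimately have "card (supp a') < card (supp a)" by (intro psubset_card_mono) auto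
    from less.hyps[OF this X's a'L a'X] have "R\<^sup>*\<^sup>* X' (X' - 2 \<cdot>\<^sub>v a')" .
    moreover have "R X X'" unfolding X'_def using step[OF less.prems(1) C(1,2) confX] .
    moreover have "X' - 2 \<cdot>\<^sub>v a' = X - 2 \<cdot>\<^sub>v a"
      using Xd CL less.prems(2) by (intro eq_vecI) (auto simp: X'_def a'_def)
    ultimately show ?thesis by (metis converse_rtranclp_into_rtranclp)
  qed
qed

context regular_lattice_pair
begin

lemma conformal_circuit:
  assumes v: "v \<in> L" "e < m" "v $ e \<noteq> 0"
  shows "\<exists>C. P.elementary C \<and> (\<forall>i<m. C $ i \<in> {-1, 0, 1}) \<and> C $ e \<noteq> 0 \<and> conformal C v"
proof -
  obtain w where w: "P.elementary w" "w $ e \<noteq> 0" "conformal w v"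
    using P.conformal_elementary[OF v] by blast
  obtain k u where u: "w = k \<cdot>\<^sub>v u" "k \<noteq> 0" "u \<in> L" "unital u" using elementary_multiple[OF w(1)] .
  obtain C where C: "P.elementary C" "\<forall>i<m. C $ i \<in> {-1, 0, 1}" "supp C = supp w" "conformal C w"
    using P.elementary_normalise[OF w(1) u(1-3)] u(4) unfolding unital_def by blast
  have d: "dim_vec C = m" "dim_vec w = m" using C(1) w(1) by (auto simp: P.elementary_def)
  have "C $ e \<noteq> 0" using C(3) w(2) d v(2) by (auto simp: supp_def)
  moreover have "conformal C v" using conformal_trans[OF C(4) w(3)] d by simp
  ultimately show ?thesis using C by blast
qed

lemma conformal_cocircuit:
  assumes v: "v \<in> L'" "e < m" "v $ e \<noteq> 0"
  shows "\<exists>C. D.elementary C \<and> (\<forall>i<m. C $ i \<in> {-1, 0, 1}) \<and> C $ e \<noteq> 0 \<and> conformal C v"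
proof -
  obtain w where w: "D.elementary w" "w $ e \<noteq> 0" "conformal w v"
    using D.conformal_elementary[OF v] by blast
  obtain k u where u: "w = k \<cdot>\<^sub>v u" "k \<noteq> 0" "u \<in> L'" "unital u" using dual_elementary_multiple[OF w(1)] .
  obtain C where C: "D.elementary C" "\<forall>i<m. C $ i \<in> {-1, 0, 1}" "supp C = supp w" "conformal C w"
    using D.elementary_normalise[OF w(1) u(1-3)] u(4) unfolding unital_def by blast
  have d: "dim_vec C = m" "dim_vec w = m" using C(1) w(1) by (auto simp: D.elementary_def)
  have "C $ e \<noteq> 0" using C(3) w(2) d v(2) by (auto simp: supp_def)
  moreover have "conformal C v" using conformal_trans[OF C(4) w(3)] d by simp
  ultimately show ?thesis using C by blast
qed

section \<open>The painting lemma\<close>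

text \<open>
  Extend a maximal free subset of \<open>F\<close> first to one of \<open>insert e F\<close> and then to a basis. Either \<open>e\<close> is
  in this basis and its fundamental cocircuit vanishes on \<open>F\<close>, or its fundamental circuit lies in
  \<open>insert e F\<close>.
\<close>
lemma four_colouring_base:
  assumes e: "e < m" "e \<notin> F" and F: "F \<subseteq> {0..<m}"
  shows "(\<exists>v\<in>L. v $ e \<noteq> 0 \<and> supp v \<subseteq> insert e F) \<or> (\<exists>y\<in>L'. y $ e \<noteq> 0 \<and> (\<forall>i\<in>F. y $ i = 0))"
proof -
  have fin: "finite F" using F by (auto intro: finite_subset)
  obtain B0 where B0: "P.maximal_free B0 F" using P.extend_free[OF fin, of "{}"] P.free_empty by auto
  obtain B1 where B1: "B0 \<subseteq> B1" "P.maximal_free B1 (insert e F)"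
    using P.extend_free[of "insert e F" B0] fin B0 by (auto simp: P.maximal_free_def)
  have "B1 \<subseteq> {0..<m}" "P.free B1" using B1(2) F e by (auto simp: P.maximal_free_def)
  then obtain B where B: "B1 \<subseteq> B" "P.maximal_free B {0..<m}"
    using P.extend_free[of "{0..<m}" B1] by auto
  have B0F: "B0 \<subseteq> F" using B0 by (simp add: P.maximal_free_def)
  show ?thesis
  proof (cases "e \<in> B")
    case True
    from fundamental_cocircuit[OF B(2) True] obtain y where
      y: "y \<in> L'" "y $ e = 1" "\<forall>i\<in>B - {e}. y $ i = 0" by blast
    have "y $ i = 0" if "i \<in> B0" for i using y(3) that B B1 B0F e(2) by blast
    then have "\<forall>i\<in>F. y $ i = 0" using dual_vanishes[OF B0 F y(1)] by blast
    moreover have "y $ e \<noteq> 0" using y(2) by simp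
    ultimately show ?thesis using y(1) by blast
  next
    case False
    then have "e \<in> insert e F - B1" using B by blast
    then obtain v where v: "v \<in> L" "supp v \<subseteq> insert e B1" "v $ e \<noteq> 0"
      using P.maximal_free_circuit[OF B1(2)] F e(1) by auto
    moreover have "B1 \<subseteq> insert e F" using B1 by (simp add: P.maximal_free_def)
    ultimately show ?thesis by blast
  qed
qed

text \<open>
  Minty's painting lemma, the combinatorial form of Farkas' lemma. The elements of \<open>S\<close> carry a sign
  condition; those of \<open>F\<close> may be used freely by the vectors of \<open>L\<close> but not by those of \<open>L'\<close>, and the
  remaining ones conversely. The induction moves an element \<open>g\<close> of \<open>S\<close> to either side. If neither
  instance solves the problem for \<open>S\<close>, then they give \<open>v \<in> L\<close> and \<open>y \<in> L'\<close> that violate the sign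
  condition only at \<open>g\<close>. All terms of their scalar product are then nonnegative and the term at \<open>e\<close> is
  positive, which contradicts orthogonality.
\<close>
lemma four_colouring:
  assumes "finite S" "e \<in> S" "S \<subseteq> {0..<m}" "F \<subseteq> {0..<m} - S" "\<forall>i<m. X $ i \<noteq> 0"
  shows "(\<exists>v\<in>L. v $ e \<noteq> 0 \<and> (\<forall>i\<in>S. X $ i * v $ i \<ge> 0) \<and> supp v \<subseteq> S \<union> F)
       \<or> (\<exists>y\<in>L'. y $ e \<noteq> 0 \<and> (\<forall>i\<in>S. X $ i * y $ i \<ge> 0) \<and> (\<forall>i\<in>F. y $ i = 0))"
  using assms
proof (induction "card S" arbitrary: S F rule: less_induct)
  case less
  note e = less.prems(2) and S = less.prems(3) and F = less.prems(4) and X = less.prems(5)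
  have em: "e < m" using e S by auto
  have sgn: "X $ e * v $ e \<ge> 0 \<or> X $ e * (- v) $ e \<ge> 0" if "dim_vec v = m" for v :: "int vec"
    using that em by (cases "X $ e * v $ e \<ge> 0") auto
  show ?case
  proof (cases "S = {e}")
    case True
    then have eF: "e \<notin> F" "F \<subseteq> {0..<m}" using F by auto
    from four_colouring_base[OF em eF] show ?thesis
    proof
      assume "\<exists>v\<in>L. v $ e \<noteq> 0 \<and> supp v \<subseteq> insert e F"
      then obtain v where v: "v \<in> L" "v $ e \<noteq> 0" "supp v \<subseteq> insert e F" by blast
      have "supp (- v) = supp v" "(- v) $ e \<noteq> 0" using v em by (auto simp: supp_def)
      then show ?thesis using sgn[of v] v True P.uminus[OF v(1)] by (metis P.dim insert_is_Un singletonD)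
    next
      assume "\<exists>y\<in>L'. y $ e \<noteq> 0 \<and> (\<forall>i\<in>F. y $ i = 0)"
      then obtain y where y: "y \<in> L'" "y $ e \<noteq> 0" "\<forall>i\<in>F. y $ i = 0" by blast
      have "(- y) $ e \<noteq> 0" "\<forall>i\<in>F. (- y) $ i = 0" using y em eF by auto
      then show ?thesis using sgn[of y] y True D.uminus[OF y(1)] by (metis D.dim singletonD)
    qed
  next
    case False
    then obtain g where g: "g \<in> S" "g \<noteq> e" using e by blast
    define S' where "S' = S - {g}"
    have "card S' < card S" unfolding S'_def using card_Diff1_less less.prems(1) g(1) .
    then have S': "finite S'" "e \<in> S'" "S' \<subseteq> {0..<m}" "card S' < card S"
      using g e S less.prems(1) by (auto simp: S'_def)
    have gm: "g < m" using g S by auto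
    have F1: "insert g F \<subseteq> {0..<m} - S'" and F2: "F \<subseteq> {0..<m} - S'" using F gm by (auto simp: S'_def)
    show ?thesis
    proof (rule ccontr)
      assume no: "\<not> ?thesis"
      have "\<not> (\<exists>y\<in>L'. y $ e \<noteq> 0 \<and> (\<forall>i\<in>S'. X $ i * y $ i \<ge> 0) \<and> (\<forall>i\<in>insert g F. y $ i = 0))"
      proof
        assume "\<exists>y\<in>L'. y $ e \<noteq> 0 \<and> (\<forall>i\<in>S'. X $ i * y $ i \<ge> 0) \<and> (\<forall>i\<in>insert g F. y $ i = 0)"
        then obtain y where y: "y \<in> L'" "y $ e \<noteq> 0" "\<forall>i\<in>S'. X $ i * y $ i \<ge> 0" "\<forall>i\<in>insert g F. y $ i = 0"
          by blast
        then have "\<forall>i\<in>S. X $ i * y $ i \<ge> 0" by (auto simp: S'_def)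
        then show False using no y by blast
      qed
      with less.hyps[OF S'(4,1-3) F1 X] obtain v where
        v: "v \<in> L" "v $ e \<noteq> 0" "\<forall>i\<in>S'. X $ i * v $ i \<ge> 0" "supp v \<subseteq> S' \<union> insert g F" by blast
      have vS: "supp v \<subseteq> S \<union> F" using v(4) g by (auto simp: S'_def)
      have "\<not> (\<exists>v\<in>L. v $ e \<noteq> 0 \<and> (\<forall>i\<in>S'. X $ i * v $ i \<ge> 0) \<and> supp v \<subseteq> S' \<union> F)"
      proof
        assume "\<exists>v\<in>L. v $ e \<noteq> 0 \<and> (\<forall>i\<in>S'. X $ i * v $ i \<ge> 0) \<and> supp v \<subseteq> S' \<union> F"
        then obtain v where w: "v \<in> L" "v $ e \<noteq> 0" "\<forall>i\<in>S'. X $ i * v $ i \<ge> 0" "supp v \<subseteq> S' \<union> F" by blast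
        have "g \<notin> supp v" using w(4) g F by (auto simp: S'_def)
        then have "v $ g = 0" using w(1) gm by (auto simp: supp_def)
        then have "\<forall>i\<in>S. X $ i * v $ i \<ge> 0" using w(3) by (auto simp: S'_def)
        moreover have "supp v \<subseteq> S \<union> F" using w(4) by (auto simp: S'_def)
        ultimately show False using no w by blast
      qed
      with less.hyps[OF S'(4,1-3) F2 X] obtain y where
        y: "y \<in> L'" "y $ e \<noteq> 0" "\<forall>i\<in>S'. X $ i * y $ i \<ge> 0" "\<forall>i\<in>F. y $ i = 0" by blast
      have "X $ g * v $ g < 0"
      proof (rule ccontr)
        assume "\<not> X $ g * v $ g < 0"
        then have "\<forall>i\<in>S. X $ i * v $ i \<ge> 0" using v(3) by (auto simp: S'_def)
        then show False using no v vS by blast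
      qed
      moreover have "X $ g * y $ g < 0"
      proof (rule ccontr)
        assume "\<not> X $ g * y $ g < 0"
        then have "\<forall>i\<in>S. X $ i * y $ i \<ge> 0" using y(3) by (auto simp: S'_def)
        then show False using no y by blast
      qed
      ultimately have vyg: "0 \<le> v $ g * y $ g" by (auto simp: mult_less_0_iff zero_le_mult_iff)
      have nonneg: "0 \<le> v $ i * y $ i" if i: "i < m" for i
      proof -
        consider "i = g" | "i \<in> S'" | "i \<in> F" | "i \<notin> S' \<union> insert g F" by blast
        then show ?thesis
        proof cases
          case 2
          then have "0 \<le> X $ i * v $ i" "0 \<le> X $ i * y $ i" using v(3) y(3) by auto
          moreover have "X $ i \<noteq> 0" using X i by blast
          ultimately show ?thesis by (auto simp: zero_le_mult_iff)
        next
          case 4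
          then have "v $ i = 0" using v(1,4) i by (auto simp: supp_def)
          then show ?thesis by simp
        qed (use vyg y in auto)
      qed
      have "(\<Sum>i<m. v $ i * y $ i) = 0" using orth_sum v(1) y(1) .
      then have "\<forall>i\<in>{..<m}. v $ i * y $ i = 0"
        by (subst (asm) sum_nonneg_eq_0_iff) (auto intro: nonneg)
      then show False using v(2) y(2) em by auto
    qed
  qed
qed

text \<open>
  The case of the painting lemma in which every element carries a sign condition.
\<close>
lemma compatible_circuit_or_cocircuit:
  assumes X: "X \<in> carrier_vec m" "\<forall>i<m. X $ i \<noteq> 0" and e: "e < m"
  shows "\<exists>C. (P.elementary C \<or> D.elementary C) \<and> (\<forall>i<m. C $ i \<in> {-1, 0, 1}) \<and> C $ e \<noteq> 0 \<and> conformal C X"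
proof -
  have conf: "conformal v X" if "dim_vec v = m" "\<forall>i\<in>{0..<m}. X $ i * v $ i \<ge> 0" for v
    unfolding conformal_def
  proof (intro allI impI)
    fix i assume i: "i < dim_vec v" "v $ i \<noteq> 0"
    then have "X $ i * v $ i \<ge> 0" "X $ i \<noteq> 0" using that X by auto
    then show "0 < v $ i * X $ i" using i by (auto simp: zero_le_mult_iff zero_less_mult_iff)
  qed
  have "(\<exists>v\<in>L. v $ e \<noteq> 0 \<and> (\<forall>i\<in>{0..<m}. X $ i * v $ i \<ge> 0) \<and> supp v \<subseteq> {0..<m} \<union> {})
       \<or> (\<exists>y\<in>L'. y $ e \<noteq> 0 \<and> (\<forall>i\<in>{0..<m}. X $ i * y $ i \<ge> 0) \<and> (\<forall>i\<in>{}. y $ i = 0))"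
    using X e by (intro four_colouring) auto
  then show ?thesis
  proof
    assume "\<exists>v\<in>L. v $ e \<noteq> 0 \<and> (\<forall>i\<in>{0..<m}. X $ i * v $ i \<ge> 0) \<and> supp v \<subseteq> {0..<m} \<union> {}"
    then obtain v where v: "v \<in> L" "v $ e \<noteq> 0" "\<forall>i\<in>{0..<m}. X $ i * v $ i \<ge> 0" by blast
    from conformal_circuit[OF v(1) e v(2)] obtain C where
      C: "P.elementary C" "\<forall>i<m. C $ i \<in> {-1, 0, 1}" "C $ e \<noteq> 0" "conformal C v" by blast
    moreover have "conformal C X"
      using conformal_trans[OF C(4) conf] v C(1) by (simp add: P.elementary_def)
    ultimately show ?thesis by blast
  next
    assume "\<exists>y\<in>L'. y $ e \<noteq> 0 \<and> (\<forall>i\<in>{0..<m}. X $ i * y $ i \<ge> 0) \<and> (\<forall>i\<in>{}. y $ i = 0)"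
    then obtain v where v: "v \<in> L'" "v $ e \<noteq> 0" "\<forall>i\<in>{0..<m}. X $ i * v $ i \<ge> 0" by blast
    from conformal_cocircuit[OF v(1) e v(2)] obtain C where
      C: "D.elementary C" "\<forall>i<m. C $ i \<in> {-1, 0, 1}" "C $ e \<noteq> 0" "conformal C v" by blast
    moreover have "conformal C X"
      using conformal_trans[OF C(4) conf] v C(1) by (simp add: D.elementary_def)
    ultimately show ?thesis by blast
  qed
qed

section \<open>Odd vectors modulo twice the sum of the lattices\<close>

definition sum_lattice :: "int vec set" where
  "sum_lattice = {x + y | x y. x \<in> L \<and> y \<in> L'}"

lemma sum_lattice_carrier: "sum_lattice \<subseteq> carrier_vec m"
  by (auto simp: sum_lattice_def)

lemma sum_latticeI1: "x \<in> L \<Longrightarrow> x \<in> sum_lattice" and sum_latticeI2: "y \<in> L' \<Longrightarrow> y \<in> sum_lattice"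
proof -
  show "x \<in> sum_lattice" if "x \<in> L"
  proof -
    have "x = x + 0\<^sub>v m" using that by simp
    then show ?thesis unfolding sum_lattice_def using that D.zero by blast
  qed
  show "y \<in> sum_lattice" if "y \<in> L'"
  proof -
    have "y = 0\<^sub>v m + y" using that by simp
    then show ?thesis unfolding sum_lattice_def using that P.zero by blast
  qed
qed

lemma sum_lattice_zero: "0\<^sub>v m \<in> sum_lattice" using sum_latticeI1 P.zero by blast

lemma sum_lattice_add: "u \<in> sum_lattice \<Longrightarrow> v \<in> sum_lattice \<Longrightarrow> u + v \<in> sum_lattice"
proof -
  assume "u \<in> sum_lattice" "v \<in> sum_lattice"
  then obtain x y x' y' where *: "x \<in> L" "y \<in> L'" "x' \<in> L" "y' \<in> L'" "u = x + y" "v = x' + y'"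
    by (auto simp: sum_lattice_def)
  then have "u + v = (x + x') + (y + y')" by (intro eq_vecI) auto
  then show ?thesis unfolding sum_lattice_def using * P.add D.add by blast
qed

lemma sum_lattice_smult: "u \<in> sum_lattice \<Longrightarrow> k \<cdot>\<^sub>v u \<in> sum_lattice"
proof -
  assume "u \<in> sum_lattice"
  then obtain x y where *: "x \<in> L" "y \<in> L'" "u = x + y" by (auto simp: sum_lattice_def)
  then have "k \<cdot>\<^sub>v u = k \<cdot>\<^sub>v x + k \<cdot>\<^sub>v y" by (simp add: smult_add_distrib_vec[of _ m])
  then show ?thesis unfolding sum_lattice_def using * P.smult D.smult by blast
qed

lemma sum_lattice_uminus: "u \<in> sum_lattice \<Longrightarrow> - u \<in> sum_lattice"
proof -
  assume u: "u \<in> sum_lattice"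
  then have "- u = (-1) \<cdot>\<^sub>v u" using sum_lattice_carrier by (intro eq_vecI) auto
  with sum_lattice_smult[OF u, of "-1"] show ?thesis by simp
qed

lemma sum_lattice_diff: "u \<in> sum_lattice \<Longrightarrow> v \<in> sum_lattice \<Longrightarrow> u - v \<in> sum_lattice"
proof -
  assume u: "u \<in> sum_lattice" "v \<in> sum_lattice"
  then have "u - v = u + (- v)" using sum_lattice_carrier by (intro eq_vecI) auto
  with sum_lattice_add[OF u(1) sum_lattice_uminus[OF u(2)]] show ?thesis by simp
qed

text \<open>
  If \<open>C\<close> is compatible with \<open>x\<close>, then subtracting \<open>2 C\<close> lowers the absolute values greater than \<open>1\<close>
  on the support of \<open>C\<close> by \<open>2\<close> and keeps those equal to \<open>1\<close>. So as long as \<open>x\<close> has an entry \<open>x $ e \<notin> {-1, 1}\<close>, a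
  circuit or cocircuit through \<open>e\<close> makes it smaller.
\<close>
lemma reduce_to_signs:
  assumes x: "x \<in> carrier_vec m" "\<And>i. i < m \<Longrightarrow> odd (x $ i)"
  shows "\<exists>X\<in>sign_vectors m. \<exists>g\<in>sum_lattice. X = x - 2 \<cdot>\<^sub>v g"
  using x
proof (induction "\<Sum>i<m. nat \<bar>x $ i\<bar>" arbitrary: x rule: less_induct)
  case less
  note xd = less.prems(1) and odd = less.prems(2)
  show ?case
  proof (cases "x \<in> sign_vectors m")
    case True
    moreover have "x = x - 2 \<cdot>\<^sub>v 0\<^sub>v m" using xd by (intro eq_vecI) auto
    ultimately show ?thesis using sum_lattice_zero by blast
  next
    case False
    then obtain e where e: "e < m" "x $ e \<noteq> 1" "x $ e \<noteq> -1" using xd by (auto simp: sign_vectors_def)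
    have x0: "\<forall>i<m. x $ i \<noteq> 0" using odd by fastforce
    obtain C where C: "P.elementary C \<or> D.elementary C" "\<forall>i<m. C $ i \<in> {-1, 0, 1}" "C $ e \<noteq> 0" "conformal C x"
      using compatible_circuit_or_cocircuit[OF xd x0 e(1)] by blast
    have CM: "C \<in> sum_lattice" using C(1) sum_latticeI1 sum_latticeI2 by (auto simp: P.elementary_def D.elementary_def)
    have Cd: "dim_vec C = m" using CM sum_lattice_carrier by auto
    define y where "y = x - 2 \<cdot>\<^sub>v C"
    have yi: "y $ i = x $ i - 2 * C $ i" if "i < m" for i using that xd Cd by (simp add: y_def)
    have Ci: "C $ i = 0 \<or> C $ i = 1 \<and> x $ i > 0 \<or> C $ i = -1 \<and> x $ i < 0" if i: "i < m" for i
    proof -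
      have "C $ i \<in> {-1, 0, 1}" using C(2) i by blast
      moreover have "C $ i \<noteq> 0 \<Longrightarrow> 0 < C $ i * x $ i" using C(4) i Cd by (auto simp: conformal_def)
      ultimately show ?thesis by auto
    qed
    have le: "nat \<bar>y $ i\<bar> \<le> nat \<bar>x $ i\<bar>" if i: "i < m" for i
      using Ci[OF i] unfolding yi[OF i] by auto
    have "nat \<bar>y $ e\<bar> < nat \<bar>x $ e\<bar>"
      using Ci[OF e(1)] e C(3) unfolding yi[OF e(1)] by auto
    then have "(\<Sum>i<m. nat \<bar>y $ i\<bar>) < (\<Sum>i<m. nat \<bar>x $ i\<bar>)"
      using le e(1) by (intro sum_strict_mono_ex1) auto
    moreover have "y \<in> carrier_vec m" using xd CM sum_lattice_carrier by (auto simp: y_def)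
    moreover have "odd (y $ i)" if "i < m" for i using odd[OF that] yi[OF that] by simp
    ultimately obtain X g where Xg: "X \<in> sign_vectors m" "g \<in> sum_lattice" "X = y - 2 \<cdot>\<^sub>v g"
      using less.hyps by blast
    have "X = x - 2 \<cdot>\<^sub>v (C + g)"
      using Xg xd Cd sum_lattice_carrier unfolding Xg(3) y_def by (intro eq_vecI) auto
    then show ?thesis using Xg sum_lattice_add[OF CM Xg(2)] by blast
  qed
qed

text \<open>
  The entries of \<open>a + b\<close> lie in \<open>{-1, 0, 1}\<close>, and two integers whose sum is that small have a product at
  most \<open>0\<close>. By orthogonality all these products are \<open>0\<close>, so that at every element \<open>a\<close> or \<open>b\<close> vanishes.
\<close>
lemma sign_difference_split:
  assumes X: "X \<in> sign_vectors m" and Y: "Y \<in> sign_vectors m"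
    and a: "a \<in> L" and b: "b \<in> L'" and XY: "X - Y = 2 \<cdot>\<^sub>v (a + b)" and i: "i < m"
  shows "a $ i = 0 \<and> (b $ i = 0 \<or> b $ i = X $ i) \<or> b $ i = 0 \<and> a $ i = X $ i"
proof -
  have eq: "X $ i - Y $ i = 2 * (a $ i + b $ i)" if "i < m" for i
  proof -
    have "X $ i - Y $ i = (X - Y) $ i" using that sign_vectors_dim[OF X] sign_vectors_dim[OF Y] by simp
    also have "\<dots> = 2 * (a $ i + b $ i)" unfolding XY using a b that by simp
    finally show ?thesis .
  qed
  have z: "a $ i + b $ i = 0 \<or> a $ i + b $ i = X $ i" if "i < m" for i
    using eq[OF that] sign_vectorsD[OF X that] sign_vectorsD[OF Y that] by auto
  have le: "a $ i * b $ i \<le> 0" if i: "i < m" for i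
  proof -
    have "a $ i + b $ i \<in> {-1, 0, 1}" using z[OF i] sign_vectorsD[OF X i] by auto
    then consider "b $ i = - 1 - a $ i" | "b $ i = - a $ i" | "b $ i = 1 - a $ i" by fastforce
    then show ?thesis
    proof cases
      case 1 then show ?thesis by (cases "a $ i \<ge> 0") (auto simp: mult_le_0_iff)
    next
      case 2 then show ?thesis by (cases "a $ i \<ge> 0") (auto simp: mult_le_0_iff)
    next
      case 3 then show ?thesis by (cases "a $ i > 0") (auto simp: mult_le_0_iff)
    qed
  qed
  have "(\<Sum>i<m. - (a $ i * b $ i)) = 0" using orth_sum[OF a b] by (simp add: sum_negf)
  then have "\<forall>i\<in>{..<m}. - (a $ i * b $ i) = 0"
    by (subst (asm) sum_nonneg_eq_0_iff) (auto dest: le)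
  then have "a $ i = 0 \<or> b $ i = 0" using i by auto
  then show ?thesis using z[OF i] by auto
qed

end

section \<open>The lattices of a totally unimodular matrix\<close>

lemma clear_denominators:
  fixes x :: "nat \<Rightarrow> rat"
  shows "\<exists>d>0. \<exists>z. \<forall>i<n. of_int d * x i = of_int (z i)"
proof (induction n)
  case 0
  have "(1::int) > 0" by simp
  then show ?case by blast
next
  case (Suc n)
  then obtain d z where d: "d > 0" "\<forall>i<n. of_int d * x i = of_int (z i)" by blast
  obtain p q where pq: "q > 0" "x n = of_int p / of_int q"
    by (metis quotient_of_denom_pos quotient_of_div surj_pair)
  define z' where "z' i = (if i = n then d * p else q * z i)" for i
  have "of_int (d * q) * x i = of_int (z' i)" if "i < Suc n" for i
  proof (cases "i = n")
    case True then show ?thesis using pq by (simp add: z'_def)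
  next
    case False
    then have "of_int d * x i = of_int (z i)" using d that by auto
    then show ?thesis using False by (simp add: z'_def algebra_simps)
  qed
  moreover have "d * q > 0" using d pq by simp
  ultimately show ?case by blast
qed

lemma circuit_lattice_iff:
  assumes "A \<in> carrier_mat r m"
  shows "v \<in> circuit_lattice A \<longleftrightarrow>
           v \<in> carrier_vec m \<and> (\<forall>l<r. (\<Sum>i<m. A $$ (l, i) * v $ i) = 0)"
proof -
  have "A *\<^sub>v v = 0\<^sub>v r \<longleftrightarrow> (\<forall>l<r. (\<Sum>i<m. A $$ (l, i) * v $ i) = 0)" if "v \<in> carrier_vec m"
  proof -
    have "(A *\<^sub>v v) $ l = (\<Sum>i<m. A $$ (l, i) * v $ i)" if "l < r" for l
      using assms that \<open>v \<in> carrier_vec m\<close> by (simp add: scalar_prod_def atLeast0LessThan)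
    moreover have "A *\<^sub>v v = 0\<^sub>v r \<longleftrightarrow> (\<forall>l<r. (A *\<^sub>v v) $ l = 0)"
    proof
      assume "A *\<^sub>v v = 0\<^sub>v r"
      then show "\<forall>l<r. (A *\<^sub>v v) $ l = 0" by (simp del: index_mult_mat_vec)
    next
      assume "\<forall>l<r. (A *\<^sub>v v) $ l = 0"
      then show "A *\<^sub>v v = 0\<^sub>v r" using assms by (intro eq_vecI) auto
    qed
    ultimately show ?thesis by simp
  qed
  then show ?thesis using assms unfolding circuit_lattice_def mat_kernel[OF assms] by auto
qed

lemma cocircuit_lattice_iff:
  assumes A: "A \<in> carrier_mat r m"
  shows "y \<in> cocircuit_lattice A \<longleftrightarrow>
           y \<in> carrier_vec m \<and> (\<exists>w. \<forall>i<m. of_int (y $ i) = (\<Sum>l<r. of_int (A $$ (l, i)) * w l :: rat))"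
proof -
  interpret vec_space "TYPE(rat)" m .
  have RA: "rat_mat A \<in> carrier_mat r m" using A by simp
  have val: "((rat_mat A)\<^sup>T *\<^sub>v w) $ i = (\<Sum>l<r. of_int (A $$ (l, i)) * w $ l)"
    if "w \<in> carrier_vec r" "i < m" for w i
    using A that by (simp add: scalar_prod_def atLeast0LessThan)
  have "rat_vec y \<in> row_space (rat_mat A) \<longleftrightarrow>
      (\<exists>w. \<forall>i<m. of_int (y $ i) = (\<Sum>l<r. of_int (A $$ (l, i)) * w l :: rat))" if y: "y \<in> carrier_vec m"
  proof
    assume "rat_vec y \<in> row_space (rat_mat A)"
    then obtain w where w: "w \<in> carrier_vec r" "(rat_mat A)\<^sup>T *\<^sub>v w = rat_vec y"
      unfolding row_space_eq[OF RA] using A by auto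
    have "of_int (y $ i) = (\<Sum>l<r. of_int (A $$ (l, i)) * w $ l)" if "i < m" for i
      using val[OF w(1) that] w(2) y that by simp
    then show "\<exists>w. \<forall>i<m. of_int (y $ i) = (\<Sum>l<r. of_int (A $$ (l, i)) * w l :: rat)" by blast
  next
    assume "\<exists>w. \<forall>i<m. of_int (y $ i) = (\<Sum>l<r. of_int (A $$ (l, i)) * w l :: rat)"
    then obtain w where w: "\<And>i. i < m \<Longrightarrow> of_int (y $ i) = (\<Sum>l<r. of_int (A $$ (l, i)) * w l :: rat)" by blast
    have "(rat_mat A)\<^sup>T *\<^sub>v vec r w = rat_vec y"
    proof (rule eq_vecI)
      fix i assume "i < dim_vec (rat_vec y)"
      then have i: "i < m" using y by simp
      show "((rat_mat A)\<^sup>T *\<^sub>v vec r w) $ i = rat_vec y $ i"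
        using val[OF _ i, of "vec r w"] w[OF i] y i by simp
    qed (use A y in simp)
    then show "rat_vec y \<in> row_space (rat_mat A)"
      unfolding row_space_eq[OF RA] using A y by auto
  qed
  then show ?thesis unfolding cocircuit_lattice_def using A by auto
qed

lemma lattices_orthogonal:
  assumes A: "A \<in> carrier_mat r m" and x: "x \<in> circuit_lattice A" and y: "y \<in> cocircuit_lattice A"
  shows "x \<bullet> y = 0"
proof -
  obtain w where w: "\<And>i. i < m \<Longrightarrow> of_int (y $ i) = (\<Sum>l<r. of_int (A $$ (l, i)) * w l :: rat)"
    using y cocircuit_lattice_iff[OF A] by blast
  have xk: "(\<Sum>i<m. A $$ (l, i) * x $ i) = 0" if "l < r" for l
    using x circuit_lattice_iff[OF A] that by blast
  have "rat_of_int (\<Sum>i<m. x $ i * y $ i) = (\<Sum>i<m. of_int (x $ i) * (\<Sum>l<r. of_int (A $$ (l, i)) * w l))"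
    using w by simp
  also have "\<dots> = (\<Sum>i<m. \<Sum>l<r. w l * of_int (A $$ (l, i) * x $ i))"
    by (simp add: sum_distrib_left mult_ac)
  also have "\<dots> = (\<Sum>l<r. \<Sum>i<m. w l * of_int (A $$ (l, i) * x $ i))"
    by (rule sum.swap)
  also have "\<dots> = (\<Sum>l<r. w l * of_int (\<Sum>i<m. A $$ (l, i) * x $ i))"
    by (simp add: sum_distrib_left)
  also have "\<dots> = 0" using xk by simp
  finally have "(\<Sum>i<m. x $ i * y $ i) = 0" by (simp only: of_int_eq_0_iff)
  moreover have "x \<in> carrier_vec m" "y \<in> carrier_vec m"
    using x y circuit_lattice_iff[OF A] cocircuit_lattice_iff[OF A] by blast+
  ultimately show ?thesis by (simp add: scalar_prod_def atLeast0LessThan)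
qed

lemma circuit_lattice_saturated:
  assumes A: "A \<in> carrier_mat r m"
  shows "saturated_lattice m (circuit_lattice A)"
proof
  note iff = circuit_lattice_iff[OF A]
  show "circuit_lattice A \<subseteq> carrier_vec m" "0\<^sub>v m \<in> circuit_lattice A" by (auto simp: iff)
  show "v + w \<in> circuit_lattice A" if "v \<in> circuit_lattice A" "w \<in> circuit_lattice A" for v w
    using that by (auto simp: iff distrib_left sum.distrib)
  have sm: "(\<Sum>i<m. A $$ (l, i) * (k \<cdot>\<^sub>v v) $ i) = k * (\<Sum>i<m. A $$ (l, i) * v $ i)"
    if "v \<in> carrier_vec m" for l k v
    using that by (simp add: sum_distrib_left mult_ac)
  show "k \<cdot>\<^sub>v v \<in> circuit_lattice A" if "v \<in> circuit_lattice A" for k v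
    using that sm by (auto simp: iff)
  show "v \<in> circuit_lattice A" if "v \<in> carrier_vec m" "k \<noteq> 0" "k \<cdot>\<^sub>v v \<in> circuit_lattice A" for v k
    using that sm by (auto simp: iff)
qed

lemma cocircuit_lattice_saturated:
  assumes A: "A \<in> carrier_mat r m"
  shows "saturated_lattice m (cocircuit_lattice A)"
proof
  note iff = cocircuit_lattice_iff[OF A]
  show "cocircuit_lattice A \<subseteq> carrier_vec m" by (auto simp: iff)
  show "0\<^sub>v m \<in> cocircuit_lattice A"
    unfolding iff by (intro conjI exI[of _ "\<lambda>_. 0"]) simp_all
  show "v + w \<in> cocircuit_lattice A" if vw: "v \<in> cocircuit_lattice A" "w \<in> cocircuit_lattice A" for v w
  proof -
    have vd: "v \<in> carrier_vec m" and wd: "w \<in> carrier_vec m" using vw iff by blast+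
    obtain p where p: "\<forall>i<m. of_int (v $ i) = (\<Sum>l<r. of_int (A $$ (l, i)) * p l :: rat)"
      using vw(1) unfolding iff by blast
    obtain q where q: "\<forall>i<m. of_int (w $ i) = (\<Sum>l<r. of_int (A $$ (l, i)) * q l :: rat)"
      using vw(2) unfolding iff by blast
    have "of_int ((v + w) $ i) = (\<Sum>l<r. of_int (A $$ (l, i)) * (p l + q l) :: rat)" if i: "i < m" for i
    proof -
      have "rat_of_int ((v + w) $ i) = of_int (v $ i) + of_int (w $ i)" using i vd wd by simp
      also have "\<dots> = (\<Sum>l<r. of_int (A $$ (l, i)) * p l) + (\<Sum>l<r. of_int (A $$ (l, i)) * q l)"
        using p q i by presburger
      finally show ?thesis unfolding distrib_left sum.distrib .
    qed
    then have "\<forall>i<m. of_int ((v + w) $ i) = (\<Sum>l<r. of_int (A $$ (l, i)) * (p l + q l) :: rat)" by blast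
    from exI[of "\<lambda>w'. \<forall>i<m. of_int ((v + w) $ i) = (\<Sum>l<r. of_int (A $$ (l, i)) * w' l :: rat)", OF this]
    show ?thesis unfolding iff using add_carrier_vec[OF vd wd] by blast
  qed
  show "k \<cdot>\<^sub>v v \<in> cocircuit_lattice A" if v: "v \<in> cocircuit_lattice A" for k v
  proof -
    have vd: "v \<in> carrier_vec m" using v iff by blast
    obtain p where p: "\<forall>i<m. of_int (v $ i) = (\<Sum>l<r. of_int (A $$ (l, i)) * p l :: rat)"
      using v unfolding iff by blast
    have "of_int ((k \<cdot>\<^sub>v v) $ i) = (\<Sum>l<r. of_int (A $$ (l, i)) * (of_int k * p l) :: rat)" if i: "i < m" for i
    proof -
      have "rat_of_int ((k \<cdot>\<^sub>v v) $ i) = of_int k * of_int (v $ i)" using i vd by simp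
      also have "\<dots> = of_int k * (\<Sum>l<r. of_int (A $$ (l, i)) * p l)"
        using p i by presburger
      finally show ?thesis unfolding sum_distrib_left mult.left_commute .
    qed
    then have "\<forall>i<m. of_int ((k \<cdot>\<^sub>v v) $ i) = (\<Sum>l<r. of_int (A $$ (l, i)) * (of_int k * p l) :: rat)" by blast
    from exI[of "\<lambda>w'. \<forall>i<m. of_int ((k \<cdot>\<^sub>v v) $ i) = (\<Sum>l<r. of_int (A $$ (l, i)) * w' l :: rat)", OF this]
    show ?thesis unfolding iff using smult_carrier_vec vd by blast
  qed
  show "v \<in> cocircuit_lattice A" if v: "v \<in> carrier_vec m" "k \<noteq> 0" "k \<cdot>\<^sub>v v \<in> cocircuit_lattice A" for v k
  proof -
    obtain p where p: "\<And>i. i < m \<Longrightarrow> of_int ((k \<cdot>\<^sub>v v) $ i) = (\<Sum>l<r. of_int (A $$ (l, i)) * p l :: rat)"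
      using v(3) unfolding iff by blast
    have "of_int (v $ i) = (\<Sum>l<r. of_int (A $$ (l, i)) * (p l / of_int k) :: rat)" if "i < m" for i
    proof -
      have "of_int k * of_int (v $ i) = (\<Sum>l<r. of_int (A $$ (l, i)) * p l :: rat)" 
        using p[OF that] v that by simp
      also have "\<dots> = of_int k * (\<Sum>l<r. of_int (A $$ (l, i)) * (p l / of_int k))"
        using v(2) by (simp add: sum_distrib_left)
      finally show ?thesis using v(2) by simp
    qed
    then have "\<forall>i<m. of_int (v $ i) = (\<Sum>l<r. of_int (A $$ (l, i)) * (p l / of_int k) :: rat)" by blast
    from exI[of "\<lambda>w'. \<forall>i<m. of_int (v $ i) = (\<Sum>l<r. of_int (A $$ (l, i)) * w' l :: rat)", OF this]
    show ?thesis unfolding iff using v(1) by blast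
  qed
qed

text \<open>
  Linear dependence is tested over the rationals; clearing denominators produces an integral relation
  with the same support. Two equal columns with different indices yield the relation
  \<open>u\<^sub>i - u\<^sub>j\<close>, so freeness also implies injectivity.
\<close>
lemma matroid_indep_iff:
  assumes A: "A \<in> carrier_mat r m" and S: "S \<subseteq> {0..<m}"
  shows "S \<in> matroid_indep A \<longleftrightarrow> (\<forall>v\<in>circuit_lattice A. supp v \<subseteq> S \<longrightarrow> v = 0\<^sub>v m)"
proof -
  interpret vec_space "TYPE(rat)" r .
  define c where "c = col (rat_mat A)"
  have c: "c i \<in> carrier_vec r" for i using A col_dim[of "rat_mat A" i] by (simp add: c_def)
  have ck: "c i $ l = of_int (A $$ (l, i))" if "i < m" "l < r" for i l
    using that A by (simp add: c_def)
  have cS: "c ` S \<subseteq> carrier_vec r" using c by auto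
  have fin: "finite S" using S by (auto intro: finite_subset)
  have indep: "S \<in> matroid_indep A \<longleftrightarrow> inj_on c S \<and> \<not> lin_dep (c ` S)"
    using A S by (simp add: matroid_indep_def c_def)
  show ?thesis
  proof
    assume "S \<in> matroid_indep A"
    then have inj: "inj_on c S" and ind: "\<not> lin_dep (c ` S)" using indep by auto
    show "\<forall>v\<in>circuit_lattice A. supp v \<subseteq> S \<longrightarrow> v = 0\<^sub>v m"
    proof (intro ballI impI, rule ccontr)
      fix v assume v: "v \<in> circuit_lattice A" "supp v \<subseteq> S" "v \<noteq> 0\<^sub>v m"
      have vd: "v \<in> carrier_vec m" and ker: "\<And>l. l < r \<Longrightarrow> (\<Sum>i<m. A $$ (l, i) * v $ i) = 0"
        using v circuit_lattice_iff[OF A] by auto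
      obtain j where j: "j < m" "v $ j \<noteq> 0"
        using supp_empty[OF vd] mem_supp[OF vd] v(3) by blast
      have jS: "j \<in> S" using j v vd by (auto simp: supp_def)
      define a where "a w = rat_of_int (v $ the_inv_into S c w)" for w
      have ac: "a (c i) = of_int (v $ i)" if "i \<in> S" for i
        using the_inv_into_f_f[OF inj that] by (simp add: a_def)
      have "lincomb a (c ` S) = 0\<^sub>v r"
      proof (rule eq_vecI)
        fix l assume "l < dim_vec (0\<^sub>v r :: rat vec)"
        then have l: "l < r" by simp
        have "lincomb a (c ` S) $ l = (\<Sum>x\<in>c ` S. a x * x $ l)"
          by (rule lincomb_index[OF l cS])
        also have "\<dots> = (\<Sum>i\<in>S. a (c i) * c i $ l)" by (simp add: sum.reindex[OF inj])
        also have "\<dots> = (\<Sum>i\<in>S. of_int (A $$ (l, i) * v $ i))"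
          using S l by (intro sum.cong) (auto simp: ac ck)
        also have "\<dots> = (\<Sum>i<m. of_int (A $$ (l, i) * v $ i))"
          using S v(2) vd by (intro sum.mono_neutral_left) (auto simp: supp_def)
        also have "\<dots> = of_int (\<Sum>i<m. A $$ (l, i) * v $ i)" by simp
        also have "\<dots> = 0" using ker[OF l] by simp
        finally show "lincomb a (c ` S) $ l = 0\<^sub>v r $ l" using l by simp
      qed (use lincomb_dim[OF finite_imageI[OF fin] cS, of a] in simp)
      moreover have "a (c j) \<noteq> 0" using ac[OF jS] j by simp
      moreover have "c j \<in> c ` S" using jS by simp
      moreover have "finite (c ` S)" using fin by simp
      ultimately have "lin_dep (c ` S)"
        unfolding lin_dep_def by (auto simp: class_ring_simps module_vec_simps intro!: exI[of _ "c ` S"] exI[of _ a] exI[of _ "c j"])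
      with ind show False by simp
    qed
  next
    assume free: "\<forall>v\<in>circuit_lattice A. supp v \<subseteq> S \<longrightarrow> v = 0\<^sub>v m"
    have inj: "inj_on c S"
    proof (rule inj_onI, rule ccontr)
      fix i j assume ij: "i \<in> S" "j \<in> S" "c i = c j" "i \<noteq> j"
      then have ijm: "i < m" "j < m" using S by auto
      define v :: "int vec" where "v = unit_vec m i - unit_vec m j"
      have vi: "v $ k = (if k = i then 1 else 0) - (if k = j then 1 else 0)" if "k < m" for k
        using that ijm by (simp add: v_def unit_vec_def)
      have vd: "v \<in> carrier_vec m" by (simp add: v_def)
      have "(\<Sum>k<m. A $$ (l, k) * v $ k) = 0" if l: "l < r" for l
      proof -
        have eq: "A $$ (l, i) = A $$ (l, j)"
          using ck[OF ijm(1) l] ck[OF ijm(2) l] ij(3) by simp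
        have "(\<Sum>k<m. A $$ (l, k) * v $ k) = (\<Sum>k<m. (if k = i then A $$ (l, k) else 0) - (if k = j then A $$ (l, k) else 0))"
          using vi by (intro sum.cong) auto
        also have "\<dots> = 0" using ijm eq by (simp add: sum_subtractf)
        finally show ?thesis .
      qed
      then have "v \<in> circuit_lattice A" using vd circuit_lattice_iff[OF A] by blast
      moreover have "supp v \<subseteq> S" using vi vd ij by (auto simp: supp_def split: if_splits)
      ultimately have "v = 0\<^sub>v m" using free by blast
      then show False using vi[OF ijm(1)] ij(4) ijm by simp
    qed
    have "\<not> lin_dep (c ` S)"
    proof
      assume "lin_dep (c ` S)"
      then obtain T a w where T: "finite T" "T \<subseteq> c ` S" "lincomb a T = 0\<^sub>v r" "w \<in> T" "a w \<noteq> 0"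
        unfolding lin_dep_def by (auto simp: class_ring_simps module_vec_simps)
      define U where "U = {i \<in> S. c i \<in> T}"
      have U: "c ` U = T" "inj_on c U" "U \<subseteq> {..<m}"
        using T(2) inj S by (auto simp: U_def inj_on_def)
      define x where "x i = (if i \<in> U then a (c i) else 0)" for i
      obtain d z where d: "d > 0" "\<forall>i<m. of_int d * x i = of_int (z i)"
        using clear_denominators[of m x] by blast
      define v where "v = vec m z"
      have vd: "v \<in> carrier_vec m" by (simp add: v_def)
      have "(\<Sum>i<m. A $$ (l, i) * v $ i) = 0" if l: "l < r" for l
      proof -
        have "rat_of_int (\<Sum>i<m. A $$ (l, i) * v $ i) = (\<Sum>i<m. of_int (A $$ (l, i)) * (of_int d * x i))"
          using d by (simp add: v_def)
        also have "\<dots> = (\<Sum>i\<in>U. of_int (A $$ (l, i)) * (of_int d * x i))"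
          using U by (intro sum.mono_neutral_right) (auto simp: x_def)
        also have "\<dots> = of_int d * (\<Sum>i\<in>U. a (c i) * c i $ l)"
          using U l unfolding sum_distrib_left
          by (intro sum.cong) (auto simp: x_def ck mult_ac)
        also have "(\<Sum>i\<in>U. a (c i) * c i $ l) = (\<Sum>x\<in>T. a x * x $ l)"
          unfolding U(1)[symmetric] by (simp add: sum.reindex[OF U(2)])
        also have "\<dots> = lincomb a T $ l"
          using T(2) c by (subst lincomb_index[OF l]) auto
        also have "\<dots> = 0" using T(3) l by simp
        finally show ?thesis by (simp only: of_int_eq_0_iff mult_zero_right)
      qed
      then have "v \<in> circuit_lattice A" using vd circuit_lattice_iff[OF A] by blast
      moreover have "supp v \<subseteq> S"
      proof
        fix i assume "i \<in> supp v"
        then have i: "i < m" "z i \<noteq> 0" by (auto simp: supp_def v_def)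
        then have "of_int d * x i \<noteq> 0" using d(2) by simp
        then have "i \<in> U" by (auto simp: x_def split: if_splits)
        then show "i \<in> S" by (simp add: U_def)
      qed
      ultimately have v0: "v = 0\<^sub>v m" using free by blast
      obtain i where i: "i \<in> U" "c i = w" using T(4) U(1) by auto
      then have im: "i < m" using U by auto
      have "of_int d * x i \<noteq> 0" using d(1) T(5) i by (simp add: x_def)
      then have "z i \<noteq> 0" using d(2) im by simp
      moreover have "v $ i = z i" using im by (simp add: v_def)
      ultimately show False using v0 im by simp
    qed
    then show "S \<in> matroid_indep A" using inj indep by simp
  qed
qed

lemma pick_lessThan: "i < r \<Longrightarrow> pick {0..<r} i = i"
proof -
  assume "i < r"
  moreover have "{a. a < r \<and> a \<in> UNIV} = {0..<r}" by auto
  ultimately show ?thesis using pick_reduce_set[of i r UNIV] by (simp add: pick_UNIV)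
qed

text \<open>
  The columns may be listed in any order and with repetitions, as needed for Cramer's rule. A repetition
  makes the determinant zero, and a list without repetitions is a permutation of the sorted list that
  underlies a submatrix.
\<close>
lemma totally_unimodular_det_columns:
  assumes A: "A \<in> carrier_mat r m" and tu: "totally_unimodular A" and f: "\<And>k. k < r \<Longrightarrow> f k < m"
  shows "det (mat r r (\<lambda>(i, k). A $$ (i, f k))) \<in> {-1, 0, 1}" (is "det ?M \<in> _")
proof (cases "inj_on f {0..<r}")
  case False
  then obtain j k where jk: "j < r" "k < r" "f j = f k" "j \<noteq> k" by (auto simp: inj_on_def)
  have "col ?M j = col ?M k" using jk by (intro eq_vecI) auto
  then have "det ?M = 0" using jk det_identical_columns[of ?M r j k] by auto
  then show ?thesis by simp
next
  case True
  define J where "J = f ` {0..<r}"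
  have J: "J \<subseteq> {0..<m}" "card J = r" using f card_image[OF True] by (auto simp: J_def)
  have JJ: "{j. j < m \<and> j \<in> J} = J" using J by auto
  have finJ: "finite J" by (simp add: J_def)
  define N where "N = submatrix A {0..<r} J"
  have "det N \<in> {-1, 0, 1}"
    using tu A J unfolding totally_unimodular_def N_def by auto
  have N: "N \<in> carrier_mat r r" 
    using A J JJ by (auto simp: N_def submatrix_def)
  have Nik: "N $$ (i, k) = A $$ (i, pick J k)" if "i < r" "k < r" for i k
  proof -
    have "{i. i < r \<and> i \<in> {0..<r}} = {0..<r}" by auto
    then show ?thesis using that A J JJ pick_lessThan[of i r] by (auto simp: N_def submatrix_def)
  qed
  \<comment> \<open>The position of \<open>f k\<close> in the sorted enumeration of \<open>J\<close>.\<close>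
  define p where "p k = (if k < r then card {a\<in>J. a < f k} else k)" for k
  have pk: "p k < r" "pick J (p k) = f k" if "k < r" for k
  proof -
    have fk: "f k \<in> J" using that by (simp add: J_def)
    have "{a\<in>J. a < f k} \<subset> J" using fk by auto
    then show "p k < r" using that J(2) finJ psubset_card_mono[of J] by (auto simp: p_def)
    show "pick J (p k) = f k" using pick_card_in_set[OF fk] that by (simp add: p_def)
  qed
  have "inj_on p {0..<r}"
    using pk(2) True by (metis (no_types, lifting) atLeastLessThan_iff inj_on_def)
  moreover have "p ` {0..<r} \<subseteq> {0..<r}" using pk(1) by auto
  ultimately have "bij_betw p {0..<r} {0..<r}"
    by (simp add: bij_betw_def endo_inj_surj)
  then have perm: "p permutes {0..<r}" by (rule bij_imp_permutes) (simp add: p_def)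
  have NT: "N\<^sup>T \<in> carrier_mat r r" using N by simp
  have "?M = (mat r r (\<lambda>(i, j). N\<^sup>T $$ (p i, j)))\<^sup>T"
    using N Nik pk by (intro eq_matI) auto
  then have "det ?M = det (mat r r (\<lambda>(i, j). N\<^sup>T $$ (p i, j)))" by (metis det_transpose mat_carrier)
  also have "\<dots> = signof p * det N" using det_permute_rows[OF NT perm] det_transpose[OF N] by simp
  finally show ?thesis using \<open>det N \<in> {-1, 0, 1}\<close> by (auto simp: sign_def)
qed

text \<open>
  After normalising the columns of a basis to unit columns by row operations, the rows of the matrix are
  the fundamental cocircuits. The inverse of the basis matrix \<open>N\<close> is \<open>d\<close> times its adjugate, since
  \<open>d = det N\<close> is \<open>1\<close> or \<open>-1\<close>; by Cramer's rule every entry of the normalised matrix is, up to sign, the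
  determinant of \<open>N\<close> with one column replaced by a column of \<open>A\<close>.
\<close>
lemma fundamental_row:
  assumes A: "A \<in> carrier_mat r m" and tu: "totally_unimodular A"
    and f: "\<And>k. k < r \<Longrightarrow> f k < m" and det: "det (mat r r (\<lambda>(i, k). A $$ (i, f k))) \<noteq> 0"
    and k: "k < r"
  shows "\<exists>y\<in>cocircuit_lattice A. (\<forall>i<m. y $ i \<in> {-1, 0, 1}) \<and>
           (\<forall>k'<r. y $ f k' = (if k' = k then 1 else 0))"
proof -
  define N where "N = mat r r (\<lambda>(i, k). A $$ (i, f k))"
  define d where "d = det N"
  have N: "N \<in> carrier_mat r r" by (simp add: N_def)
  have d: "d \<in> {-1, 1}" using totally_unimodular_det_columns[OF A tu, of f] f det by (auto simp: d_def N_def)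
  then have dd: "d * d = 1" by auto
  note adj = adj_mat[OF N]
  define w where "w l = d * adj_mat N $$ (k, l)" for l
  define y where "y = vec m (\<lambda>i. \<Sum>l<r. A $$ (l, i) * w l)"
  have yd: "y \<in> carrier_vec m" by (simp add: y_def)
  have "\<forall>i<m. of_int (y $ i) = (\<Sum>l<r. of_int (A $$ (l, i)) * of_int (w l) :: rat)"
    by (simp add: y_def)
  from exI[of "\<lambda>w'. \<forall>i<m. of_int (y $ i) = (\<Sum>l<r. of_int (A $$ (l, i)) * w' l :: rat)", OF this]
  have yL: "y \<in> cocircuit_lattice A" using yd unfolding cocircuit_lattice_iff[OF A] by blast
  have small: "y $ i \<in> {-1, 0, 1}" if i: "i < m" for i
  proof -
    define b where "b = col A i"
    have b: "b \<in> carrier_vec r" using A col_dim[of A i] by (simp add: b_def)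
    define Q where "Q = d \<cdot>\<^sub>m adj_mat N"
    have Q: "Q \<in> carrier_mat r r" using adj(1) by (simp add: Q_def)
    have "N * Q = d \<cdot>\<^sub>m (N * adj_mat N)" unfolding Q_def using N adj(1) by (intro mult_smult_distrib)
    also have "\<dots> = 1\<^sub>m r" using adj(2) dd by (intro eq_matI) (auto simp: d_def)
    finally have NQ: "N * Q = 1\<^sub>m r" .
    define x where "x = Q *\<^sub>v b"
    have x: "x \<in> carrier_vec r" using Q b by (simp add: x_def)
    have "N *\<^sub>v x = (N * Q) *\<^sub>v b" unfolding x_def using N Q b by (simp add: assoc_mult_mat_vec)
    also have "\<dots> = b" unfolding NQ using b by simp
    finally have Nx: "N *\<^sub>v x = b" .
    have "replace_col N b k = mat r r (\<lambda>(l, k'). A $$ (l, (f(k := i)) k'))"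
      using A i k by (intro eq_matI) (auto simp: replace_col_def N_def b_def)
    then have "det (replace_col N b k) \<in> {-1, 0, 1}"
      using totally_unimodular_det_columns[OF A tu, of "f(k := i)"] f i by simp
    then have "x $ k * d \<in> {-1, 0, 1}" using cramer_lemma_mat[OF N x k] by (simp add: Nx d_def)
    moreover have "x $ k = y $ i"
      using k i A b adj(1) by (simp add: x_def Q_def y_def w_def b_def scalar_prod_def sum_distrib_left atLeast0LessThan mult_ac)
    ultimately show ?thesis using d by auto
  qed
  have "y $ f k' = (if k' = k then 1 else 0)" if k': "k' < r" for k'
  proof -
    have "(adj_mat N * N) $$ (k, k') = (\<Sum>l<r. adj_mat N $$ (k, l) * A $$ (l, f k'))"
      using adj(1) N k k' by (simp add: scalar_prod_def atLeast0LessThan) (simp add: N_def)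
    then have "y $ f k' = d * (adj_mat N * N) $$ (k, k')"
      using f[OF k'] by (simp add: y_def w_def sum_distrib_left mult_ac)
    also have "\<dots> = (if k' = k then 1 else 0)" unfolding adj(3) using k k' dd by (auto simp: d_def)
    finally show ?thesis .
  qed
  then show ?thesis using yL small by blast
qed

text \<open>
  The columns of a basis form a maximal linearly independent set of columns, so their number is the rank
  \<open>r\<close> and they form a nonsingular square matrix.
\<close>
lemma base_columns:
  assumes A: "A \<in> carrier_mat r m" and rank: "vec_space.rank r (rat_mat A) = r"
    and B: "B \<subseteq> {0..<m}" "B \<in> matroid_indep A" "\<And>i. i \<in> {0..<m} - B \<Longrightarrow> insert i B \<notin> matroid_indep A"
  obtains f where "bij_betw f {0..<r} B" "det (mat r r (\<lambda>(i, k). A $$ (i, f k))) \<noteq> 0"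
proof -
  interpret vec_space "TYPE(rat)" r .
  define c where "c = col (rat_mat A)"
  have RA: "rat_mat A \<in> carrier_mat r m" using A by simp
  have indep: "S \<in> matroid_indep A \<longleftrightarrow> inj_on c S \<and> \<not> lin_dep (c ` S)" if "S \<subseteq> {0..<m}" for S
    using A that by (simp add: matroid_indep_def c_def)
  have inj: "inj_on c B" and ind: "\<not> lin_dep (c ` B)" using indep B by auto
  have cols: "set (cols (rat_mat A)) = c ` {0..<m}" using A by (auto simp: cols_def c_def)
  have "maximal (c ` B) (\<lambda>T. T \<subseteq> set (cols (rat_mat A)) \<and> lin_indpt T)"
    unfolding maximal_def
  proof (intro conjI allI impI)
    show "c ` B \<subseteq> set (cols (rat_mat A))" using B cols by auto
    show "lin_indpt (c ` B)" by (rule ind)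
    fix T assume T: "c ` B \<subseteq> T \<and> T \<subseteq> set (cols (rat_mat A)) \<and> lin_indpt T"
    show "T = c ` B"
    proof (rule ccontr)
      assume "T \<noteq> c ` B"
      then obtain t where "t \<in> T" "t \<notin> c ` B" using T by blast
      moreover then obtain i where "i < m" "t = c i" using T cols by auto
      ultimately have i: "i < m" "c i \<in> T" "c i \<notin> c ` B" by auto
      then have "i \<in> {0..<m} - B" by auto
      moreover have "inj_on c (insert i B)" using inj i by auto
      moreover have "\<not> lin_dep (c ` insert i B)"
      proof -
        have "c ` insert i B \<subseteq> T" "lin_indpt T" using T i by auto
        then show ?thesis using subset_li_is_li by blast
      qed
      ultimately show False using B(3) indep[of "insert i B"] B(1) by auto
    qed
  qed
  from rank_card_indpt[OF RA this] have cB: "card B = r" using rank inj by (simp add: card_image)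
  have "finite B" using B(1) by (auto intro: finite_subset)
  then obtain f where f: "bij_betw f {0..<r} B" using ex_bij_betw_nat_finite cB by blast
  define N where "N = mat r r (\<lambda>(i, k). A $$ (i, f k))"
  have fm: "f k < m" if "k < r" for k using f B(1) that by (force simp: bij_betw_def)
  have N: "rat_mat N \<in> carrier_mat r r" by (simp add: N_def)
  have colsN: "cols (rat_mat N) = map (\<lambda>k. c (f k)) [0..<r]"
    using A fm by (intro nth_equalityI) (auto simp: N_def c_def intro!: eq_vecI)
  have "distinct (cols (rat_mat N))"
    unfolding colsN using f inj by (auto simp: distinct_map bij_betw_def inj_on_def)
  moreover have "set (cols (rat_mat N)) = c ` B" unfolding colsN using f by (auto simp: bij_betw_def)
  ultimately have "rank (rat_mat N) = r" using lin_indpt_full_rank[OF N] ind by simp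
  then have "det (rat_mat N) \<noteq> 0" using det_rank_iff[OF N] by simp
  then have "det N \<noteq> 0" by (simp add: of_int_hom.hom_det)
  with f that show thesis unfolding N_def by blast
qed

section \<open>Reversal classes as residue classes of sign vectors\<close>

locale unimodular_representation =
  fixes A :: "int mat" and r m :: nat
  assumes A: "A \<in> carrier_mat r m"
    and rank: "vec_space.rank r (rat_mat A) = r"
    and tu: "totally_unimodular A"

lemma (in saturated_lattice) maximal_free_iff:
  "maximal_free B {0..<m} \<longleftrightarrow> B \<subseteq> {0..<m} \<and> free B \<and> (\<forall>B'. B' \<subseteq> {0..<m} \<and> free B' \<and> B \<subseteq> B' \<longrightarrow> B' = B)"
proof
  assume *: "maximal_free B {0..<m}"
  have "B' = B" if B': "B' \<subseteq> {0..<m}" "free B'" "B \<subseteq> B'" for B'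
  proof (rule ccontr)
    assume "B' \<noteq> B"
    then obtain i where "i \<in> B'" "i \<notin> B" using B' by blast
    then have "\<not> free (insert i B)" "insert i B \<subseteq> B'" using * B' by (auto simp: maximal_free_def)
    then show False using free_subset B'(2) by blast
  qed
  then show "B \<subseteq> {0..<m} \<and> free B \<and> (\<forall>B'. B' \<subseteq> {0..<m} \<and> free B' \<and> B \<subseteq> B' \<longrightarrow> B' = B)"
    using * by (auto simp: maximal_free_def)
next
  assume *: "B \<subseteq> {0..<m} \<and> free B \<and> (\<forall>B'. B' \<subseteq> {0..<m} \<and> free B' \<and> B \<subseteq> B' \<longrightarrow> B' = B)"
  have "\<not> free (insert i B)" if "i \<in> {0..<m} - B" for i
  proof
    assume "free (insert i B)"
    moreover have "insert i B \<subseteq> {0..<m}" "B \<subseteq> insert i B" using that * by auto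
    ultimately have "insert i B = B" using * by blast
    then show False using that by auto
  qed
  then show "maximal_free B {0..<m}" using * by (auto simp: maximal_free_def)
qed

context unimodular_representation
begin

abbreviation L where "L \<equiv> circuit_lattice A"
abbreviation L' where "L' \<equiv> cocircuit_lattice A"

sublocale P: saturated_lattice m L
  using circuit_lattice_saturated[OF A] .

lemma indep_iff_free: "S \<in> matroid_indep A \<longleftrightarrow> S \<subseteq> {0..<m} \<and> P.free S"
proof (cases "S \<subseteq> {0..<m}")
  case True
  then show ?thesis using matroid_indep_iff[OF A True] by (simp add: P.free_def)
next
  case False
  then show ?thesis using A by (auto simp: matroid_indep_def)
qed

sublocale regular_lattice_pair m L L'
proof (intro regular_lattice_pair.intro regular_lattice_pair_axioms.intro)
  show "saturated_lattice m L" "saturated_lattice m L'"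
    using circuit_lattice_saturated[OF A] cocircuit_lattice_saturated[OF A] .
  show "x \<bullet> y = 0" if "x \<in> L" "y \<in> L'" for x y
    using lattices_orthogonal[OF A that] .
  fix B j assume B: "P.maximal_free B {0..<m}" and j: "j \<in> B"
  have Bm: "B \<subseteq> {0..<m}" "B \<in> matroid_indep A" using B by (auto simp: P.maximal_free_def indep_iff_free)
  have "insert i B \<notin> matroid_indep A" if "i \<in> {0..<m} - B" for i
    using B that by (auto simp: P.maximal_free_def indep_iff_free)
  then obtain f where f: "bij_betw f {0..<r} B" "det (mat r r (\<lambda>(i, k). A $$ (i, f k))) \<noteq> 0"
    using base_columns[OF A rank Bm] by blast
  have fm: "f k < m" if "k < r" for k using f(1) Bm(1) that by (force simp: bij_betw_def)
  obtain k where k: "k < r" "f k = j" using f(1) j by (auto simp: bij_betw_def)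
  obtain y where y: "y \<in> L'" "\<forall>i<m. y $ i \<in> {-1, 0, 1}" "\<forall>k'<r. y $ f k' = (if k' = k then 1 else 0)"
    using fundamental_row[OF A tu, of f k] fm f(2) k(1) by blast
  have "y $ j = 1" using y(3) k by auto
  moreover have "y $ i = 0" if i: "i \<in> B - {j}" for i
  proof -
    obtain k' where "k' < r" "f k' = i" using f(1) i by (auto simp: bij_betw_def)
    then show ?thesis using y(3) k(2) i by auto
  qed
  ultimately show "\<exists>y\<in>L'. (\<forall>i<m. y $ i \<in> {-1, 0, 1}) \<and> y $ j = 1 \<and> (\<forall>i\<in>B - {j}. y $ i = 0)"
    using y(1,2) by blast
qed

lemma bases_iff_maximal_free: "B \<in> bases_of (matroid_indep A) \<longleftrightarrow> P.maximal_free B {0..<m}"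
  unfolding P.maximal_free_iff by (simp add: bases_of_def indep_iff_free Ball_def imp_conjL conj_assoc)

lemma signed_circuitI:
  assumes C: "P.elementary C" "\<forall>i<m. C $ i \<in> {-1, 0, 1}"
  shows "signed_circuit A C"
proof -
  have CL: "C \<in> L" "C \<noteq> 0\<^sub>v m" using C by (auto simp: P.elementary_def)
  have m: "dim_col A = m" using A by simp
  have sub: "supp C \<subseteq> {0..<m}" using CL by (auto simp: supp_def)
  have "supp C \<notin> matroid_indep A" using CL by (auto simp: indep_iff_free P.free_def)
  moreover have "D \<in> matroid_indep A" if D: "D \<subset> supp C" for D
    unfolding indep_iff_free P.free_def
  proof (intro conjI ballI impI)
    show "D \<subseteq> {0..<m}" using D sub by blast
    fix v assume "v \<in> L" "supp v \<subseteq> D"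
    then show "v = 0\<^sub>v m" using C(1) D unfolding P.elementary_def by blast
  qed
  ultimately show ?thesis
    using CL C(2) sub unfolding signed_circuit_def circuits_def circuits_of_def m by blast
qed

text \<open>
  If \<open>S\<close> is disjoint from a basis, then a vector of \<open>L'\<close> supported in \<open>S\<close> vanishes on this basis and is
  zero. If every basis meets \<open>S\<close>, then some fundamental cocircuit is supported in \<open>S\<close>.
\<close>
lemma dual_indep_iff: 
  assumes S: "S \<subseteq> {0..<m}"
  shows "S \<in> dual_indep {0..<m} (matroid_indep A) \<longleftrightarrow> D.free S"
proof
  assume "S \<in> dual_indep {0..<m} (matroid_indep A)"
  then obtain B where B: "P.maximal_free B {0..<m}" "S \<inter> B = {}" by (auto simp: dual_indep_def bases_iff_maximal_free)
  show "D.free S"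
    unfolding D.free_def
  proof (intro ballI impI)
    fix y assume y: "y \<in> L'" "supp y \<subseteq> S"
    have "y $ i = 0" if "i \<in> B" for i
    proof -
      have "i < m" "i \<notin> supp y" using that B y by (auto simp: P.maximal_free_def)
      then show ?thesis using y(1) by (auto simp: supp_def)
    qed
    then show "y = 0\<^sub>v m" using dual_vanishing_zero[OF B(1) y(1)] by blast
  qed
next
  assume free: "D.free S"
  have "\<exists>B. B \<subseteq> {0..<m} - S \<and> P.free B \<and> P.maximal_free B {0..<m}"
  proof (rule ccontr)
    assume no: "\<not> ?thesis"
    obtain B j where B: "P.maximal_free B {0..<m}" "j \<in> B - ({0..<m} - S)"
      and van: "\<And>y. y \<in> L' \<Longrightarrow> (\<forall>i\<in>B - {j}. y $ i = 0) \<Longrightarrow> supp y \<inter> ({0..<m} - S) = {}"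
      using fundamental_cocircuit_support[of "{0..<m} - S"] no by blast
    have "j \<in> B" using B by blast
    from fundamental_cocircuit[OF B(1) this] obtain y where
      y: "y \<in> L'" "y $ j = 1" "\<forall>i\<in>B - {j}. y $ i = 0" by blast
    have "supp y \<subseteq> {0..<m}" using y(1) by (auto simp: supp_def)
    then have "supp y \<subseteq> S" using van[OF y(1,3)] by blast
    then have "y = 0\<^sub>v m" using free y(1) by (auto simp: D.free_def)
    moreover have "j < m" using B by (auto simp: P.maximal_free_def)
    ultimately show False using y(2) by simp
  qed
  then show "S \<in> dual_indep {0..<m} (matroid_indep A)"
    using S by (auto simp: dual_indep_def bases_iff_maximal_free)
qed

lemma signed_cocircuitI:
  assumes C: "D.elementary C" "\<forall>i<m. C $ i \<in> {-1, 0, 1}"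
  shows "signed_cocircuit A C"
proof -
  have CL: "C \<in> L'" "C \<noteq> 0\<^sub>v m" using C by (auto simp: D.elementary_def)
  have m: "dim_col A = m" using A by simp
  have sub: "supp C \<subseteq> {0..<m}" using CL by (auto simp: supp_def)
  have "supp C \<notin> dual_indep {0..<m} (matroid_indep A)"
    unfolding dual_indep_iff[OF sub] using CL by (auto simp: D.free_def)
  moreover have "S \<in> dual_indep {0..<m} (matroid_indep A)" if S: "S \<subset> supp C" for S
  proof -
    have "S \<subseteq> {0..<m}" using S sub by blast
    moreover have "D.free S" unfolding D.free_def
    proof (intro ballI impI)
      fix v assume "v \<in> L'" "supp v \<subseteq> S"
      then show "v = 0\<^sub>v m" using C(1) S unfolding D.elementary_def by blast
    qed
    ultimately show ?thesis using dual_indep_iff by blast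
  qed
  ultimately show ?thesis
    using CL C(2) sub unfolding signed_cocircuit_def cocircuits_def circuits_of_def m by blast
qed

lemma orientations_eq: "orientations A = sign_vectors m"
  using A by (simp add: orientations_def sign_vectors_def)

lemma lattice_sum_eq: "lattice_sum A = sum_lattice"
  by (simp add: lattice_sum_def sum_lattice_def)

text \<open>
  Congruence modulo \<open>2 (L + L')\<close>, the invariant that classifies orientations up to reversals.
\<close>
definition congr :: "int vec \<Rightarrow> int vec \<Rightarrow> bool" where
  "congr x y \<longleftrightarrow> (\<exists>g\<in>sum_lattice. x - y = 2 \<cdot>\<^sub>v g)"

lemma sum_lattice_dim: "g \<in> sum_lattice \<Longrightarrow> g \<in> carrier_vec m"
  using sum_lattice_carrier by blast

lemma congrI:
  assumes "x \<in> carrier_vec m" "y \<in> carrier_vec m" "g \<in> sum_lattice" "\<And>i. i < m \<Longrightarrow> x $ i - y $ i = 2 * g $ i"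
  shows "congr x y"
  unfolding congr_def
proof (rule bexI[OF _ assms(3)], rule eq_vecI)
  fix i assume "i < dim_vec (2 \<cdot>\<^sub>v g)"
  then have "i < m" using sum_lattice_dim[OF assms(3)] by simp
  then show "(x - y) $ i = (2 \<cdot>\<^sub>v g) $ i" using assms sum_lattice_dim[OF assms(3)] by simp
qed (use assms(2) sum_lattice_dim[OF assms(3)] in simp)

lemma congrD:
  assumes "congr x y" "x \<in> carrier_vec m" "y \<in> carrier_vec m"
  shows "\<exists>g\<in>sum_lattice. \<forall>i<m. x $ i - y $ i = 2 * g $ i"
proof -
  obtain g where g: "g \<in> sum_lattice" "x - y = 2 \<cdot>\<^sub>v g" using assms(1) by (auto simp: congr_def)
  have "x $ i - y $ i = 2 * g $ i" if i: "i < m" for i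
  proof -
    have "x $ i - y $ i = (x - y) $ i" using assms(2,3) i by simp
    also have "\<dots> = 2 * g $ i" unfolding g(2) using sum_lattice_dim[OF g(1)] i by simp
    finally show ?thesis .
  qed
  with g(1) show ?thesis by blast
qed

lemma congr_refl: "x \<in> carrier_vec m \<Longrightarrow> congr x x"
  by (rule congrI[OF _ _ sum_lattice_zero]) auto

lemma congr_sym:
  assumes "congr x y" "x \<in> carrier_vec m" "y \<in> carrier_vec m"
  shows "congr y x"
proof -
  obtain g where g: "g \<in> sum_lattice" "\<And>i. i < m \<Longrightarrow> x $ i - y $ i = 2 * g $ i" using congrD[OF assms] by blast
  show ?thesis
  proof (rule congrI[OF assms(3,2) sum_lattice_uminus[OF g(1)]])
    fix i assume "i < m"
    then show "y $ i - x $ i = 2 * (- g) $ i" using g(2)[of i] sum_lattice_dim[OF g(1)] by simp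
  qed
qed

lemma congr_trans:
  assumes "congr x y" "congr y z" "x \<in> carrier_vec m" "y \<in> carrier_vec m" "z \<in> carrier_vec m"
  shows "congr x z"
proof -
  obtain g where g: "g \<in> sum_lattice" "\<And>i. i < m \<Longrightarrow> x $ i - y $ i = 2 * g $ i" using congrD[OF assms(1,3,4)] by blast
  obtain h where h: "h \<in> sum_lattice" "\<And>i. i < m \<Longrightarrow> y $ i - z $ i = 2 * h $ i" using congrD[OF assms(2,4,5)] by blast
  show ?thesis
  proof (rule congrI[OF assms(3,5) sum_lattice_add[OF g(1) h(1)]])
    fix i assume "i < m"
    then show "x $ i - z $ i = 2 * (g + h) $ i"
      using g(2)[of i] h(2)[of i] sum_lattice_dim[OF g(1)] sum_lattice_dim[OF h(1)] by simp
  qed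
qed

lemma congr_shift:
  assumes "congr x y" "x \<in> carrier_vec m" "y \<in> carrier_vec m" "z \<in> carrier_vec m"
  shows "congr (x - z) (y - z)"
proof -
  obtain g where g: "g \<in> sum_lattice" "\<And>i. i < m \<Longrightarrow> x $ i - y $ i = 2 * g $ i" using congrD[OF assms(1,2,3)] by blast
  show ?thesis
  proof (rule congrI[OF _ _ g(1)])
    fix i assume "i < m"
    then show "(x - z) $ i - (y - z) $ i = 2 * g $ i" using g(2)[of i] assms by simp
  qed (use assms in auto)
qed

lemma negate_on_supp:
  assumes X: "X \<in> carrier_vec m" and C: "C \<in> carrier_vec m" "compatible X C"
  shows "negate_on (supp C) X = X - 2 \<cdot>\<^sub>v C"
proof (rule eq_vecI)
  fix i assume "i < dim_vec (X - 2 \<cdot>\<^sub>v C)"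
  then have i: "i < m" using C by simp
  then show "negate_on (supp C) X $ i = (X - 2 \<cdot>\<^sub>v C) $ i"
    using X C by (auto simp: negate_on_def compatible_def supp_def)
qed (use X C in \<open>simp add: negate_on_def\<close>)

lemma reversal_congr:
  assumes "reversal A X Y"
  shows "X \<in> sign_vectors m \<and> Y \<in> sign_vectors m \<and> congr X Y"
proof -
  obtain C where X: "X \<in> sign_vectors m" and C: "signed_circuit A C \<or> signed_cocircuit A C" "compatible X C"
    and Y: "Y = negate_on (supp C) X"
    using assms by (auto simp: reversal_def orientations_eq)
  have CM: "C \<in> sum_lattice" using C(1) sum_latticeI1 sum_latticeI2 by (auto simp: signed_circuit_def signed_cocircuit_def)
  note Xd = sign_vectors_dim[OF X]
  have Y2: "Y = X - 2 \<cdot>\<^sub>v C" using negate_on_supp[OF Xd sum_lattice_dim[OF CM] C(2)] Y by simp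
  have Yd: "Y \<in> carrier_vec m" using Xd by (simp add: Y negate_on_def)
  have "Y $ i \<in> {-1, 1}" if "i < m" for i
    using sign_vectorsD[OF X that] Xd that by (auto simp: Y negate_on_def)
  then have "Y \<in> sign_vectors m" using Yd by (simp add: sign_vectors_def)
  moreover have "congr X Y"
  proof (rule congrI[OF Xd Yd CM])
    fix i assume "i < m"
    then show "X $ i - Y $ i = 2 * C $ i" using Xd sum_lattice_dim[OF CM] by (simp add: Y2)
  qed
  ultimately show ?thesis using X by blast
qed

lemma reversal_step:
  assumes X: "X \<in> sign_vectors m" and C: "P.elementary C \<or> D.elementary C" "\<forall>i<m. C $ i \<in> {-1, 0, 1}"
    and conf: "conformal C X"
  shows "reversal A X (X - 2 \<cdot>\<^sub>v C)"
proof -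
  have Cd: "C \<in> carrier_vec m" using C(1) by (auto simp: P.elementary_def D.elementary_def)
  have "X $ i = C $ i" if "i \<in> supp C" for i
  proof -
    have i: "i < m" "C $ i \<noteq> 0" using that Cd by (auto simp: supp_def)
    then have "0 < C $ i * X $ i" using conf Cd by (auto simp: conformal_def)
    moreover have "C $ i \<in> {-1, 0, 1}" using C(2) i(1) by blast
    ultimately show ?thesis using sign_vectorsD[OF X i(1)] by auto
  qed
  then have comp: "compatible X C" by (simp add: compatible_def)
  show ?thesis
    unfolding reversal_def orientations_eq
    using X comp negate_on_supp[OF sign_vectors_dim[OF X] Cd comp] C signed_circuitI signed_cocircuitI
    by metis
qed

text \<open>
  For congruent orientations, first the circuits that make up \<open>a\<close> are reversed, leading to \<open>Z = X - 2 a\<close>,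
  and then the cocircuits that make up \<open>b\<close>. The latter are still compatible with \<open>Z\<close>, which agrees with \<open>X\<close>
  outside the support of \<open>a\<close>.
\<close>
lemma equivclp_reversal_iff:
  assumes X: "X \<in> sign_vectors m" and Y: "Y \<in> sign_vectors m"
  shows "equivclp (reversal A) X Y \<longleftrightarrow> congr X Y"
proof
  note Xd = sign_vectors_dim[OF X]
  assume "equivclp (reversal A) X Y"
  then have "Y \<in> carrier_vec m \<and> congr X Y"
  proof (induction rule: equivclp_induct)
    case base then show ?case using Xd congr_refl by blast
  next
    case (step y z)
    then have "y \<in> carrier_vec m" "z \<in> carrier_vec m" "congr y z"
      using reversal_congr congr_sym sign_vectors_dim by metis+
    with step.IH show ?case using congr_trans[of X y z] Xd by blast
  qed
  then show "congr X Y" ..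
next
  assume "congr X Y"
  note Xd = sign_vectors_dim[OF X] and Yd = sign_vectors_dim[OF Y]
  obtain a b where ab: "a \<in> L" "b \<in> L'" "X - Y = 2 \<cdot>\<^sub>v (a + b)"
    using \<open>congr X Y\<close> by (auto simp: congr_def sum_lattice_def)
  note split = sign_difference_split[OF X Y ab]
  define Z where "Z = X - 2 \<cdot>\<^sub>v a"
  have Zd: "Z \<in> carrier_vec m" using Xd ab by (simp add: Z_def)
  have Zi: "Z $ i = X $ i - 2 * a $ i" if "i < m" for i using that Xd ab by (simp add: Z_def)
  have Z: "Z \<in> sign_vectors m"
    unfolding sign_vectors_def
  proof (intro CollectI conjI allI impI Zd)
    fix i assume i: "i < m"
    show "Z $ i \<in> {-1, 1}" unfolding Zi[OF i] using split[OF i] sign_vectorsD[OF X i] by auto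
  qed
  have "(reversal A)\<^sup>*\<^sup>* X (X - 2 \<cdot>\<^sub>v a)"
  proof (rule P.peel_circuits[OF conformal_circuit _ X ab(1)])
    show "reversal A X (X - 2 \<cdot>\<^sub>v C)" if "X \<in> sign_vectors m" "P.elementary C"
      "\<forall>i<m. C $ i \<in> {-1, 0, 1}" "conformal C X" for X C
      using reversal_step that by blast
    show "a $ i = 0 \<or> a $ i = X $ i" if "i < m" for i using split[OF that] by blast
  qed
  moreover have "(reversal A)\<^sup>*\<^sup>* Z (Z - 2 \<cdot>\<^sub>v b)"
  proof (rule D.peel_circuits[OF conformal_cocircuit _ Z ab(2)])
    show "reversal A X (X - 2 \<cdot>\<^sub>v C)" if "X \<in> sign_vectors m" "D.elementary C"
      "\<forall>i<m. C $ i \<in> {-1, 0, 1}" "conformal C X" for X C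
      using reversal_step that by blast
    show "b $ i = 0 \<or> b $ i = Z $ i" if i: "i < m" for i using split[OF i] Zi[OF i] by auto
  qed
  moreover have "Z - 2 \<cdot>\<^sub>v b = Y"
  proof (rule eq_vecI)
    fix i assume "i < dim_vec Y"
    then have i: "i < m" using Yd by simp
    have "X $ i - Y $ i = (X - Y) $ i" using i Xd Yd by simp
    also have "\<dots> = 2 * a $ i + 2 * b $ i" unfolding ab(3) using i ab by simp
    finally show "(Z - 2 \<cdot>\<^sub>v b) $ i = Y $ i" using i Xd ab by (simp add: Z_def)
  qed (use Yd ab in simp)
  ultimately have "(reversal A)\<^sup>*\<^sup>* X Y" unfolding Z_def by (metis rtranclp_trans)
  then show "equivclp (reversal A) X Y" by (rule rtranclp_into_equivclp)
qed

abbreviation \<G> where "\<G> \<equiv> reversal_classes A"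

lemma orient_class_eq: "X \<in> sign_vectors m \<Longrightarrow> orient_class A X = {Y \<in> sign_vectors m. congr X Y}"
  using equivclp_reversal_iff by (auto simp: orient_class_def reversal_equiv_def orientations_eq)

lemma classes_eq: "\<G> = orient_class A ` sign_vectors m"
  by (auto simp: reversal_classes_def quotient_def orient_class_def orientations_eq)

lemma orient_class_eqI:
  assumes X: "X \<in> sign_vectors m" and Y: "Y \<in> sign_vectors m" and XY: "congr X Y"
  shows "orient_class A X = orient_class A Y"
  unfolding orient_class_eq[OF X] orient_class_eq[OF Y]
  using congr_trans congr_sym XY X Y sign_vectors_dim by blast

lemma mem_class:
  assumes "c \<in> \<G>" "X \<in> c"
  shows "X \<in> sign_vectors m" "c = orient_class A X"
proof -
  obtain Z where Z: "Z \<in> sign_vectors m" "c = orient_class A Z" using assms(1) classes_eq by auto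
  then have *: "X \<in> sign_vectors m" "congr Z X" using assms(2) orient_class_eq[OF Z(1)] by auto
  then show "X \<in> sign_vectors m" "c = orient_class A X" using orient_class_eqI Z by blast+
qed

lemma class_nonempty: "c \<in> \<G> \<Longrightarrow> \<exists>X. X \<in> c"
  using classes_eq orient_class_eq congr_refl sign_vectors_dim by fastforce

lemma self_mem_class: "X \<in> sign_vectors m \<Longrightarrow> X \<in> orient_class A X"
  using orient_class_eq congr_refl sign_vectors_dim by blast

lemma orient_class_mem: "X \<in> sign_vectors m \<Longrightarrow> orient_class A X \<in> \<G>"
  using classes_eq by blast

text \<open>
  If \<open>X\<close> has the wrong sign at \<open>e\<close>, reverse a circuit or cocircuit through \<open>e\<close> that is compatible with \<open>X\<close>.
\<close>
lemma class_attains_sign: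
  assumes c: "c \<in> \<G>" and e: "e < m" and s: "s \<in> {1, -1}"
  shows "\<exists>X\<in>c. X $ e = s"
proof -
  obtain X where X: "X \<in> c" using class_nonempty[OF c] by blast
  note Xs = mem_class(1)[OF c X] and Xc = mem_class(2)[OF c X]
  note Xd = sign_vectors_dim[OF Xs]
  show ?thesis
  proof (cases "X $ e = s")
    case False
    then have Xe: "X $ e = - s" using sign_vectorsD[OF Xs e] s by auto
    have "\<forall>i<m. X $ i \<noteq> 0" using sign_vectorsD[OF Xs] by force
    from compatible_circuit_or_cocircuit[OF Xd this e] obtain C where
      C: "P.elementary C \<or> D.elementary C" "\<forall>i<m. C $ i \<in> {-1, 0, 1}" "C $ e \<noteq> 0" "conformal C X" by blast
    have Cd: "C \<in> carrier_vec m" using C(1) by (auto simp: P.elementary_def D.elementary_def)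
    have "reversal A X (X - 2 \<cdot>\<^sub>v C)" using reversal_step[OF Xs C(1,2,4)] .
    then have Y: "X - 2 \<cdot>\<^sub>v C \<in> c" using reversal_congr Xc orient_class_eq[OF Xs] by blast
    have "C $ e \<in> {-1, 0, 1}" using C(2) e by blast
    moreover have "0 < C $ e * X $ e" using C(3,4) Cd e by (auto simp: conformal_def)
    ultimately have "C $ e = X $ e" using sign_vectorsD[OF Xs e] by auto
    then have "(X - 2 \<cdot>\<^sub>v C) $ e = s" using Xd Cd e Xe by simp
    with Y show ?thesis by blast
  qed (use X in blast)
qed

lemma negate_single:
  assumes X: "X \<in> sign_vectors m" and e: "e < m"
  shows "negate_on {e} X \<in> sign_vectors m"
    and "negate_on {e} X = X - 2 \<cdot>\<^sub>v (X $ e \<cdot>\<^sub>v unit_vec m e)"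
proof -
  note Xd = sign_vectors_dim[OF X]
  have "negate_on {e} X $ i \<in> {-1, 1}" if "i < m" for i
    using sign_vectorsD[OF X that] Xd that by (auto simp: negate_on_def)
  then show "negate_on {e} X \<in> sign_vectors m" using Xd by (simp add: sign_vectors_def negate_on_def)
  show "negate_on {e} X = X - 2 \<cdot>\<^sub>v (X $ e \<cdot>\<^sub>v unit_vec m e)"
    using Xd e by (intro eq_vecI) (auto simp: negate_on_def unit_vec_def)
qed

lemma negate_well_defined:
  assumes c: "c \<in> \<G>" and e: "e < m" and XY: "X \<in> c" "Y \<in> c" "X $ e = Y $ e"
  shows "orient_class A (negate_on {e} X) = orient_class A (negate_on {e} Y)"
proof -
  have X: "X \<in> sign_vectors m" and Y: "Y \<in> sign_vectors m" using mem_class c XY by auto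
  have "congr X Y" using mem_class(2)[OF c XY(1)] XY(2) orient_class_eq[OF X] by auto
  then have "congr (negate_on {e} X) (negate_on {e} Y)"
    unfolding negate_single(2)[OF X e] negate_single(2)[OF Y e] XY(3)
    using congr_shift sign_vectors_dim[OF X] sign_vectors_dim[OF Y] by simp
  then show ?thesis using orient_class_eqI negate_single(1) X Y e by blast
qed

section \<open>The action on reversal classes\<close>

text \<open>
  The action \<open>x \<mapsto> x - 2 \<gamma>\<close> on odd vectors modulo \<open>2 (L + L')\<close>, expressed through orientations.
\<close>
definition act :: "int vec \<Rightarrow> int vec set \<Rightarrow> int vec set" where
  "act \<gamma> c = {Y \<in> sign_vectors m. \<exists>X\<in>c. congr (X - 2 \<cdot>\<^sub>v \<gamma>) Y}"

lemma act_eqI: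
  assumes X: "X \<in> sign_vectors m" and Y: "Y \<in> sign_vectors m" and g: "\<gamma> \<in> carrier_vec m"
    and XY: "congr (X - 2 \<cdot>\<^sub>v \<gamma>) Y"
  shows "act \<gamma> (orient_class A X) = orient_class A Y"
proof -
  note Xd = sign_vectors_dim[OF X] and Yd = sign_vectors_dim[OF Y]
  have gd: "2 \<cdot>\<^sub>v \<gamma> \<in> carrier_vec m" using g by simp
  have "(\<exists>X'\<in>orient_class A X. congr (X' - 2 \<cdot>\<^sub>v \<gamma>) Z) \<longleftrightarrow> congr Y Z" if Z: "Z \<in> sign_vectors m" for Z
  proof
    note Zd = sign_vectors_dim[OF Z]
    assume "\<exists>X'\<in>orient_class A X. congr (X' - 2 \<cdot>\<^sub>v \<gamma>) Z"
    then obtain X' where X': "X' \<in> sign_vectors m" "congr X X'" "congr (X' - 2 \<cdot>\<^sub>v \<gamma>) Z"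
      using orient_class_eq[OF X] by auto
    note X'd = sign_vectors_dim[OF X'(1)]
    have d: "X - 2 \<cdot>\<^sub>v \<gamma> \<in> carrier_vec m" "X' - 2 \<cdot>\<^sub>v \<gamma> \<in> carrier_vec m" using Xd X'd gd by auto
    have "congr Y (X - 2 \<cdot>\<^sub>v \<gamma>)" using congr_sym[OF XY d(1) Yd] .
    moreover have "congr (X - 2 \<cdot>\<^sub>v \<gamma>) (X' - 2 \<cdot>\<^sub>v \<gamma>)" using congr_shift[OF X'(2) Xd X'd gd] .
    ultimately show "congr Y Z" using X'(3) congr_trans d Yd Zd by blast
  next
    note Zd = sign_vectors_dim[OF Z]
    assume "congr Y Z"
    then have "congr (X - 2 \<cdot>\<^sub>v \<gamma>) Z" using congr_trans[OF XY] Xd gd Yd Zd by simp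
    then show "\<exists>X'\<in>orient_class A X. congr (X' - 2 \<cdot>\<^sub>v \<gamma>) Z" using self_mem_class[OF X] by blast
  qed
  then show ?thesis unfolding act_def orient_class_eq[OF Y] by blast
qed

lemma shift_to_signs:
  assumes X: "X \<in> sign_vectors m" and g: "\<gamma> \<in> carrier_vec m"
  obtains Y where "Y \<in> sign_vectors m" "congr (X - 2 \<cdot>\<^sub>v \<gamma>) Y"
proof -
  note Xd = sign_vectors_dim[OF X]
  have d: "X - 2 \<cdot>\<^sub>v \<gamma> \<in> carrier_vec m" using g Xd by simp
  have "odd ((X - 2 \<cdot>\<^sub>v \<gamma>) $ i)" if "i < m" for i
    using sign_vectorsD[OF X that] Xd g that by auto
  from reduce_to_signs[OF d this] obtain Y h where
    Y: "Y \<in> sign_vectors m" "h \<in> sum_lattice" "Y = X - 2 \<cdot>\<^sub>v \<gamma> - 2 \<cdot>\<^sub>v h" by blast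
  have "congr (X - 2 \<cdot>\<^sub>v \<gamma>) Y"
  proof (rule congrI[OF d sign_vectors_dim[OF Y(1)] Y(2)])
    fix i assume "i < m"
    then show "(X - 2 \<cdot>\<^sub>v \<gamma>) $ i - Y $ i = 2 * h $ i" using Xd g sum_lattice_dim[OF Y(2)] by (simp add: Y(3))
  qed
  with Y(1) that show thesis by blast
qed

lemma act_mem: "c \<in> \<G> \<Longrightarrow> \<gamma> \<in> carrier_vec m \<Longrightarrow> act \<gamma> c \<in> \<G>"
  using class_nonempty mem_class shift_to_signs act_eqI orient_class_mem by metis

lemma act_zero: "c \<in> \<G> \<Longrightarrow> act (0\<^sub>v m) c = c"
proof -
  assume c: "c \<in> \<G>"
  then obtain X where X: "X \<in> sign_vectors m" "c = orient_class A X" using classes_eq by auto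
  note Xd = sign_vectors_dim[OF X(1)]
  have "X - 2 \<cdot>\<^sub>v 0\<^sub>v m = X" using Xd by (intro eq_vecI) auto
  then show ?thesis using act_eqI[OF X(1) X(1), of "0\<^sub>v m"] congr_refl[OF Xd] X(2) by simp
qed

lemma act_add:
  assumes c: "c \<in> \<G>" and g: "\<gamma> \<in> carrier_vec m" and h: "\<delta> \<in> carrier_vec m"
  shows "act (\<gamma> + \<delta>) c = act \<gamma> (act \<delta> c)"
proof -
  obtain X where X: "X \<in> sign_vectors m" "c = orient_class A X" using c classes_eq by auto
  obtain Y where Y: "Y \<in> sign_vectors m" "congr (X - 2 \<cdot>\<^sub>v \<delta>) Y" using shift_to_signs[OF X(1) h] .
  obtain Z where Z: "Z \<in> sign_vectors m" "congr (Y - 2 \<cdot>\<^sub>v \<gamma>) Z" using shift_to_signs[OF Y(1) g] .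
  note d = sign_vectors_dim[OF X(1)] sign_vectors_dim[OF Y(1)] sign_vectors_dim[OF Z(1)]
  have "congr (X - 2 \<cdot>\<^sub>v \<delta> - 2 \<cdot>\<^sub>v \<gamma>) (Y - 2 \<cdot>\<^sub>v \<gamma>)" using congr_shift[OF Y(2)] d g h by simp
  then have "congr (X - 2 \<cdot>\<^sub>v \<delta> - 2 \<cdot>\<^sub>v \<gamma>) Z" using congr_trans[OF _ Z(2)] d g h by simp
  moreover have "X - 2 \<cdot>\<^sub>v \<delta> - 2 \<cdot>\<^sub>v \<gamma> = X - 2 \<cdot>\<^sub>v (\<gamma> + \<delta>)" using d g h by (intro eq_vecI) auto
  ultimately have "act (\<gamma> + \<delta>) c = orient_class A Z" using act_eqI[OF X(1) Z(1)] g h X(2) by simp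
  moreover have "act \<delta> c = orient_class A Y" using act_eqI[OF X(1) Y(1) h Y(2)] X(2) by simp
  moreover have "act \<gamma> (orient_class A Y) = orient_class A Z" using act_eqI[OF Y(1) Z(1) g Z(2)] .
  ultimately show ?thesis by simp
qed

lemma act_unit:
  assumes c: "c \<in> \<G>" and e: "e < m" and X: "X \<in> c"
  shows "act (X $ e \<cdot>\<^sub>v unit_vec m e) c = orient_class A (negate_on {e} X)"
proof -
  have Xs: "X \<in> sign_vectors m" "c = orient_class A X" using mem_class c X by auto
  note N = negate_single[OF Xs(1) e]
  have "congr (X - 2 \<cdot>\<^sub>v (X $ e \<cdot>\<^sub>v unit_vec m e)) (negate_on {e} X)"
    using congr_refl[OF sign_vectors_dim[OF N(1)]] N(2) by simp
  then show ?thesis using act_eqI[OF Xs(1) N(1)] Xs(2) by simp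
qed

lemma act_eq_orient_class_iff:
  assumes X: "X \<in> sign_vectors m" and Y: "Y \<in> sign_vectors m" and g: "\<gamma> \<in> carrier_vec m"
  shows "act \<gamma> (orient_class A X) = orient_class A Y \<longleftrightarrow> congr (X - 2 \<cdot>\<^sub>v \<gamma>) Y"
proof
  assume *: "act \<gamma> (orient_class A X) = orient_class A Y"
  obtain Z where Z: "Z \<in> sign_vectors m" "congr (X - 2 \<cdot>\<^sub>v \<gamma>) Z" using shift_to_signs[OF X g] .
  then have "orient_class A Z = orient_class A Y" using act_eqI[OF X Z(1) g] * by simp
  then have "congr Z Y" using self_mem_class[OF Y] orient_class_eq[OF Z(1)] by auto
  then show "congr (X - 2 \<cdot>\<^sub>v \<gamma>) Y"
    using congr_trans[OF Z(2)] sign_vectors_dim X Y Z(1) g by simp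
qed (rule act_eqI[OF X Y g])

text \<open>
  Two sign vectors differ by an even vector.
\<close>
lemma act_transitive:
  assumes "c \<in> \<G>" "c' \<in> \<G>"
  obtains \<gamma> where "\<gamma> \<in> carrier_vec m" "act \<gamma> c = c'"
proof -
  obtain X Y where X: "X \<in> sign_vectors m" "c = orient_class A X"
    and Y: "Y \<in> sign_vectors m" "c' = orient_class A Y" using assms classes_eq by auto
  note d = sign_vectors_dim[OF X(1)] sign_vectors_dim[OF Y(1)]
  define \<gamma> where "\<gamma> = vec m (\<lambda>i. (X $ i - Y $ i) div 2)"
  have g: "\<gamma> \<in> carrier_vec m" by (simp add: \<gamma>_def)
  have "X - 2 \<cdot>\<^sub>v \<gamma> = Y"
  proof (rule eq_vecI)
    fix i assume "i < dim_vec Y"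
    then have i: "i < m" using d by simp
    have "2 * ((X $ i - Y $ i) div 2) = X $ i - Y $ i"
      using sign_vectorsD[OF X(1) i] sign_vectorsD[OF Y(1) i] by auto
    then show "(X - 2 \<cdot>\<^sub>v \<gamma>) $ i = Y $ i" using i d by (simp add: \<gamma>_def)
  qed (use d in \<open>simp add: \<gamma>_def\<close>)
  then have "act \<gamma> c = c'" using act_eqI[OF X(1) Y(1) g] congr_refl[OF d(2)] X Y by simp
  with g that show thesis by blast
qed

lemma act_eq_iff:
  assumes c: "c \<in> \<G>" and g: "\<gamma> \<in> carrier_vec m" and h: "\<delta> \<in> carrier_vec m"
  shows "act \<gamma> c = act \<delta> c \<longleftrightarrow> \<gamma> - \<delta> \<in> sum_lattice"
proof -
  obtain X where X: "X \<in> sign_vectors m" "c = orient_class A X" using c classes_eq by auto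
  obtain Y where Y: "Y \<in> sign_vectors m" "congr (X - 2 \<cdot>\<^sub>v \<delta>) Y" using shift_to_signs[OF X(1) h] .
  note d = sign_vectors_dim[OF X(1)] sign_vectors_dim[OF Y(1)]
  have d': "X - 2 \<cdot>\<^sub>v \<delta> \<in> carrier_vec m" "X - 2 \<cdot>\<^sub>v \<gamma> \<in> carrier_vec m" using d g h by auto
  have "act \<gamma> c = act \<delta> c \<longleftrightarrow> congr (X - 2 \<cdot>\<^sub>v \<gamma>) Y"
    using act_eq_orient_class_iff[OF X(1) Y(1) g] act_eqI[OF X(1) Y(1) h Y(2)] X(2) by simp
  also have "\<dots> \<longleftrightarrow> congr (X - 2 \<cdot>\<^sub>v \<delta>) (X - 2 \<cdot>\<^sub>v \<gamma>)"
    using congr_trans congr_sym Y(2) d d' by blast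
  also have "\<dots> \<longleftrightarrow> \<gamma> - \<delta> \<in> sum_lattice"
  proof
    assume "congr (X - 2 \<cdot>\<^sub>v \<delta>) (X - 2 \<cdot>\<^sub>v \<gamma>)"
    then obtain k where k: "k \<in> sum_lattice" "\<And>i. i < m \<Longrightarrow> (X - 2 \<cdot>\<^sub>v \<delta>) $ i - (X - 2 \<cdot>\<^sub>v \<gamma>) $ i = 2 * k $ i"
      using congrD[OF _ d'] by blast
    have "\<gamma> - \<delta> = k"
    proof (rule eq_vecI)
      fix i assume "i < dim_vec k"
      then have "i < m" using sum_lattice_dim[OF k(1)] by simp
      then show "(\<gamma> - \<delta>) $ i = k $ i" using k(2)[of i] d g h by simp
    qed (use h sum_lattice_dim[OF k(1)] in simp)
    then show "\<gamma> - \<delta> \<in> sum_lattice" using k(1) by simp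
  next
    assume "\<gamma> - \<delta> \<in> sum_lattice"
    then show "congr (X - 2 \<cdot>\<^sub>v \<delta>) (X - 2 \<cdot>\<^sub>v \<gamma>)"
    proof (rule congrI[OF d'])
      fix i assume "i < m"
      then show "(X - 2 \<cdot>\<^sub>v \<delta>) $ i - (X - 2 \<cdot>\<^sub>v \<gamma>) $ i = 2 * (\<gamma> - \<delta>) $ i" using d g h by simp
    qed
  qed
  finally show ?thesis .
qed

end

lemma inv_monoid_vec:
  fixes x :: "'a :: ab_group_add vec"
  assumes "x \<in> carrier_vec m"
  shows "inv\<^bsub>monoid_vec TYPE('a) m\<^esub> x = - x"
proof -
  interpret comm_group "monoid_vec TYPE('a) m" by (rule comm_group_vec)
  show ?thesis
    by (rule inv_equality) (use assms in \<open>auto simp: monoid_vec_simps\<close>)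
qed

lemma subgroup_monoid_vecI:
  fixes S :: "'a :: ab_group_add vec set"
  assumes "S \<subseteq> carrier_vec m" "0\<^sub>v m \<in> S" "\<And>x y. x \<in> S \<Longrightarrow> y \<in> S \<Longrightarrow> x + y \<in> S" "\<And>x. x \<in> S \<Longrightarrow> - x \<in> S"
  shows "subgroup S (monoid_vec TYPE('a) m)"
proof (rule subgroup.intro)
  show "inv\<^bsub>monoid_vec TYPE('a) m\<^esub> x \<in> S" if "x \<in> S" for x
    using assms(1,4) that inv_monoid_vec[of x m] by auto
qed (use assms in \<open>auto simp: monoid_vec_simps\<close>)

text \<open>
  Every integral vector is reached from \<open>0\<close> by adding vectors \<open>s u\<^sub>e\<close>, so an action of \<open>\<int>\<^sup>E\<close> is determined by
  the sign reversal rule.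
\<close>
lemma int_vec_induct [consumes 1, case_names zero step]:
  fixes v :: "int vec"
  assumes "v \<in> carrier_vec m"
    and zero: "P (0\<^sub>v m)"
    and step: "\<And>v e s. v \<in> carrier_vec m \<Longrightarrow> e < m \<Longrightarrow> s \<in> {1, -1} \<Longrightarrow> P v \<Longrightarrow> P (s \<cdot>\<^sub>v unit_vec m e + v)"
  shows "P v"
  using assms(1)
proof (induction "\<Sum>i<m. nat \<bar>v $ i\<bar>" arbitrary: v rule: less_induct)
  case less
  show ?case
  proof (cases "v = 0\<^sub>v m")
    case False
    then obtain e where e: "e < m" "v $ e \<noteq> 0"
      using supp_empty[OF less.prems] mem_supp[OF less.prems] by blast
    define s where "s = sgn (v $ e)"
    have s: "s \<in> {1, -1}" using e by (auto simp: s_def sgn_if)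
    define w where "w = v - s \<cdot>\<^sub>v unit_vec m e"
    have wd: "w \<in> carrier_vec m" using less.prems by (simp add: w_def)
    have wi: "w $ i = (if i = e then v $ i - s else v $ i)" if "i < m" for i
      using that e less.prems by (simp add: w_def)
    have "(\<Sum>i<m. nat \<bar>w $ i\<bar>) < (\<Sum>i<m. nat \<bar>v $ i\<bar>)"
    proof (rule sum_strict_mono_ex1)
      show "\<forall>i\<in>{..<m}. nat \<bar>w $ i\<bar> \<le> nat \<bar>v $ i\<bar>"
        using e(2) by (auto simp: wi s_def sgn_if)
      have "nat \<bar>w $ e\<bar> < nat \<bar>v $ e\<bar>" using e by (auto simp: wi s_def sgn_if)
      then show "\<exists>i\<in>{..<m}. nat \<bar>w $ i\<bar> < nat \<bar>v $ i\<bar>" using e(1) by blast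
    qed simp
    then have "P w" using less.hyps wd by blast
    then have "P (s \<cdot>\<^sub>v unit_vec m e + w)" using step[OF wd e(1) s] by blast
    moreover have "s \<cdot>\<^sub>v unit_vec m e + w = v" using less.prems by (intro eq_vecI) (auto simp: w_def)
    ultimately show ?thesis by simp
  qed (use zero in simp)
qed

text \<open>
  Used to carry the action of \<open>\<int>\<^sup>E / (L + L')\<close> over to the Jacobian group along the canonical isomorphism.
\<close>
lemma torsor_transport:
  assumes G: "group G" and H: "group H" and \<psi>: "\<psi> \<in> iso G H" and t: "torsor G X \<alpha>"
  shows "torsor H X (\<alpha> \<circ> inv_into (carrier G) \<psi>)"
    and "\<And>g. g \<in> carrier G \<Longrightarrow> (\<alpha> \<circ> inv_into (carrier G) \<psi>) (\<psi> g) = \<alpha> g"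
proof -
  interpret G: group G by (rule G)
  interpret a: group_action G X \<alpha> using t by (simp add: torsor_def)
  let ?i = "inv_into (carrier G) \<psi>"
  have i: "?i \<in> iso H G" using G.iso_set_sym[OF \<psi>] .
  have bij: "bij_betw \<psi> (carrier G) (carrier H)" using \<psi> by (simp add: iso_def)
  have inj: "inj_on \<psi> (carrier G)" using bij by (simp add: bij_betw_def)
  show inv: "(\<alpha> \<circ> ?i) (\<psi> g) = \<alpha> g" if "g \<in> carrier G" for g
    using inv_into_f_f[OF inj that] by simp
  have "\<alpha> \<in> hom G (BijGroup X)" using a.group_hom group_hom.homh by blast
  then have "\<alpha> \<circ> ?i \<in> hom H (BijGroup X)" using i by (auto intro: Group.hom_compose simp: iso_def)
  then have act: "group_action H X (\<alpha> \<circ> ?i)"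
    using H by (simp add: group_action_def group_hom_def group_hom_axioms_def group_BijGroup)
  show "torsor H X (\<alpha> \<circ> ?i)"
    unfolding torsor_def
  proof (intro conjI ballI act)
    show "X \<noteq> {}" using t by (simp add: torsor_def)
    fix x y assume "x \<in> X" "y \<in> X"
    then obtain g where g: "g \<in> carrier G" "\<alpha> g x = y"
      and uniq: "\<And>g'. g' \<in> carrier G \<Longrightarrow> \<alpha> g' x = y \<Longrightarrow> g' = g"
      using t unfolding torsor_def by metis
    show "\<exists>!h. h \<in> carrier H \<and> (\<alpha> \<circ> ?i) h x = y"
    proof (rule ex1I[of _ "\<psi> g"])
      show "\<psi> g \<in> carrier H \<and> (\<alpha> \<circ> ?i) (\<psi> g) x = y"
        using inv[OF g(1)] g bij by (auto simp: bij_betw_def)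
    next
      fix h assume h: "h \<in> carrier H \<and> (\<alpha> \<circ> ?i) h x = y"
      then have "h \<in> \<psi> ` carrier G" using bij by (simp add: bij_betw_def)
      then have "?i h \<in> carrier G" "\<psi> (?i h) = h" by (rule inv_into_into, rule f_inv_into_f)
      then show "h = \<psi> g" using uniq[of "?i h"] h by auto
    qed
  qed
qed

context unimodular_representation
begin

abbreviation Z where "Z \<equiv> monoid_vec TYPE(int) m"

lemma Z_comm_group: "comm_group Z"
  by (rule comm_group_vec)

lemma sum_lattice_normal: "sum_lattice \<lhd> Z"
proof (rule comm_group.subgroup_imp_normal[OF Z_comm_group])
  show "subgroup sum_lattice Z"
    by (rule subgroup_monoid_vecI) (use sum_lattice_carrier sum_lattice_zero sum_lattice_add sum_lattice_uminus in auto)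
qed

lemma quotient_class_eq: "quotient_class A \<gamma> = sum_lattice #>\<^bsub>Z\<^esub> \<gamma>"
  using A by (simp add: quotient_class_def lattice_sum_eq)

lemma lattice_quotient_eq: "lattice_quotient A = Z Mod sum_lattice"
  using A by (simp add: lattice_quotient_def lattice_sum_eq)

lemma mem_coset: "\<gamma> \<in> carrier_vec m \<Longrightarrow> \<delta> \<in> sum_lattice #>\<^bsub>Z\<^esub> \<gamma> \<longleftrightarrow> \<delta> \<in> carrier_vec m \<and> \<delta> - \<gamma> \<in> sum_lattice"
proof -
  assume g: "\<gamma> \<in> carrier_vec m"
  have "\<delta> \<in> sum_lattice #>\<^bsub>Z\<^esub> \<gamma> \<longleftrightarrow> (\<exists>g\<in>sum_lattice. \<delta> = g + \<gamma>)" by (auto simp: r_coset_def monoid_vec_simps)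
  also have "\<dots> \<longleftrightarrow> \<delta> \<in> carrier_vec m \<and> \<delta> - \<gamma> \<in> sum_lattice"
  proof
    assume "\<exists>g\<in>sum_lattice. \<delta> = g + \<gamma>"
    then obtain h where h: "h \<in> sum_lattice" "\<delta> = h + \<gamma>" by blast
    then have "\<delta> - \<gamma> = h" using g sum_lattice_dim[OF h(1)] by (intro eq_vecI) auto
    then show "\<delta> \<in> carrier_vec m \<and> \<delta> - \<gamma> \<in> sum_lattice" using h g sum_lattice_dim[OF h(1)] by simp
  next
    assume *: "\<delta> \<in> carrier_vec m \<and> \<delta> - \<gamma> \<in> sum_lattice"
    then have "\<delta> = (\<delta> - \<gamma>) + \<gamma>" using g by (intro eq_vecI) auto
    then show "\<exists>g\<in>sum_lattice. \<delta> = g + \<gamma>" using * by blast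
  qed
  finally show ?thesis .
qed

lemma coset_eqD: "\<gamma> \<in> carrier_vec m \<Longrightarrow> \<delta> \<in> carrier_vec m \<Longrightarrow> sum_lattice #>\<^bsub>Z\<^esub> \<gamma> = sum_lattice #>\<^bsub>Z\<^esub> \<delta> \<Longrightarrow> \<gamma> - \<delta> \<in> sum_lattice"
proof -
  assume g: "\<gamma> \<in> carrier_vec m" and d: "\<delta> \<in> carrier_vec m" and eq: "sum_lattice #>\<^bsub>Z\<^esub> \<gamma> = sum_lattice #>\<^bsub>Z\<^esub> \<delta>"
  have "\<gamma> - \<gamma> = 0\<^sub>v m" using g by (intro eq_vecI) auto
  then have "\<gamma> \<in> sum_lattice #>\<^bsub>Z\<^esub> \<gamma>" using mem_coset[OF g] g sum_lattice_zero by simp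
  then show "\<gamma> - \<delta> \<in> sum_lattice" using eq mem_coset[OF d] by blast
qed

lemma coset_eqI:
  assumes g: "\<gamma> \<in> carrier_vec m" and d: "\<delta> \<in> carrier_vec m" and gd: "\<gamma> - \<delta> \<in> sum_lattice"
  shows "sum_lattice #>\<^bsub>Z\<^esub> \<gamma> = sum_lattice #>\<^bsub>Z\<^esub> \<delta>"
proof -
  have "x - \<gamma> \<in> sum_lattice \<longleftrightarrow> x - \<delta> \<in> sum_lattice" if x: "x \<in> carrier_vec m" for x
  proof
    assume "x - \<gamma> \<in> sum_lattice"
    moreover have "x - \<delta> = (x - \<gamma>) + (\<gamma> - \<delta>)" using g d x by (intro eq_vecI) auto
    ultimately show "x - \<delta> \<in> sum_lattice" using sum_lattice_add gd by metis
  next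
    assume "x - \<delta> \<in> sum_lattice"
    moreover have "x - \<gamma> = (x - \<delta>) - (\<gamma> - \<delta>)" using g d x by (intro eq_vecI) auto
    ultimately show "x - \<gamma> \<in> sum_lattice" using sum_lattice_diff gd by metis
  qed
  then show ?thesis using mem_coset g d by blast
qed

lemma act_bij: "\<gamma> \<in> carrier_vec m \<Longrightarrow> restrict (act \<gamma>) \<G> \<in> Bij \<G>"
proof -
  assume g: "\<gamma> \<in> carrier_vec m"
  then have ng: "- \<gamma> \<in> carrier_vec m" by simp
  have inv: "act (- \<gamma>) (act \<gamma> c) = c" "act \<gamma> (act (- \<gamma>) c) = c" if c: "c \<in> \<G>" for c
  proof -
    have "- \<gamma> + \<gamma> = 0\<^sub>v m" "\<gamma> + - \<gamma> = 0\<^sub>v m" using g by (auto intro!: eq_vecI)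
    then show "act (- \<gamma>) (act \<gamma> c) = c" "act \<gamma> (act (- \<gamma>) c) = c"
      using act_add[OF c ng g] act_add[OF c g ng] act_zero[OF c] by simp_all
  qed
  have "bij_betw (act \<gamma>) \<G> \<G>"
    using inv act_mem g ng by (intro bij_betw_byWitness[where f' = "act (- \<gamma>)"]) auto
  then show ?thesis by (simp add: Bij_def)
qed

definition rule_map :: "int vec \<Rightarrow> int vec set \<Rightarrow> int vec set" where
  "rule_map = restrict (\<lambda>\<gamma>. restrict (act \<gamma>) \<G>) (carrier_vec m)"

lemma rule_map_action: "group_action Z \<G> rule_map"
proof -
  have "rule_map \<in> hom Z (BijGroup \<G>)"
  proof (rule homI)
    show "rule_map \<gamma> \<in> carrier (BijGroup \<G>)" if "\<gamma> \<in> carrier Z" for \<gamma>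
      using act_bij that by (simp add: rule_map_def BijGroup_def monoid_vec_simps)
    fix \<gamma> \<delta> assume "\<gamma> \<in> carrier Z" "\<delta> \<in> carrier Z"
    then have gd: "\<gamma> \<in> carrier_vec m" "\<delta> \<in> carrier_vec m" by (auto simp: monoid_vec_simps)
    have "restrict (act (\<gamma> + \<delta>)) \<G> = compose \<G> (restrict (act \<gamma>) \<G>) (restrict (act \<delta>) \<G>)"
      using act_add[OF _ gd] act_mem[OF _ gd(2)] by (auto simp: compose_def fun_eq_iff)
    then show "rule_map (\<gamma> \<otimes>\<^bsub>Z\<^esub> \<delta>) = rule_map \<gamma> \<otimes>\<^bsub>BijGroup \<G>\<^esub> rule_map \<delta>"
      using gd act_bij by (simp add: rule_map_def BijGroup_def monoid_vec_simps)
  qed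
  then show ?thesis
    using comm_group.axioms(2)[OF Z_comm_group] group_BijGroup
    by (simp add: group_action_def group_hom_def group_hom_axioms_def)
qed

lemma rule_action_rule_map: "rule_action A rule_map"
proof -
  have m: "dim_col A = m" using A by simp
  have "rule_map (s \<cdot>\<^sub>v unit_vec m e) c = orient_class A (negate_on {e} X)"
    if "e < m" "c \<in> \<G>" "X \<in> c" "X $ e = s" for e s c X
    using act_unit[OF that(2,1,3)] that by (simp add: rule_map_def)
  then show ?thesis
    using rule_map_action unfolding rule_action_def m by (auto simp: rule_map_def)
qed

text \<open>
  The rule determines \<open>\<phi> (s u\<^sub>e) c\<close> for every class \<open>c\<close>, because every class contains an orientation with
  sign \<open>s\<close> at \<open>e\<close>.
\<close>
lemma rule_action_eq_act:
  assumes \<phi>: "rule_action A \<phi>" and g: "\<gamma> \<in> carrier_vec m"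
  shows "c \<in> \<G> \<Longrightarrow> \<phi> \<gamma> c = act \<gamma> c"
  using g
proof (induction \<gamma> arbitrary: c rule: int_vec_induct)
  have m: "dim_col A = m" using A by simp
  interpret group_action Z \<G> \<phi> using \<phi> by (simp add: rule_action_def m)
  {
    case zero
    then show ?case using id_eq_one act_zero by (metis monoid_vec_simps(3) restrict_apply')
  next
    case (step v e s)
    have ud: "s \<cdot>\<^sub>v unit_vec m e \<in> carrier_vec m" by simp
    have vc: "act v c \<in> \<G>" using act_mem step by blast
    obtain X where X: "X \<in> act v c" "X $ e = s" using class_attains_sign[OF vc step(2,3)] by blast
    have "\<phi> (s \<cdot>\<^sub>v unit_vec m e) (act v c) = orient_class A (negate_on {e} X)"
      using \<phi> X vc step(2,3) unfolding rule_action_def m by blast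
    also have "\<dots> = act (s \<cdot>\<^sub>v unit_vec m e) (act v c)" using act_unit[OF vc step(2) X(1)] X(2) by simp
    finally have "\<phi> (s \<cdot>\<^sub>v unit_vec m e) (\<phi> v c) = act (s \<cdot>\<^sub>v unit_vec m e) (act v c)"
      using step by simp
    moreover have "\<phi> (s \<cdot>\<^sub>v unit_vec m e + v) c = \<phi> (s \<cdot>\<^sub>v unit_vec m e) (\<phi> v c)"
      using composition_rule[OF step(5), of "s \<cdot>\<^sub>v unit_vec m e" v] step(1) by (simp add: monoid_vec_simps)
    ultimately show ?case using act_add[OF step(5) ud step(1)] by simp
  }
qed

lemma rule_action_unique:
  assumes \<phi>: "rule_action A \<phi>"
  shows "\<phi> = rule_map"
proof
  have m: "dim_col A = m" using A by simp
  interpret group_action Z \<G> \<phi> using \<phi> by (simp add: rule_action_def m)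
  fix \<gamma>
  show "\<phi> \<gamma> = rule_map \<gamma>"
  proof (cases "\<gamma> \<in> carrier_vec m")
    case True
    then have "\<phi> \<gamma> \<in> extensional \<G>" using Bij_imp_extensional[OF bij_prop0] by (simp add: monoid_vec_simps)
    then show ?thesis using rule_action_eq_act[OF \<phi> True] True
      by (auto simp: rule_map_def extensional_def fun_eq_iff)
  next
    case False
    then show ?thesis using \<phi> by (auto simp: rule_action_def m rule_map_def extensional_def)
  qed
qed

lemma classes_nonempty: "\<G> \<noteq> {}"
proof -
  have "vec m (\<lambda>_. 1) \<in> sign_vectors m" by (simp add: sign_vectors_def)
  then show ?thesis using classes_eq by blast
qed

text \<open>
  The action descends to the quotient and is simply transitive there because \<open>act \<gamma> c = act \<delta> c\<close> holds
  exactly if \<open>\<gamma> - \<delta> \<in> L + L'\<close>.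
\<close>
lemma lattice_quotient_torsor:
  obtains \<alpha> where "torsor (lattice_quotient A) \<G> \<alpha>"
    "\<And>\<gamma>. \<gamma> \<in> carrier_vec m \<Longrightarrow> \<alpha> (quotient_class A \<gamma>) = rule_map \<gamma>"
proof -
  have hom: "rule_map \<in> hom Z (BijGroup \<G>)" using rule_map_action by (simp add: group_action_def group_hom.homh)
  have "rule_map \<gamma> = rule_map \<delta>" if "\<gamma> \<in> carrier Z" "\<delta> \<in> carrier Z" "sum_lattice #>\<^bsub>Z\<^esub> \<gamma> = sum_lattice #>\<^bsub>Z\<^esub> \<delta>" for \<gamma> \<delta>
  proof -
    have gd: "\<gamma> \<in> carrier_vec m" "\<delta> \<in> carrier_vec m" using that by (auto simp: monoid_vec_simps)
    then have "\<gamma> - \<delta> \<in> sum_lattice" using coset_eqD that(3) by blast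
    then have "act \<gamma> c = act \<delta> c" if "c \<in> \<G>" for c using act_eq_iff[OF that gd] by blast
    then show ?thesis using gd by (auto simp: rule_map_def fun_eq_iff)
  qed
  from FactGroup_universal[OF hom sum_lattice_normal this] obtain \<alpha> where
    \<alpha>: "\<alpha> \<in> hom (Z Mod sum_lattice) (BijGroup \<G>)" "\<And>\<gamma>. \<gamma> \<in> carrier Z \<Longrightarrow> \<alpha> (sum_lattice #>\<^bsub>Z\<^esub> \<gamma>) = rule_map \<gamma>"
    by blast
  have \<alpha>q: "\<alpha> (quotient_class A \<gamma>) = rule_map \<gamma>" if "\<gamma> \<in> carrier_vec m" for \<gamma>
    using \<alpha>(2)[of \<gamma>] that by (simp add: quotient_class_eq monoid_vec_simps)
  have "group_action (Z Mod sum_lattice) \<G> \<alpha>"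
    using normal.factorgroup_is_group[OF sum_lattice_normal] group_BijGroup \<alpha>(1)
    by (simp add: group_action_def group_hom_def group_hom_axioms_def)
  moreover have "\<exists>!g. g \<in> carrier (Z Mod sum_lattice) \<and> \<alpha> g c = c'" if c: "c \<in> \<G>" "c' \<in> \<G>" for c c'
  proof -
    obtain \<gamma> where g: "\<gamma> \<in> carrier_vec m" "act \<gamma> c = c'" using act_transitive[OF c] by blast
    show ?thesis
    proof (rule ex1I[of _ "sum_lattice #>\<^bsub>Z\<^esub> \<gamma>"])
      show "sum_lattice #>\<^bsub>Z\<^esub> \<gamma> \<in> carrier (Z Mod sum_lattice) \<and> \<alpha> (sum_lattice #>\<^bsub>Z\<^esub> \<gamma>) c = c'"
        using \<alpha>(2)[of \<gamma>] g c by (auto simp: carrier_FactGroup monoid_vec_simps rule_map_def)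
      fix k assume k: "k \<in> carrier (Z Mod sum_lattice) \<and> \<alpha> k c = c'"
      then obtain \<delta> where d: "\<delta> \<in> carrier_vec m" "k = sum_lattice #>\<^bsub>Z\<^esub> \<delta>"
        by (auto simp: carrier_FactGroup monoid_vec_simps)
      then have "act \<delta> c = c'" using \<alpha>(2)[of \<delta>] k c by (auto simp: monoid_vec_simps rule_map_def)
      then have "\<delta> - \<gamma> \<in> sum_lattice" using act_eq_iff[OF c(1) d(1) g(1)] g(2) by simp
      then show "k = sum_lattice #>\<^bsub>Z\<^esub> \<gamma>" using coset_eqI[OF d(1) g(1)] d(2) by simp
    qed
  qed
  ultimately have "torsor (lattice_quotient A) \<G> \<alpha>"
    using classes_nonempty by (simp add: torsor_def lattice_quotient_eq)
  with \<alpha>q that show thesis by blast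
qed

end

section \<open>The canonical isomorphism with the Jacobian group\<close>

lemma int_self_orthogonal:
  fixes a :: "int vec"
  assumes "a \<in> carrier_vec m" "a \<bullet> a = 0"
  shows "a = 0\<^sub>v m"
proof -
  have "(\<Sum>i<m. a $ i * a $ i) = 0" using assms by (simp add: scalar_prod_def atLeast0LessThan)
  then have "\<forall>i\<in>{..<m}. a $ i * a $ i = 0" by (subst (asm) sum_nonneg_eq_0_iff) auto
  then show ?thesis using assms(1) by (intro eq_vecI) auto
qed

lemma rat_vec_scalar_prod:
  "a \<in> carrier_vec m \<Longrightarrow> b \<in> carrier_vec m \<Longrightarrow> rat_vec a \<bullet> rat_vec b = of_int (a \<bullet> b)"
  by (simp add: scalar_prod_def)

lemma (in saturated_lattice) rational_span:
  "x \<in> LinearCombinations.module.span class_ring (module_vec TYPE(rat) m) (rat_vec ` L)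
    \<longleftrightarrow> x \<in> carrier_vec m \<and> (\<exists>k>0. \<exists>a\<in>L. of_int k \<cdot>\<^sub>v x = rat_vec a)" (is "_ \<longleftrightarrow> x \<in> carrier_vec m \<and> ?Q x")
proof -
  interpret vec_space "TYPE(rat)" m .
  have LV: "rat_vec ` L \<subseteq> carrier_vec m" using carrier by auto
  define W where "W = {x \<in> carrier_vec m. ?Q x}"
  have sub: "submodule class_ring W V"
  proof (rule submodule.intro)
    show "Module.module class_ring V" by (rule vec_module)
    show "W \<subseteq> carrier V" by (auto simp: W_def)
    have "of_int 1 \<cdot>\<^sub>v 0\<^sub>v m = rat_vec (0\<^sub>v m)" by (intro eq_vecI) auto
    moreover have "(0::int) < 1" by simp
    ultimately have "?Q (0\<^sub>v m)" using zero by blast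
    then show "\<zero>\<^bsub>V\<^esub> \<in> W" by (simp add: W_def module_vec_simps)
    show "v \<oplus>\<^bsub>V\<^esub> w \<in> W" if "v \<in> W" "w \<in> W" for v w
    proof -
      obtain k a where k: "k > 0" "a \<in> L" "of_int k \<cdot>\<^sub>v v = rat_vec a" using \<open>v \<in> W\<close> by (auto simp: W_def)
      obtain l b where l: "l > 0" "b \<in> L" "of_int l \<cdot>\<^sub>v w = rat_vec b" using \<open>w \<in> W\<close> by (auto simp: W_def)
      have vw: "v \<in> carrier_vec m" "w \<in> carrier_vec m" using that by (auto simp: W_def)
      have "of_int (k * l) \<cdot>\<^sub>v (v + w) = of_int l \<cdot>\<^sub>v (of_int k \<cdot>\<^sub>v v) + of_int k \<cdot>\<^sub>v (of_int l \<cdot>\<^sub>v w)"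
        using vw by (intro eq_vecI) (auto simp: algebra_simps)
      also have "\<dots> = rat_vec (l \<cdot>\<^sub>v a + k \<cdot>\<^sub>v b)"
        unfolding k(3) l(3) using k(2) l(2) by (intro eq_vecI) auto
      finally have "of_int (k * l) \<cdot>\<^sub>v (v + w) = rat_vec (l \<cdot>\<^sub>v a + k \<cdot>\<^sub>v b)" .
      moreover have "k * l > 0" using k l by simp
      ultimately have "?Q (v + w)" using int_combination k(2) l(2) by blast
      then show ?thesis using vw by (simp add: W_def module_vec_simps)
    qed
    show "c \<odot>\<^bsub>V\<^esub> v \<in> W" if "v \<in> W" for c v
    proof -
      obtain k a where k: "k > 0" "a \<in> L" "of_int k \<cdot>\<^sub>v v = rat_vec a" using \<open>v \<in> W\<close> by (auto simp: W_def)
      obtain p q where c: "c = of_int p / of_int q" "q > 0" by (metis quotient_of_denom_pos quotient_of_div surj_pair)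
      have vd: "v \<in> carrier_vec m" using that by (auto simp: W_def)
      have "of_int (q * k) \<cdot>\<^sub>v (c \<cdot>\<^sub>v v) = of_int p \<cdot>\<^sub>v (of_int k \<cdot>\<^sub>v v)"
        using vd c by (intro eq_vecI) (auto simp: field_simps)
      also have "\<dots> = rat_vec (p \<cdot>\<^sub>v a)" unfolding k(3) using k(2) by (intro eq_vecI) auto
      finally have "of_int (q * k) \<cdot>\<^sub>v (c \<cdot>\<^sub>v v) = rat_vec (p \<cdot>\<^sub>v a)" .
      moreover have "q * k > 0" using k c by simp
      ultimately have "?Q (c \<cdot>\<^sub>v v)" using smult k(2) by blast
      then show ?thesis using vd by (simp add: W_def module_vec_simps)
    qed
  qed
  have "rat_vec ` L \<subseteq> W"
  proof
    fix x assume "x \<in> rat_vec ` L"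
    then obtain a where a: "a \<in> L" "x = rat_vec a" by blast
    have "of_int 1 \<cdot>\<^sub>v x = rat_vec a" using a by (intro eq_vecI) auto
    moreover have "(0::int) < 1" by simp
    ultimately have "?Q x" using a by blast
    then show "x \<in> W" using a by (simp add: W_def)
  qed
  then have "span (rat_vec ` L) \<subseteq> W" using span_is_subset sub by blast
  moreover have "x \<in> span (rat_vec ` L)" if x: "x \<in> W" for x
  proof -
    obtain k a where k: "k > 0" "a \<in> L" "of_int k \<cdot>\<^sub>v x = rat_vec a" using x by (auto simp: W_def)
    have "rat_vec a \<in> span (rat_vec ` L)" using in_own_span[of "rat_vec ` L"] LV k(2) by auto
    then have "(1 / of_int k) \<cdot>\<^sub>v rat_vec a \<in> span (rat_vec ` L)" by (rule smult_in_span[OF LV])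
    moreover have "(1 / of_int k) \<cdot>\<^sub>v rat_vec a = x"
      unfolding k(3)[symmetric] using k(1) by (intro eq_vecI) auto
    ultimately show ?thesis by simp
  qed
  ultimately show ?thesis unfolding W_def by blast
qed

context unimodular_representation
begin

lemma finite_sign_vectors: "finite (sign_vectors m)"
proof (rule finite_subset)
  show "sign_vectors m \<subseteq> vec_of_list ` {xs. set xs \<subseteq> {-1, 1} \<and> length xs = m}"
  proof
    fix X assume X: "X \<in> sign_vectors m"
    then have "X = vec_of_list (list_of_vec X)" by (simp add: vec_list)
    moreover have "set (list_of_vec X) \<subseteq> {-1, 1}"
      using X by (auto simp: sign_vectors_def set_list_of_vec vec_set_def)
    moreover have "length (list_of_vec X) = m" using X by (simp add: sign_vectors_def)
    ultimately show "X \<in> vec_of_list ` {xs. set xs \<subseteq> {-1, 1} \<and> length xs = m}" by blast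
  qed
  show "finite (vec_of_list ` {xs :: int list. set xs \<subseteq> {-1, 1} \<and> length xs = m})"
    by (intro finite_imageI finite_lists_length_eq) simp
qed

text \<open>
  The multiples of \<open>\<gamma>\<close> move a class through the finite set of all classes, so two of them have the same
  effect, and their difference lies in \<open>L + L'\<close>.
\<close>
lemma multiple_in_sum_lattice:
  assumes g: "\<gamma> \<in> carrier_vec m"
  shows "\<exists>k>0. k \<cdot>\<^sub>v \<gamma> \<in> sum_lattice"
proof -
  obtain c where c: "c \<in> \<G>" using classes_nonempty by blast
  have kg: "int k \<cdot>\<^sub>v \<gamma> \<in> carrier_vec m" for k using g by simp
  define f where "f k = act (int k \<cdot>\<^sub>v \<gamma>) c" for k :: nat
  have "range f \<subseteq> \<G>" using act_mem[OF c kg] by (auto simp: f_def)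
  moreover have "finite \<G>" using finite_sign_vectors classes_eq by simp
  ultimately have "finite (range f)" by (rule finite_subset)
  then have "\<not> inj f" using finite_imageD infinite_UNIV_nat by blast
  then obtain i j where ij: "f i = f j" "i < j" by (metis injI linorder_neqE_nat)
  have "int j \<cdot>\<^sub>v \<gamma> - int i \<cdot>\<^sub>v \<gamma> \<in> sum_lattice" using ij(1) act_eq_iff[OF c kg kg, of j i] by (simp add: f_def)
  moreover have "int j \<cdot>\<^sub>v \<gamma> - int i \<cdot>\<^sub>v \<gamma> = (int j - int i) \<cdot>\<^sub>v \<gamma>"
    using g by (intro eq_vecI) (auto simp: algebra_simps)
  ultimately show ?thesis using ij(2) by (intro exI[of _ "int j - int i"]) simp
qed

text \<open>
  Write \<open>k z = a + b\<close> with \<open>a \<in> L\<close>, \<open>b \<in> L'\<close> and \<open>k > 0\<close>. As \<open>z\<close> and \<open>b\<close> are orthogonal to \<open>a\<close>, so is \<open>a\<close>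
  itself; thus \<open>k z = b\<close>, and \<open>L'\<close> is saturated.
\<close>
lemma orthogonal_imp_cocircuit:
  assumes z: "z \<in> carrier_vec m" and orth: "\<And>x. x \<in> L \<Longrightarrow> z \<bullet> x = 0"
  shows "z \<in> L'"
proof -
  obtain k where k: "k > 0" "k \<cdot>\<^sub>v z \<in> sum_lattice" using multiple_in_sum_lattice[OF z] by blast
  then obtain a b where ab: "a \<in> L" "b \<in> L'" "k \<cdot>\<^sub>v z = a + b" by (auto simp: sum_lattice_def)
  have "b \<bullet> a = 0" using regular_lattice_pair_axioms ab orth_sum[OF ab(1,2)]
    by (simp add: scalar_prod_def atLeast0LessThan mult.commute)
  then have "(a + b) \<bullet> a = a \<bullet> a" using ab by (simp add: add_scalar_prod_distrib[of _ m])
  moreover have "(a + b) \<bullet> a = 0" unfolding ab(3)[symmetric] using z ab(1) orth[OF ab(1)] by simp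
  ultimately have "a \<bullet> a = 0" by simp
  then have "a = 0\<^sub>v m" using int_self_orthogonal[of a m] ab(1) by simp
  then have "k \<cdot>\<^sub>v z = b" using ab by simp
  then show ?thesis using D.saturated[OF z, of k] ab(2) k(1) by simp
qed

abbreviation Ldual where "Ldual \<equiv> dual_lattice m L"

lemma dual_lattice_iff:
  "x \<in> Ldual \<longleftrightarrow> x \<in> carrier_vec m \<and> (\<exists>k>0. \<exists>a\<in>L. of_int k \<cdot>\<^sub>v x = rat_vec a) \<and> (\<forall>y\<in>L. x \<bullet> rat_vec y \<in> \<int>)"
  unfolding dual_lattice_def using P.rational_span by blast

text \<open>
  \<open>projects \<gamma> x\<close> expresses that \<open>x\<close> is the orthogonal projection of \<open>\<gamma>\<close> to the rational span of \<open>L\<close>. Such an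
  \<open>x\<close> lies in the dual lattice because its scalar products with \<open>L\<close> are those of \<open>\<gamma>\<close>.
\<close>
definition projects :: "int vec \<Rightarrow> rat vec \<Rightarrow> bool" where
  "projects \<gamma> x \<longleftrightarrow> x \<in> Ldual \<and> (\<forall>y\<in>L. x \<bullet> rat_vec y = of_int (\<gamma> \<bullet> y))"

text \<open>
  If \<open>k \<gamma> = a + b\<close> with \<open>a \<in> L\<close> and \<open>b \<in> L'\<close>, then the projection of \<open>\<gamma>\<close> is \<open>a / k\<close>.
\<close>
lemma projects_exists:
  assumes g: "\<gamma> \<in> carrier_vec m"
  shows "\<exists>x. projects \<gamma> x"
proof -
  obtain k where k: "k > 0" "k \<cdot>\<^sub>v \<gamma> \<in> sum_lattice" using multiple_in_sum_lattice[OF g] by blast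
  then obtain a b where ab: "a \<in> L" "b \<in> L'" "k \<cdot>\<^sub>v \<gamma> = a + b" by (auto simp: sum_lattice_def)
  define x where "x = (1 / of_int k) \<cdot>\<^sub>v rat_vec a"
  have xd: "x \<in> carrier_vec m" using ab by (simp add: x_def)
  have kx: "of_int k \<cdot>\<^sub>v x = rat_vec a" using k(1) by (intro eq_vecI) (auto simp: x_def)
  have val: "x \<bullet> rat_vec y = of_int (\<gamma> \<bullet> y)" if y: "y \<in> L" for y
  proof -
    have "b \<bullet> y = 0" using orth_sum[OF y ab(2)] ab y
      by (simp add: scalar_prod_def atLeast0LessThan mult.commute)
    then have "a \<bullet> y = (k \<cdot>\<^sub>v \<gamma>) \<bullet> y" unfolding ab(3) using ab y by (simp add: add_scalar_prod_distrib[of _ m])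
    also have "\<dots> = k * (\<gamma> \<bullet> y)" using g y by simp
    finally have ay: "a \<bullet> y = k * (\<gamma> \<bullet> y)" .
    have "x \<bullet> rat_vec y = (1 / of_int k) * (rat_vec a \<bullet> rat_vec y)"
      using ab y by (simp add: x_def)
    also have "rat_vec a \<bullet> rat_vec y = of_int k * of_int (\<gamma> \<bullet> y)"
      using rat_vec_scalar_prod[of a m y] ab y ay by simp
    finally show ?thesis using k(1) by simp
  qed
  then have "x \<in> Ldual" using dual_lattice_iff xd kx k(1) ab(1) by auto
  with val show ?thesis by (auto simp: projects_def)
qed

lemma span_orthogonal_zero:
  assumes x: "x \<in> carrier_vec m" "k > 0" "a \<in> L" "of_int k \<cdot>\<^sub>v x = rat_vec a"
    and orth: "\<And>y. y \<in> L \<Longrightarrow> x \<bullet> rat_vec y = 0"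
  shows "x = 0\<^sub>v m"
proof -
  have "rat_vec a \<bullet> rat_vec a = of_int k * (x \<bullet> rat_vec a)" using x(1,3) by (simp flip: x(4))
  then have "rat_of_int (a \<bullet> a) = 0" using rat_vec_scalar_prod[of a m a] x(3) orth[OF x(3)] by simp
  then have "a = 0\<^sub>v m" using int_self_orthogonal[of a m] x(3) by simp
  then have z: "of_int k \<cdot>\<^sub>v x = 0\<^sub>v m" using x(4) by (intro eq_vecI) auto
  show ?thesis
  proof (rule eq_vecI)
    fix i assume "i < dim_vec (0\<^sub>v m :: rat vec)"
    then have i: "i < m" by simp
    have "of_int k * x $ i = (of_int k \<cdot>\<^sub>v x) $ i" using i x(1) by simp
    also have "\<dots> = 0" unfolding z using i by simp
    finally show "x $ i = 0\<^sub>v m $ i" using i x(2) by simp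
  qed (use x in simp)
qed

lemma Ldual_carrier: "x \<in> Ldual \<Longrightarrow> x \<in> carrier_vec m"
  using dual_lattice_iff by blast

lemma Ldual_comb:
  assumes x: "x \<in> Ldual" and y: "y \<in> Ldual"
  shows "of_int p \<cdot>\<^sub>v x + of_int q \<cdot>\<^sub>v y \<in> Ldual"
proof -
  note d = Ldual_carrier[OF x] Ldual_carrier[OF y]
  obtain k a where k: "k > 0" "a \<in> L" "of_int k \<cdot>\<^sub>v x = rat_vec a" using x dual_lattice_iff by blast
  obtain l b where l: "l > 0" "b \<in> L" "of_int l \<cdot>\<^sub>v y = rat_vec b" using y dual_lattice_iff by blast
  let ?z = "of_int p \<cdot>\<^sub>v x + of_int q \<cdot>\<^sub>v y"
  have zd: "?z \<in> carrier_vec m" using d by simp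
  have "of_int (k * l) \<cdot>\<^sub>v ?z = of_int (l * p) \<cdot>\<^sub>v (of_int k \<cdot>\<^sub>v x) + of_int (k * q) \<cdot>\<^sub>v (of_int l \<cdot>\<^sub>v y)"
    using d by (intro eq_vecI) (auto simp: algebra_simps)
  also have "\<dots> = rat_vec ((l * p) \<cdot>\<^sub>v a + (k * q) \<cdot>\<^sub>v b)"
    unfolding k(3) l(3) using k(2) l(2) by (intro eq_vecI) auto
  finally have "of_int (k * l) \<cdot>\<^sub>v ?z = rat_vec ((l * p) \<cdot>\<^sub>v a + (k * q) \<cdot>\<^sub>v b)" .
  moreover have "k * l > 0" using k l by simp
  ultimately have "\<exists>k>0. \<exists>a\<in>L. of_int k \<cdot>\<^sub>v ?z = rat_vec a" using P.int_combination k(2) l(2) by blast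
  moreover have "?z \<bullet> rat_vec w \<in> \<int>" if w: "w \<in> L" for w
  proof -
    have "?z \<bullet> rat_vec w = of_int p * (x \<bullet> rat_vec w) + of_int q * (y \<bullet> rat_vec w)"
      using d w by (simp add: add_scalar_prod_distrib[of _ m])
    moreover have "x \<bullet> rat_vec w \<in> \<int>" "y \<bullet> rat_vec w \<in> \<int>" using x y w dual_lattice_iff by blast+
    ultimately show ?thesis by simp
  qed
  ultimately show ?thesis using dual_lattice_iff zd by blast
qed

lemma projects_unique:
  assumes x: "projects \<gamma> x" and y: "projects \<gamma> y"
  shows "x = y"
proof -
  have D: "x \<in> Ldual" "y \<in> Ldual" using x y by (auto simp: projects_def)
  note d = Ldual_carrier[OF D(1)] Ldual_carrier[OF D(2)]
  let ?z = "of_int 1 \<cdot>\<^sub>v x + of_int (-1) \<cdot>\<^sub>v y"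
  have "?z \<in> Ldual" using Ldual_comb[OF D] .
  then obtain k a where ka: "k > 0" "a \<in> L" "of_int k \<cdot>\<^sub>v ?z = rat_vec a" using dual_lattice_iff by blast
  have "?z \<bullet> rat_vec w = 0" if w: "w \<in> L" for w
    using x y w d by (simp add: projects_def add_scalar_prod_distrib[of _ m])
  then have z: "?z = 0\<^sub>v m" using span_orthogonal_zero[OF _ ka] d by simp
  show ?thesis
  proof (rule eq_vecI)
    fix i assume "i < dim_vec y"
    then have i: "i < m" using d by simp
    have "x $ i - y $ i = ?z $ i" using i d by simp
    also have "\<dots> = 0" unfolding z using i by simp
    finally show "x $ i = y $ i" by simp
  qed (use d in simp)
qed

lemma projects_add:
  assumes x: "projects \<gamma> x" and y: "projects \<delta> y" and gd: "\<gamma> \<in> carrier_vec m" "\<delta> \<in> carrier_vec m"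
  shows "projects (\<gamma> + \<delta>) (x + y)"
proof -
  have D: "x \<in> Ldual" "y \<in> Ldual" using x y by (auto simp: projects_def)
  note d = Ldual_carrier[OF D(1)] Ldual_carrier[OF D(2)]
  have "of_int 1 \<cdot>\<^sub>v x + of_int 1 \<cdot>\<^sub>v y = x + y" using d by (intro eq_vecI) auto
  then have "x + y \<in> Ldual" using Ldual_comb[OF D, of 1 1] by simp
  moreover have "(x + y) \<bullet> rat_vec w = of_int ((\<gamma> + \<delta>) \<bullet> w)" if w: "w \<in> L" for w
    using x y w d gd by (simp add: projects_def add_scalar_prod_distrib[of _ m])
  ultimately show ?thesis by (simp add: projects_def)
qed

text \<open>
  The fundamental circuits \<open>C i\<close> of a basis \<open>B\<close> generate \<open>L\<close>, and among the elements outside \<open>B\<close> only \<open>i\<close> is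
  in the support of \<open>C i\<close>. So a vector \<open>\<gamma>\<close> that is zero on \<open>B\<close> can be given any integral scalar products
  with them, in particular those of \<open>x\<close>.
\<close>
lemma projects_surj:
  assumes x: "x \<in> Ldual"
  shows "\<exists>\<gamma>\<in>carrier_vec m. projects \<gamma> x"
proof -
  obtain B where B: "P.maximal_free B {0..<m}" using P.extend_free[of "{0..<m}" "{}"] P.free_empty by auto
  have freeB: "P.free B" using B by (simp add: P.maximal_free_def)
  have "\<forall>i. \<exists>v. i < m \<and> i \<notin> B \<longrightarrow> v \<in> L \<and> v $ i = 1 \<and> supp v \<subseteq> insert i B"
  proof
    fix i show "\<exists>v. i < m \<and> i \<notin> B \<longrightarrow> v \<in> L \<and> v $ i = 1 \<and> supp v \<subseteq> insert i B"
      using fundamental_circuit[OF B, of i] by metis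
  qed
  then obtain C where "\<forall>i. i < m \<and> i \<notin> B \<longrightarrow> C i \<in> L \<and> C i $ i = 1 \<and> supp (C i) \<subseteq> insert i B"
    by (rule choice[THEN exE])
  then have C: "C i \<in> L" "C i $ i = 1" "supp (C i) \<subseteq> insert i B" if "i < m" "i \<notin> B" for i
    using that by blast+
  have int: "x \<bullet> rat_vec y \<in> \<int>" if "y \<in> L" for y using x that dual_lattice_iff by blast
  note xd = Ldual_carrier[OF x]
  define \<gamma> where "\<gamma> = vec m (\<lambda>i. if i \<in> B then 0 else \<lfloor>x \<bullet> rat_vec (C i)\<rfloor>)"
  have gd: "\<gamma> \<in> carrier_vec m" by (simp add: \<gamma>_def)
  have gC: "of_int (\<gamma> \<bullet> C i) = x \<bullet> rat_vec (C i)" if i: "i < m" "i \<notin> B" for i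
  proof -
    have "\<gamma> $ j * C i $ j = 0" if j: "j \<in> {..<m} - {i}" for j
    proof (cases "j \<in> B")
      case True then show ?thesis using j by (simp add: \<gamma>_def)
    next
      case False
      then have "j \<notin> supp (C i)" using C(3)[OF i] j by auto
      then have "C i $ j = 0" using C(1)[OF i] j by (auto simp: supp_def)
      then show ?thesis by simp
    qed
    then have "(\<Sum>j<m. \<gamma> $ j * C i $ j) = \<gamma> $ i * C i $ i"
      using i(1) by (subst sum.remove[of _ i]) (auto simp: sum.neutral)
    then have "\<gamma> \<bullet> C i = \<gamma> $ i * C i $ i" using C(1)[OF i] by (simp add: scalar_prod_def atLeast0LessThan)
    also have "\<dots> = \<lfloor>x \<bullet> rat_vec (C i)\<rfloor>" using C(2)[OF i] i by (simp add: \<gamma>_def)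
    finally show ?thesis using int[OF C(1)[OF i]] by (metis Ints_cases floor_of_int)
  qed
  have val: "x \<bullet> rat_vec y = of_int (\<gamma> \<bullet> y)" if y: "y \<in> L" for y
    using y
  proof (induction "card (supp y - B)" arbitrary: y rule: less_induct)
    case less
    note yL = less.prems
    show ?case
    proof (cases "supp y \<subseteq> B")
      case True
      then have y0: "y = 0\<^sub>v m" using freeB yL by (simp add: P.free_def)
      have ry: "rat_vec y = 0\<^sub>v m" unfolding y0 by (intro eq_vecI) auto
      have "x \<bullet> rat_vec y = 0" unfolding ry using xd by simp
      moreover have "\<gamma> \<bullet> y = 0" unfolding y0 using gd by simp
      ultimately show ?thesis by simp
    next
      case False
      then obtain i where i: "i \<in> supp y" "i \<notin> B" by blast
      then have im: "i < m" using yL by (auto simp: supp_def)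
      note Ci = C[OF im i(2)]
      define w where "w = y - y $ i \<cdot>\<^sub>v C i"
      have wL: "w \<in> L" unfolding w_def using P.diff[OF yL P.smult[OF Ci(1)]] .
      have wj: "w $ j = y $ j - y $ i * C i $ j" if "j < m" for j
        using that yL Ci(1) by (simp add: w_def)
      have "supp w - B \<subset> supp y - B"
      proof
        show "supp w - B \<subseteq> supp y - B"
        proof
          fix j assume j: "j \<in> supp w - B"
          then have jm: "j < m" "w $ j \<noteq> 0" using wL by (auto simp: supp_def)
          have "j \<noteq> i" using jm wj[OF im] Ci(2) by auto
          then have "j \<notin> supp (C i)" using Ci(3) j by blast
          then have "C i $ j = 0" using jm Ci(1) by (auto simp: supp_def)
          then have "y $ j \<noteq> 0" using wj[OF jm(1)] jm(2) by simp
          then show "j \<in> supp y - B" using j jm yL by (auto simp: supp_def)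
        qed
        have "i \<notin> supp w" using wj[OF im] Ci(2) by (simp add: supp_def)
        then show "supp w - B \<noteq> supp y - B" using i by blast
      qed
      then have "card (supp w - B) < card (supp y - B)" by (intro psubset_card_mono) auto
      from less.hyps[OF this wL] have IH: "x \<bullet> rat_vec w = of_int (\<gamma> \<bullet> w)" .
      have yw: "y = w + y $ i \<cdot>\<^sub>v C i" using yL Ci(1) by (intro eq_vecI) (auto simp: w_def)
      have "rat_vec y = rat_vec w + of_int (y $ i) \<cdot>\<^sub>v rat_vec (C i)"
        using yL Ci(1) by (intro eq_vecI) (auto simp: w_def)
      then have "x \<bullet> rat_vec y = x \<bullet> rat_vec w + of_int (y $ i) * (x \<bullet> rat_vec (C i))"
        using xd wL Ci(1) by (simp add: scalar_prod_add_distrib[of _ m])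
      also have "\<dots> = of_int (\<gamma> \<bullet> w + y $ i * (\<gamma> \<bullet> C i))" using IH gC[OF im i(2)] by simp
      also have "\<gamma> \<bullet> w + y $ i * (\<gamma> \<bullet> C i) = \<gamma> \<bullet> (w + y $ i \<cdot>\<^sub>v C i)"
        using gd wL Ci(1) by (simp add: scalar_prod_add_distrib[of _ m])
      also have "\<dots> = \<gamma> \<bullet> y" using yw by simp
      finally show ?thesis .
    qed
  qed
  then have "projects \<gamma> x" using x by (simp add: projects_def)
  with gd show ?thesis by blast
qed

lemma projects_L: "a \<in> L \<Longrightarrow> b \<in> L' \<Longrightarrow> projects (a + b) (rat_vec a)"
proof -
  assume a: "a \<in> L" and b: "b \<in> L'"
  have val: "rat_vec a \<bullet> rat_vec y = of_int ((a + b) \<bullet> y)" if y: "y \<in> L" for y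
  proof -
    have "b \<bullet> y = 0" using orth_sum[OF y b] y
      by (simp add: scalar_prod_def atLeast0LessThan mult.commute)
    then show ?thesis using a b y rat_vec_scalar_prod[of a m y] by (simp add: add_scalar_prod_distrib[of _ m])
  qed
  have "of_int 1 \<cdot>\<^sub>v rat_vec a = rat_vec a" using a by (intro eq_vecI) auto
  moreover have "(0::int) < 1" by simp
  ultimately have "\<exists>k>0. \<exists>a'\<in>L. of_int k \<cdot>\<^sub>v rat_vec a = rat_vec a'" using a by blast
  then have "rat_vec a \<in> Ldual" using dual_lattice_iff a val by auto
  with val show ?thesis by (simp add: projects_def)
qed

text \<open>
  If the projection is some \<open>a \<in> L\<close>, then \<open>\<gamma> - a\<close> is an integral vector orthogonal to \<open>L\<close>, hence in \<open>L'\<close>.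
\<close>
lemma projects_integral_iff:
  assumes g: "\<gamma> \<in> carrier_vec m" and x: "projects \<gamma> x"
  shows "x \<in> rat_vec ` L \<longleftrightarrow> \<gamma> \<in> sum_lattice"
proof
  assume "x \<in> rat_vec ` L"
  then obtain a where a: "a \<in> L" "x = rat_vec a" by blast
  have "(\<gamma> - a) \<bullet> y = 0" if y: "y \<in> L" for y
  proof -
    have "rat_of_int (a \<bullet> y) = of_int (\<gamma> \<bullet> y)"
      using x a y rat_vec_scalar_prod[of a m y] by (simp add: projects_def)
    then show ?thesis using g a y by (simp add: minus_scalar_prod_distrib[of _ m])
  qed
  then have "\<gamma> - a \<in> L'" using orthogonal_imp_cocircuit g a(1) by simp
  moreover have "\<gamma> = a + (\<gamma> - a)" using g a by (intro eq_vecI) auto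
  ultimately show "\<gamma> \<in> sum_lattice" using a(1) unfolding sum_lattice_def by blast
next
  assume "\<gamma> \<in> sum_lattice"
  then obtain a b where ab: "a \<in> L" "b \<in> L'" "\<gamma> = a + b" by (auto simp: sum_lattice_def)
  then show "x \<in> rat_vec ` L" using projects_unique[OF x] projects_L[OF ab(1,2)] by auto
qed

abbreviation Q where "Q \<equiv> monoid_vec TYPE(rat) m"

lemma Jac_eq: "Jac A = Q\<lparr>carrier := Ldual\<rparr> Mod (rat_vec ` L)"
  using A by (simp add: Jac_def)

lemma jac_class_eq: "jac_class A x = rat_vec ` L #>\<^bsub>Q\<lparr>carrier := Ldual\<rparr>\<^esub> x"
  using A by (simp add: jac_class_def r_coset_def)

lemma Ldual_subgroup: "subgroup Ldual Q"
proof (rule subgroup_monoid_vecI)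
  show "Ldual \<subseteq> carrier_vec m" using Ldual_carrier by blast
  have "rat_vec (0\<^sub>v m) = 0\<^sub>v m" by (intro eq_vecI) auto
  moreover have "rat_vec (0\<^sub>v m) \<in> Ldual" using projects_L[OF P.zero D.zero] by (simp add: projects_def)
  ultimately show "0\<^sub>v m \<in> Ldual" by metis
  show "x + y \<in> Ldual" if "x \<in> Ldual" "y \<in> Ldual" for x y
  proof -
    have "of_int 1 \<cdot>\<^sub>v x + of_int 1 \<cdot>\<^sub>v y = x + y" using that Ldual_carrier by (intro eq_vecI) auto
    then show ?thesis using Ldual_comb[OF that, of 1 1] by simp
  qed
  show "- x \<in> Ldual" if "x \<in> Ldual" for x
  proof -
    have "of_int (-1) \<cdot>\<^sub>v x + of_int 0 \<cdot>\<^sub>v x = - x" using Ldual_carrier[OF that] by (intro eq_vecI) auto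
    then show ?thesis using Ldual_comb[OF that that, of "-1" 0] by simp
  qed
qed

lemma L_normal: "rat_vec ` L \<lhd> Q\<lparr>carrier := Ldual\<rparr>"
proof -
  interpret Q: comm_group Q by (rule comm_group_vec)
  interpret DQ: comm_group "Q\<lparr>carrier := Ldual\<rparr>"
  proof (rule group.group_comm_groupI[OF Q.subgroup_imp_group[OF Ldual_subgroup]])
    fix x y assume "x \<in> carrier (Q\<lparr>carrier := Ldual\<rparr>)" "y \<in> carrier (Q\<lparr>carrier := Ldual\<rparr>)"
    then show "x \<otimes>\<^bsub>Q\<lparr>carrier := Ldual\<rparr>\<^esub> y = y \<otimes>\<^bsub>Q\<lparr>carrier := Ldual\<rparr>\<^esub> x"
      using Ldual_carrier by (simp add: monoid_vec_simps comm_add_vec[of _ m])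
  qed
  have LQ: "subgroup (rat_vec ` L) Q"
  proof (rule subgroup_monoid_vecI)
    show "rat_vec ` L \<subseteq> carrier_vec m" by auto
    have "rat_vec (0\<^sub>v m) = 0\<^sub>v m" by (intro eq_vecI) auto
    then show "0\<^sub>v m \<in> rat_vec ` L" using P.zero by force
    fix x assume "x \<in> rat_vec ` L"
    then obtain a where a: "a \<in> L" "x = rat_vec a" by blast
    have "- x = rat_vec (- a)" using a by (intro eq_vecI) auto
    then show "- x \<in> rat_vec ` L" using P.uminus[OF a(1)] by blast
    fix y assume "y \<in> rat_vec ` L"
    then obtain b where b: "b \<in> L" "y = rat_vec b" by blast
    have "x + y = rat_vec (a + b)" using a b by (intro eq_vecI) auto
    then show "x + y \<in> rat_vec ` L" using P.add[OF a(1) b(1)] by blast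
  qed
  have "rat_vec a \<in> Ldual" if "a \<in> L" for a using projects_L[OF that D.zero] by (simp add: projects_def)
  then have "subgroup (rat_vec ` L) (Q\<lparr>carrier := Ldual\<rparr>)"
    using Q.subgroup_incl[OF LQ Ldual_subgroup] by auto
  then show ?thesis by (rule DQ.subgroup_imp_normal)
qed

lemma Jac_group: "group (Jac A)"
  unfolding Jac_eq by (rule normal.factorgroup_is_group[OF L_normal])

definition proj_class :: "int vec \<Rightarrow> rat vec set" where
  "proj_class \<gamma> = jac_class A (THE x. projects \<gamma> x)"

lemma proj_class_eq: "projects \<gamma> x \<Longrightarrow> proj_class \<gamma> = jac_class A x"
  unfolding proj_class_def using projects_unique by (metis the_equality)

lemma proj_class_hom: "group_hom Z (Jac A) proj_class"
proof (rule group_hom.intro)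
  show "group Z" using comm_group.axioms(2)[OF Z_comm_group] .
  show "group (Jac A)" by (rule Jac_group)
  show "group_hom_axioms Z (Jac A) proj_class"
  proof (unfold group_hom_axioms_def, rule homI)
    show "proj_class \<gamma> \<in> carrier (Jac A)" if "\<gamma> \<in> carrier Z" for \<gamma>
    proof -
      have "\<gamma> \<in> carrier_vec m" using that by (simp add: monoid_vec_simps)
      then obtain x where x: "projects \<gamma> x" using projects_exists by blast
      then have "x \<in> Ldual" by (simp add: projects_def)
      then show ?thesis unfolding proj_class_eq[OF x] Jac_eq jac_class_eq by (simp add: carrier_FactGroup)
    qed
    fix \<gamma> \<delta> assume "\<gamma> \<in> carrier Z" "\<delta> \<in> carrier Z"
    then have gd: "\<gamma> \<in> carrier_vec m" "\<delta> \<in> carrier_vec m" by (auto simp: monoid_vec_simps)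
    obtain x y where xy: "projects \<gamma> x" "projects \<delta> y" using projects_exists gd by blast
    then have D: "x \<in> Ldual" "y \<in> Ldual" by (auto simp: projects_def)
    have "proj_class (\<gamma> + \<delta>) = jac_class A (x + y)" using proj_class_eq projects_add xy gd by blast
    also have "\<dots> = jac_class A x <#>\<^bsub>Q\<lparr>carrier := Ldual\<rparr>\<^esub> jac_class A y"
      unfolding jac_class_eq using normal.rcos_sum[OF L_normal, of x y] D by (simp add: monoid_vec_simps)
    finally show "proj_class (\<gamma> \<otimes>\<^bsub>Z\<^esub> \<delta>) = proj_class \<gamma> \<otimes>\<^bsub>Jac A\<^esub> proj_class \<delta>"
      using proj_class_eq[OF xy(1)] proj_class_eq[OF xy(2)] by (simp add: Jac_eq monoid_vec_simps)
  qed
qed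

lemma proj_class_surj: "proj_class ` carrier Z = carrier (Jac A)"
proof
  show "proj_class ` carrier Z \<subseteq> carrier (Jac A)"
    using group_hom.hom_closed[OF proj_class_hom] by blast
  show "carrier (Jac A) \<subseteq> proj_class ` carrier Z"
  proof
    fix c assume "c \<in> carrier (Jac A)"
    then obtain x where x: "x \<in> Ldual" "c = jac_class A x" by (auto simp: Jac_eq jac_class_eq carrier_FactGroup)
    obtain \<gamma> where "\<gamma> \<in> carrier_vec m" "projects \<gamma> x" using projects_surj[OF x(1)] by blast
    then show "c \<in> proj_class ` carrier Z" using proj_class_eq x(2) by (auto simp: monoid_vec_simps)
  qed
qed

lemma proj_class_kernel: "Coset.kernel Z (Jac A) proj_class = sum_lattice"
proof -
  have "proj_class \<gamma> = rat_vec ` L \<longleftrightarrow> \<gamma> \<in> sum_lattice" if g: "\<gamma> \<in> carrier_vec m" for \<gamma>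
  proof -
    interpret N: normal "rat_vec ` L" "Q\<lparr>carrier := Ldual\<rparr>" by (rule L_normal)
    obtain x where x: "projects \<gamma> x" using projects_exists[OF g] by blast
    then have D: "x \<in> Ldual" by (simp add: projects_def)
    have "proj_class \<gamma> = rat_vec ` L \<longleftrightarrow> rat_vec ` L #>\<^bsub>Q\<lparr>carrier := Ldual\<rparr>\<^esub> x = rat_vec ` L"
      unfolding proj_class_eq[OF x] jac_class_eq ..
    also have "\<dots> \<longleftrightarrow> x \<in> rat_vec ` L"
      using N.rcos_const[OF N.group_axioms] N.rcos_self[OF _ N.subgroup_axioms] D by auto
    finally show ?thesis using projects_integral_iff[OF g x] by simp
  qed
  then show ?thesis using sum_lattice_carrier by (auto simp: Coset.kernel_def Jac_eq monoid_vec_simps)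
qed

text \<open>
  The first isomorphism theorem for the map that sends \<open>\<gamma>\<close> to the class of its projection.
\<close>
lemma canonical_iso:
  obtains \<psi> where "canonical_jac_iso A \<psi>"
proof -
  interpret h: group_hom Z "Jac A" proj_class by (rule proj_class_hom)
  define \<psi> where "\<psi> = (\<lambda>X. the_elem (proj_class ` X))"
  have iso: "\<psi> \<in> iso (lattice_quotient A) (Jac A)"
    unfolding \<psi>_def lattice_quotient_eq
    using h.FactGroup_iso_set[OF proj_class_surj] by (simp add: proj_class_kernel)
  have "\<exists>x\<in>Ldual. (\<forall>y\<in>L. (rat_vec \<gamma> - x) \<bullet> rat_vec y = 0) \<and> \<psi> (quotient_class A \<gamma>) = jac_class A x"
    if g: "\<gamma> \<in> carrier_vec m" for \<gamma>
  proof -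
    obtain x where x: "projects \<gamma> x" using projects_exists[OF g] by blast
    then have D: "x \<in> Ldual" by (simp add: projects_def)
    have "(rat_vec \<gamma> - x) \<bullet> rat_vec y = 0" if y: "y \<in> L" for y
      using x y g Ldual_carrier[OF D] rat_vec_scalar_prod[of \<gamma> m y]
      by (simp add: projects_def minus_scalar_prod_distrib[of _ m])
    moreover have "proj_class ` quotient_class A \<gamma> = {proj_class \<gamma>}"
    proof -
      have "proj_class \<delta> = proj_class \<gamma>" if d: "\<delta> \<in> quotient_class A \<gamma>" for \<delta>
      proof -
        obtain k where k: "k \<in> sum_lattice" "\<delta> = k + \<gamma>"
          using d by (auto simp: quotient_class_eq r_coset_def monoid_vec_simps)
        have kd: "k \<in> carrier Z" "\<gamma> \<in> carrier Z" using sum_lattice_dim[OF k(1)] g by (auto simp: monoid_vec_simps)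
        have "proj_class k = \<one>\<^bsub>Jac A\<^esub>" using k(1) proj_class_kernel by (auto simp: Coset.kernel_def)
        then show ?thesis using h.hom_mult[OF kd] h.hom_closed[OF kd(2)] k(2)
          by (simp add: monoid_vec_simps)
      qed
      moreover have "\<gamma> \<in> quotient_class A \<gamma>"
      proof -
        have "\<gamma> - \<gamma> = 0\<^sub>v m" using g by (intro eq_vecI) auto
        then show ?thesis using mem_coset[OF g] g sum_lattice_zero by (simp add: quotient_class_eq)
      qed
      ultimately show ?thesis by blast
    qed
    ultimately show ?thesis using D proj_class_eq[OF x] by (auto simp: \<psi>_def)
  qed
  then have "canonical_jac_iso A \<psi>"
    using iso A by (simp add: canonical_jac_iso_def)
  with that show thesis .
qed

end

theorem theorem1p2p1:
  fixes A :: "int mat" and r m :: nat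
  assumes "A \<in> carrier_mat r m"
    and "vec_space.rank r (rat_mat A) = r"
    and "totally_unimodular A"
  shows "(\<forall>c\<in>reversal_classes A. \<forall>e<m. \<forall>s\<in>{1, -1}. \<exists>X\<in>c. X $ e = s)
    \<and> (\<forall>c\<in>reversal_classes A. \<forall>e<m. \<forall>X\<in>c. \<forall>Y\<in>c. X $ e = Y $ e \<longrightarrow>
         orient_class A (negate_on {e} X) = orient_class A (negate_on {e} Y))
    \<and> (\<exists>!\<phi>. rule_action A \<phi>)
    \<and> (\<exists>\<psi>. canonical_jac_iso A \<psi> \<and>
         (\<forall>\<phi>. rule_action A \<phi> \<longrightarrow>
            (\<exists>\<alpha> \<beta>. torsor (lattice_quotient A) (reversal_classes A) \<alpha>
               \<and> torsor (Jac A) (reversal_classes A) \<beta>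
               \<and> (\<forall>\<gamma>\<in>carrier_vec m. \<alpha> (quotient_class A \<gamma>) = \<phi> \<gamma>
                                    \<and> \<beta> (\<psi> (quotient_class A \<gamma>)) = \<phi> \<gamma>))))"
proof -
  interpret unimodular_representation A r m using assms by unfold_locales
  obtain \<psi> where \<psi>: "canonical_jac_iso A \<psi>" using canonical_iso .
  then have iso: "\<psi> \<in> iso (lattice_quotient A) (Jac A)" by (simp add: canonical_jac_iso_def)
  obtain \<alpha> where \<alpha>: "torsor (lattice_quotient A) \<G> \<alpha>"
    "\<And>\<gamma>. \<gamma> \<in> carrier_vec m \<Longrightarrow> \<alpha> (quotient_class A \<gamma>) = rule_map \<gamma>"
    using lattice_quotient_torsor by blast
  have grp: "group (lattice_quotient A)"
    unfolding lattice_quotient_eq by (rule normal.factorgroup_is_group[OF sum_lattice_normal])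
  define \<beta> where "\<beta> = \<alpha> \<circ> inv_into (carrier (lattice_quotient A)) \<psi>"
  note tr = torsor_transport[OF grp Jac_group iso \<alpha>(1), folded \<beta>_def]
  have \<beta>: "\<beta> (\<psi> (quotient_class A \<gamma>)) = rule_map \<gamma>" if g: "\<gamma> \<in> carrier_vec m" for \<gamma>
  proof -
    have "quotient_class A \<gamma> \<in> carrier (lattice_quotient A)"
      using g by (auto simp: quotient_class_eq lattice_quotient_eq carrier_FactGroup monoid_vec_simps)
    then show ?thesis using tr(2) \<alpha>(2)[OF g] by simp
  qed
  have 4: "\<exists>\<alpha> \<beta>. torsor (lattice_quotient A) \<G> \<alpha> \<and> torsor (Jac A) \<G> \<beta>
      \<and> (\<forall>\<gamma>\<in>carrier_vec m. \<alpha> (quotient_class A \<gamma>) = \<phi> \<gamma> \<and> \<beta> (\<psi> (quotient_class A \<gamma>)) = \<phi> \<gamma>)"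
    if "rule_action A \<phi>" for \<phi>
    unfolding rule_action_unique[OF that] using \<alpha> tr(1) \<beta> by blast
  show ?thesis
  proof (intro conjI)
    show "\<forall>c\<in>\<G>. \<forall>e<m. \<forall>s\<in>{1, -1}. \<exists>X\<in>c. X $ e = s" using class_attains_sign by blast
    show "\<forall>c\<in>\<G>. \<forall>e<m. \<forall>X\<in>c. \<forall>Y\<in>c. X $ e = Y $ e \<longrightarrow>
         orient_class A (negate_on {e} X) = orient_class A (negate_on {e} Y)"
      using negate_well_defined by blast
    show "\<exists>!\<phi>. rule_action A \<phi>" using rule_action_rule_map rule_action_unique by blast
    show "\<exists>\<psi>. canonical_jac_iso A \<psi> \<and> (\<forall>\<phi>. rule_action A \<phi> \<longrightarrow>
            (\<exists>\<alpha> \<beta>. torsor (lattice_quotient A) \<G> \<alpha> \<and> torsor (Jac A) \<G> \<beta>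
               \<and> (\<forall>\<gamma>\<in>carrier_vec m. \<alpha> (quotient_class A \<gamma>) = \<phi> \<gamma> \<and> \<beta> (\<psi> (quotient_class A \<gamma>)) = \<phi> \<gamma>)))"
      using \<psi> 4 by blast
  qed
qed

end
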